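(* Let $G$ be a quasitriangular Poisson–Lie group with quasitriangular structure $r$ and let $r_-=\frac12(r-r_{21})=r_-^{[1]}\otimes r_-^{[2]}$. The canonical compatible preconnection $\gamma$ on $G$ (the left invariant one with $\hat\Xi=0$) is given explicitly by $$\gamma(a,\tau)=(a\triangleleft r_-^{[1]})(\tau\triangleleft r_-^{[2]})-(r_-^{[1]}\triangleright a)(r_-^{[2]}\triangleright\tau)$$ for all $a\in C^\infty(G)$, $\tau\in\Omega^1(G)$. Its curvature and torsion are, for all functions $x,y,z$ and $1$-forms $\tau$, $$R(\hat x,\hat y)\tau=(n^{[1]}\triangleright x)(n^{[2]}\triangleright y)(n^{[3]}\triangleright\tau)-(x\triangleleft n^{[1]})(y\triangleleft n^{[2]})(\tau\triangleleft n^{[3]}),$$ $$T(\hat x,\hat y)(\mathrm{d}z)=(m^{[1]}\triangleright x)(m^{[2]}\triangleright y)(m^{[3]}\triangleright z)-(x\triangleleft m^{[1]})(y\triangleleft m^{[2]})(z\triangleleft m^{[3]}),$$ where $n=[[r_-,r_-]]=[r_{-12},r_{-13}]+[r_{-12},r_{-23}]+[r_{-13},r_{-23}]$ and $m=[r_{-13},r_{-23}]$.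
   Context: $\mathfrak g=T_eG$; $gv,vg$ denote the images of $v\in\mathfrak g$ in $T_gG$ under left and right translation. Quasitriangular: $\delta v=\mathrm{ad}_v(r)$ with $r\in\mathfrak g\otimes\mathfrak g$ satisfying $[r_{12},r_{13}]+[r_{12},r_{23}]+[r_{13},r_{23}]=0$ and $r_+=\frac12(r+r_{21})$ ad-invariant; the Poisson bivector is $\omega(g)=gr-rg=\omega^{[1]}(g)\otimes\omega^{[2]}(g)$ and $\{a,b\}(g)=a'(g;\omega^{[1]}(g))b'(g;\omega^{[2]}(g))$, with $a'(g;u)$ the derivative of $a$ at $g$ in direction $u\in T_gG$. Elements of tensor powers are written $n=n^{[1]}\otimes n^{[2]}\otimes n^{[3]}$ (summation understood). Actions: $(g\triangleright a)(h)=a(g^{-1}h)$, $(g\triangleright\tau)(h)=L_{g^{-1}}^*(\tau(g^{-1}h))$, $(a\triangleleft g)(h)=a(hg^{-1})$, $(\tau\triangleleft g)(h)=R_{g^{-1}}^*(\tau(hg^{-1}))$ on functions and $1$-forms; $v\triangleright$, $\triangleleft v$ for $v\in\mathfrak g$ denote the corresponding infinitesimal actions, so that $(v\triangleright a)(g)=-a'(g;vg)$ and $(a\triangleleft v)(g)=-a'(g;gv)$. Canonical preconnection: a preconnection is a map $\gamma:C^\infty(G)\times\Omega^1(G)\to\Omega^1(G)$ with $\gamma(xy,\tau)=x\gamma(y,\tau)+\gamma(x,\tau)y$, $\gamma(x,\tau y)=\gamma(x,\tau)y+\tau\{x,y\}$; it is compatible if $\mathrm{d}\{x,y\}=\gamma(x,\mathrm{d}y)-\gamma(y,\mathrm{d}x)$.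 Writing $\tilde\tau(g)(v)=\tau(g)(gv)$ and $\tilde\gamma(a,\tilde\tau)=\widetilde{\gamma(a,\tau)}$, the canonical one ($\hat\Xi=0$) is determined by $\tilde\gamma(a,s)(g)=\{a,s\}(g)+a'(g;gr_-^{[1]})\,\mathrm{ad}^*_{r_-^{[2]}}(s(g))$ for $s\in C^\infty(G,\mathfrak g^* )$, where $(\mathrm{ad}^*_v\psi)(w)=\psi([w,v])$. Curvature and torsion: $\hat x=\{x,-\}$, $\hat\nabla_x\tau=\gamma(x,\tau)$, $R(\hat x,\hat y)=\hat\nabla_x\hat\nabla_y-\hat\nabla_y\hat\nabla_x-\hat\nabla_{\{x,y\}}$, $T(\hat x,\hat y)=\hat\nabla_x\hat y-\hat\nabla_y\hat x-\widehat{\{x,y\}}$, where on vector fields $\langle\hat\nabla_xv,\tau\rangle=\hat x(\langle v,\tau\rangle)-\langle v,\hat\nabla_x\tau\rangle$; $T(\hat x,\hat y)(\mathrm{d}z)$ means $\langle T(\hat x,\hat y),\mathrm{d}z\rangle$. *)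

theory Defs
  imports "HOL-Analysis.Analysis" "HOL-Algebra.Group"
begin

section \<open>Smooth maps between open subsets of normed spaces\<close>

text \<open>Intended for open \<open>S\<close> and finite-dimensional domain.\<close>

fun Ck_on :: "nat \<Rightarrow> 'a set \<Rightarrow> ('a::real_normed_vector \<Rightarrow> 'b::real_normed_vector) \<Rightarrow> bool" where
  "Ck_on 0 S f \<longleftrightarrow> continuous_on S f"
| "Ck_on (Suc k) S f \<longleftrightarrow>
     (\<forall>x\<in>S. f differentiable (at x)) \<and>
     (\<forall>v. Ck_on k S (\<lambda>x. frechet_derivative f (at x) v))"

definition smooth_on :: "'a set \<Rightarrow> ('a::real_normed_vector \<Rightarrow> 'b::real_normed_vector) \<Rightarrow> bool" where
  "smooth_on S f \<longleftrightarrow> (\<forall>k. Ck_on k S f)"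


section \<open>Lie groups\<close>

text \<open>
  A chart is a pair \<open>(U, c)\<close> of an open set and a coordinate map. The underlying set of the group
  is the whole type \<open>'g\<close>, whose topology (Hausdorff and second countable) comes from the type
  classes. The atlas need not be maximal.
\<close>

type_synonym ('g, 'e) chart = "'g set \<times> ('g \<Rightarrow> 'e)"

record ('g, 'e) lie = "'g monoid" +
  charts :: "('g, 'e) chart set"

definition smooth_atlas ::
    "('g::{t2_space, second_countable_topology}, 'e::euclidean_space) chart set \<Rightarrow> bool" where
  "smooth_atlas A \<longleftrightarrow>
     (\<Union>(U, c)\<in>A. U) = UNIV \<and>
     (\<forall>(U, c)\<in>A. open U \<and> open (c ` U) \<and> homeomorphism U (c ` U) c (inv_into U c)) \<and>
     (\<forall>(U, c)\<in>A. \<forall>(V, d)\<in>A. smooth_on (c ` (U \<inter> V)) (d \<circ> inv_into U c))"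

text \<open>Smoothness of the multiplication \<open>G \<times> G \<rightarrow> G\<close> and of the inversion is expressed in charts;
  continuity makes the domains of the coordinate expressions open.\<close>

definition lie_group ::
    "('g::{t2_space, second_countable_topology}, 'e::euclidean_space) lie \<Rightarrow> bool" where
  "lie_group G \<longleftrightarrow>
     group G \<and> carrier G = UNIV \<and> smooth_atlas (charts G) \<and>
     continuous_on UNIV (\<lambda>(g, h). g \<otimes>\<^bsub>G\<^esub> h) \<and>
     continuous_on UNIV (\<lambda>g. inv\<^bsub>G\<^esub> g) \<and>
     (\<forall>(U, c)\<in>charts G. \<forall>(V, d)\<in>charts G. \<forall>(W, f)\<in>charts G.
        smooth_on {(p, q). p \<in> c ` U \<and> q \<in> d ` V \<and> inv_into U c p \<otimes>\<^bsub>G\<^esub> inv_into V d q \<in> W}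
          (\<lambda>(p, q). f (inv_into U c p \<otimes>\<^bsub>G\<^esub> inv_into V d q))) \<and>
     (\<forall>(U, c)\<in>charts G. \<forall>(W, f)\<in>charts G.
        smooth_on {p. p \<in> c ` U \<and> inv\<^bsub>G\<^esub> (inv_into U c p) \<in> W}
          (\<lambda>p. f (inv\<^bsub>G\<^esub> (inv_into U c p))))"

definition smooth_fun :: "('g, 'e::euclidean_space) lie \<Rightarrow> ('g \<Rightarrow> real) \<Rightarrow> bool" where
  "smooth_fun G a \<longleftrightarrow> (\<forall>(U, c)\<in>charts G. smooth_on (c ` U) (a \<circ> inv_into U c))"


section \<open>Tangent vectors, vector fields and 1-forms\<close>

text \<open>
  A tangent vector \<open>u\<close> at \<open>g\<close> is the functional \<open>a \<mapsto> a'(g; u)\<close> on smooth functions, so that the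
  derivative of \<open>a\<close> in the direction \<open>u\<close> is the application \<open>u a\<close>. Functionals are extended by
  zero to non-smooth functions, so that equality of tangent vectors is equality in HOL.
\<close>

type_synonym 'g tangent = "('g \<Rightarrow> real) \<Rightarrow> real"
type_synonym 'g form = "'g \<Rightarrow> 'g tangent \<Rightarrow> real"

definition coord_vector ::
    "('g, 'e::euclidean_space) lie \<Rightarrow> ('g, 'e) chart \<Rightarrow> 'g \<Rightarrow> 'e \<Rightarrow> 'g tangent" where
  "coord_vector G C g e = (\<lambda>a. if smooth_fun G a
     then frechet_derivative (a \<circ> inv_into (fst C) (snd C)) (at (snd C g)) e else 0)"

definition tangent_space :: "('g, 'e::euclidean_space) lie \<Rightarrow> 'g \<Rightarrow> 'g tangent set" where
  "tangent_space G g = {coord_vector G C g e | C e. C \<in> charts G \<and> g \<in> fst C}"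

definition lie_algebra :: "('g, 'e::euclidean_space) lie \<Rightarrow> 'g tangent set" where
  "lie_algebra G = tangent_space G \<one>\<^bsub>G\<^esub>"

definition linear_form_on :: "'g tangent set \<Rightarrow> ('g tangent \<Rightarrow> real) \<Rightarrow> bool" where
  "linear_form_on V \<phi> \<longleftrightarrow>
     (\<forall>X\<in>V. \<forall>Y\<in>V. \<phi> (\<lambda>a. X a + Y a) = \<phi> X + \<phi> Y) \<and>
     (\<forall>X\<in>V. \<forall>t. \<phi> (\<lambda>a. t * X a) = t * \<phi> X)"

text \<open>Smooth 1-forms; each \<open>\<tau> g\<close> is extended by zero outside \<open>T\<^sub>gG\<close>, so that equality of forms is
  equality in HOL.\<close>

definition one_forms :: "('g, 'e::euclidean_space) lie \<Rightarrow> 'g form set" where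
  "one_forms G = {\<tau>.
     (\<forall>g. linear_form_on (tangent_space G g) (\<tau> g)) \<and>
     (\<forall>g. \<forall>X. X \<notin> tangent_space G g \<longrightarrow> \<tau> g X = 0) \<and>
     (\<forall>C\<in>charts G. \<forall>e. smooth_on (snd C ` fst C)
        (\<lambda>p. let h = inv_into (fst C) (snd C) p in \<tau> h (coord_vector G C h e)))}"

definition ext_d :: "('g, 'e::euclidean_space) lie \<Rightarrow> ('g \<Rightarrow> real) \<Rightarrow> 'g form" where
  "ext_d G a = (\<lambda>g X. if X \<in> tangent_space G g then X a else 0)"

definition pairing :: "('g \<Rightarrow> 'g tangent) \<Rightarrow> 'g form \<Rightarrow> 'g \<Rightarrow> real" where
  "pairing v \<tau> = (\<lambda>g. \<tau> g (v g))"

text \<open>Push-forwards of tangent vectors, \<open>gv\<close> and \<open>vg\<close>.\<close>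

definition ltrans :: "('g, 'e::euclidean_space) lie \<Rightarrow> 'g \<Rightarrow> 'g tangent \<Rightarrow> 'g tangent" where
  "ltrans G g v = (\<lambda>a. v (\<lambda>h. a (g \<otimes>\<^bsub>G\<^esub> h)))"

definition rtrans :: "('g, 'e::euclidean_space) lie \<Rightarrow> 'g tangent \<Rightarrow> 'g \<Rightarrow> 'g tangent" where
  "rtrans G v g = (\<lambda>a. v (\<lambda>h. a (h \<otimes>\<^bsub>G\<^esub> g)))"

text \<open>The Lie bracket of \<open>T\<^sub>eG\<close>: the value at \<open>e\<close> of the commutator of the left-invariant vector
  fields \<open>g \<mapsto> gv\<close> and \<open>g \<mapsto> gw\<close>.\<close>

definition bracket :: "('g, 'e::euclidean_space) lie \<Rightarrow> 'g tangent \<Rightarrow> 'g tangent \<Rightarrow> 'g tangent" where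
  "bracket G v w = (\<lambda>a. v (\<lambda>g. ltrans G g w a) - w (\<lambda>g. ltrans G g v a))"

text \<open>\<open>(ad\<^sup>*\<^sub>v \<psi>)(w) = \<psi>([w, v])\<close>\<close>

definition coad ::
    "('g, 'e::euclidean_space) lie \<Rightarrow> 'g tangent \<Rightarrow> ('g tangent \<Rightarrow> real) \<Rightarrow> 'g tangent \<Rightarrow> real" where
  "coad G v \<psi> = (\<lambda>w. \<psi> (bracket G w v))"


section \<open>Actions on functions and 1-forms\<close>

definition lact_fun :: "('g, 'e::euclidean_space) lie \<Rightarrow> 'g \<Rightarrow> ('g \<Rightarrow> real) \<Rightarrow> 'g \<Rightarrow> real" where
  "lact_fun G g a = (\<lambda>h. a (inv\<^bsub>G\<^esub> g \<otimes>\<^bsub>G\<^esub> h))"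

definition ract_fun :: "('g, 'e::euclidean_space) lie \<Rightarrow> ('g \<Rightarrow> real) \<Rightarrow> 'g \<Rightarrow> 'g \<Rightarrow> real" where
  "ract_fun G a g = (\<lambda>h. a (h \<otimes>\<^bsub>G\<^esub> inv\<^bsub>G\<^esub> g))"

definition lact_form :: "('g, 'e::euclidean_space) lie \<Rightarrow> 'g \<Rightarrow> 'g form \<Rightarrow> 'g form" where
  "lact_form G g \<tau> = (\<lambda>h X. \<tau> (inv\<^bsub>G\<^esub> g \<otimes>\<^bsub>G\<^esub> h) (ltrans G (inv\<^bsub>G\<^esub> g) X))"

definition ract_form :: "('g, 'e::euclidean_space) lie \<Rightarrow> 'g form \<Rightarrow> 'g \<Rightarrow> 'g form" where
  "ract_form G \<tau> g = (\<lambda>h X. \<tau> (h \<otimes>\<^bsub>G\<^esub> inv\<^bsub>G\<^esub> g) (rtrans G X (inv\<^bsub>G\<^esub> g)))"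

text \<open>The infinitesimal actions differentiate the orbit maps \<open>g \<mapsto> g \<triangleright> a\<close> etc. (evaluated at a point,
  and for forms on a tangent vector) at \<open>g = e\<close> in the direction \<open>v \<in> T\<^sub>eG\<close>; as \<open>v\<close> is itself the
  derivative at \<open>e\<close> in direction \<open>v\<close>, this is application of \<open>v\<close>.\<close>

definition inf_lact_fun ::
    "('g, 'e::euclidean_space) lie \<Rightarrow> 'g tangent \<Rightarrow> ('g \<Rightarrow> real) \<Rightarrow> 'g \<Rightarrow> real" where
  "inf_lact_fun G v a = (\<lambda>h. v (\<lambda>g. lact_fun G g a h))"

definition inf_ract_fun ::
    "('g, 'e::euclidean_space) lie \<Rightarrow> ('g \<Rightarrow> real) \<Rightarrow> 'g tangent \<Rightarrow> 'g \<Rightarrow> real" where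
  "inf_ract_fun G a v = (\<lambda>h. v (\<lambda>g. ract_fun G a g h))"

definition inf_lact_form ::
    "('g, 'e::euclidean_space) lie \<Rightarrow> 'g tangent \<Rightarrow> 'g form \<Rightarrow> 'g form" where
  "inf_lact_form G v \<tau> = (\<lambda>h X. v (\<lambda>g. lact_form G g \<tau> h X))"

definition inf_ract_form ::
    "('g, 'e::euclidean_space) lie \<Rightarrow> 'g form \<Rightarrow> 'g tangent \<Rightarrow> 'g form" where
  "inf_ract_form G \<tau> v = (\<lambda>h X. v (\<lambda>g. ract_form G \<tau> g h X))"


section \<open>Tensor powers of the Lie algebra\<close>

text \<open>
  Elements of \<open>V \<otimes> V\<close> and \<open>V \<otimes> V \<otimes> V\<close> are written as finite sums of pure tensors, represented by
  lists of pairs and triples. Such a sum is zero iff every bilinear (trilinear) form vanishes on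
  it. Everything below is multilinear in the listed vectors, hence does not depend on how a tensor
  is written as a sum.
\<close>

type_synonym 'g tensor2 = "('g tangent \<times> 'g tangent) list"
type_synonym 'g tensor3 = "('g tangent \<times> 'g tangent \<times> 'g tangent) list"

definition tensor2_zero :: "'g tangent set \<Rightarrow> 'g tensor2 \<Rightarrow> bool" where
  "tensor2_zero V t \<longleftrightarrow>
     (\<forall>B. (\<forall>v\<in>V. linear_form_on V (B v)) \<and> (\<forall>v\<in>V. linear_form_on V (\<lambda>u. B u v)) \<longrightarrow>
        (\<Sum>(u, v)\<leftarrow>t. B u v) = 0)"

definition tensor3_zero :: "'g tangent set \<Rightarrow> 'g tensor3 \<Rightarrow> bool" where
  "tensor3_zero V t \<longleftrightarrow>
     (\<forall>B. (\<forall>u\<in>V. \<forall>v\<in>V. linear_form_on V (\<lambda>w. B u v w)) \<and>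
          (\<forall>u\<in>V. \<forall>w\<in>V. linear_form_on V (\<lambda>v. B u v w)) \<and>
          (\<forall>v\<in>V. \<forall>w\<in>V. linear_form_on V (\<lambda>u. B u v w)) \<longrightarrow>
        (\<Sum>(u, v, w)\<leftarrow>t. B u v w) = 0)"

text \<open>\<open>r\<^sub>+ = (r + r\<^sub>2\<^sub>1)/2\<close> and \<open>r\<^sub>- = (r - r\<^sub>2\<^sub>1)/2\<close>\<close>

definition sym_part :: "'g tensor2 \<Rightarrow> 'g tensor2" where
  "sym_part r = map (\<lambda>(u, v). (\<lambda>a. u a / 2, v)) r @ map (\<lambda>(u, v). (\<lambda>a. v a / 2, u)) r"

definition skew_part :: "'g tensor2 \<Rightarrow> 'g tensor2" where
  "skew_part r = map (\<lambda>(u, v). (\<lambda>a. u a / 2, v)) r @ map (\<lambda>(u, v). (\<lambda>a. - (v a / 2), u)) r"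

text \<open>\<open>[t\<^sub>1\<^sub>2, t\<^sub>1\<^sub>3]\<close>, \<open>[t\<^sub>1\<^sub>2, t\<^sub>2\<^sub>3]\<close> and \<open>[t\<^sub>1\<^sub>3, t\<^sub>2\<^sub>3]\<close>\<close>

definition br1213 :: "('g, 'e::euclidean_space) lie \<Rightarrow> 'g tensor2 \<Rightarrow> 'g tensor3" where
  "br1213 G t = [(bracket G u u', v, v'). (u, v) \<leftarrow> t, (u', v') \<leftarrow> t]"

definition br1223 :: "('g, 'e::euclidean_space) lie \<Rightarrow> 'g tensor2 \<Rightarrow> 'g tensor3" where
  "br1223 G t = [(u, bracket G v u', v'). (u, v) \<leftarrow> t, (u', v') \<leftarrow> t]"

definition br1323 :: "('g, 'e::euclidean_space) lie \<Rightarrow> 'g tensor2 \<Rightarrow> 'g tensor3" where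
  "br1323 G t = [(u, u', bracket G v v'). (u, v) \<leftarrow> t, (u', v') \<leftarrow> t]"

definition schouten :: "('g, 'e::euclidean_space) lie \<Rightarrow> 'g tensor2 \<Rightarrow> 'g tensor3" where
  "schouten G t = br1213 G t @ br1223 G t @ br1323 G t"

definition ad2 :: "('g, 'e::euclidean_space) lie \<Rightarrow> 'g tangent \<Rightarrow> 'g tensor2 \<Rightarrow> 'g tensor2" where
  "ad2 G x t = map (\<lambda>(u, v). (bracket G x u, v)) t @ map (\<lambda>(u, v). (u, bracket G x v)) t"


section \<open>Quasitriangular Poisson--Lie groups\<close>

type_synonym 'g poisson = "('g \<Rightarrow> real) \<Rightarrow> ('g \<Rightarrow> real) \<Rightarrow> 'g \<Rightarrow> real"

definition poisson_structure ::
    "('g, 'e::euclidean_space) lie \<Rightarrow> 'g poisson \<Rightarrow> bool" where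
  "poisson_structure G P \<longleftrightarrow>
     (\<forall>x y. smooth_fun G x \<longrightarrow> smooth_fun G y \<longrightarrow> smooth_fun G (P x y)) \<and>
     (\<forall>x y z s t. smooth_fun G x \<longrightarrow> smooth_fun G y \<longrightarrow> smooth_fun G z \<longrightarrow>
        P x (\<lambda>g. s * y g + t * z g) = (\<lambda>g. s * P x y g + t * P x z g)) \<and>
     (\<forall>x y. smooth_fun G x \<longrightarrow> smooth_fun G y \<longrightarrow> P x y = (\<lambda>g. - P y x g)) \<and>
     (\<forall>x y z. smooth_fun G x \<longrightarrow> smooth_fun G y \<longrightarrow> smooth_fun G z \<longrightarrow>
        P x (\<lambda>g. y g * z g) = (\<lambda>g. P x y g * z g + y g * P x z g)) \<and>
     (\<forall>x y z. smooth_fun G x \<longrightarrow> smooth_fun G y \<longrightarrow> smooth_fun G z \<longrightarrow>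
        (\<forall>g. P x (P y z) g + P y (P z x) g + P z (P x y) g = 0))"

text \<open>The last condition says that multiplication \<open>G \<times> G \<rightarrow> G\<close> is a Poisson map for the product
  Poisson structure.\<close>

definition poisson_lie_group ::
    "('g::{t2_space, second_countable_topology}, 'e::euclidean_space) lie \<Rightarrow> 'g poisson \<Rightarrow> bool" where
  "poisson_lie_group G P \<longleftrightarrow>
     lie_group G \<and> poisson_structure G P \<and>
     (\<forall>a b g h. smooth_fun G a \<longrightarrow> smooth_fun G b \<longrightarrow>
        P a b (g \<otimes>\<^bsub>G\<^esub> h) =
          P (\<lambda>k. a (k \<otimes>\<^bsub>G\<^esub> h)) (\<lambda>k. b (k \<otimes>\<^bsub>G\<^esub> h)) g +
          P (\<lambda>k. a (g \<otimes>\<^bsub>G\<^esub> k)) (\<lambda>k. b (g \<otimes>\<^bsub>G\<^esub> k)) h)"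

text \<open>\<open>\<omega>(g) = gr - rg\<close> as a sum of pure tensors in \<open>T\<^sub>gG \<otimes> T\<^sub>gG\<close>, and
  \<open>{a, b}(g) = a'(g; \<omega>\<^sup>1(g)) b'(g; \<omega>\<^sup>2(g))\<close>.\<close>

definition bivector :: "('g, 'e::euclidean_space) lie \<Rightarrow> 'g tensor2 \<Rightarrow> 'g \<Rightarrow> 'g tensor2" where
  "bivector G r g =
     map (\<lambda>(u, v). (ltrans G g u, ltrans G g v)) r @
     map (\<lambda>(u, v). (\<lambda>a. - rtrans G u g a, rtrans G v g)) r"

definition pl_bracket :: "('g, 'e::euclidean_space) lie \<Rightarrow> 'g tensor2 \<Rightarrow> 'g poisson" where
  "pl_bracket G r a b = (\<lambda>g. \<Sum>(u, v)\<leftarrow>bivector G r g. u a * v b)"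

text \<open>The condition \<open>\<delta>v = ad\<^sub>v(r)\<close> on the cobracket needs no separate clause: \<open>\<delta>\<close> is the derivative at
  \<open>e\<close> of \<open>g \<mapsto> \<omega>(g)g\<^sup>-\<^sup>1 = Ad\<^sub>g(r) - r\<close>.\<close>

definition quasitriangular_poisson_lie_group ::
    "('g::{t2_space, second_countable_topology}, 'e::euclidean_space) lie \<Rightarrow> 'g tensor2 \<Rightarrow> bool" where
  "quasitriangular_poisson_lie_group G r \<longleftrightarrow>
     set r \<subseteq> lie_algebra G \<times> lie_algebra G \<and>
     tensor3_zero (lie_algebra G) (schouten G r) \<and>
     (\<forall>x\<in>lie_algebra G. tensor2_zero (lie_algebra G) (ad2 G x (sym_part r))) \<and>
     poisson_lie_group G (pl_bracket G r)"


section \<open>Preconnections\<close>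

type_synonym 'g preconn = "('g \<Rightarrow> real) \<Rightarrow> 'g form \<Rightarrow> 'g form"

definition preconnection ::
    "('g, 'e::euclidean_space) lie \<Rightarrow> 'g poisson \<Rightarrow> 'g preconn \<Rightarrow> bool" where
  "preconnection G P \<gamma> \<longleftrightarrow>
     (\<forall>x \<tau>. smooth_fun G x \<longrightarrow> \<tau> \<in> one_forms G \<longrightarrow> \<gamma> x \<tau> \<in> one_forms G) \<and>
     (\<forall>x y \<tau>. smooth_fun G x \<longrightarrow> smooth_fun G y \<longrightarrow> \<tau> \<in> one_forms G \<longrightarrow>
        \<gamma> (\<lambda>g. x g * y g) \<tau> = (\<lambda>g X. x g * \<gamma> y \<tau> g X + \<gamma> x \<tau> g X * y g)) \<and>
     (\<forall>x y \<tau>. smooth_fun G x \<longrightarrow> smooth_fun G y \<longrightarrow> \<tau> \<in> one_forms G \<longrightarrow>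
        \<gamma> x (\<lambda>g X. \<tau> g X * y g) = (\<lambda>g X. \<gamma> x \<tau> g X * y g + \<tau> g X * P x y g))"

definition compatible ::
    "('g, 'e::euclidean_space) lie \<Rightarrow> 'g poisson \<Rightarrow> 'g preconn \<Rightarrow> bool" where
  "compatible G P \<gamma> \<longleftrightarrow>
     (\<forall>x y. smooth_fun G x \<longrightarrow> smooth_fun G y \<longrightarrow>
        ext_d G (P x y) = (\<lambda>g X. \<gamma> x (ext_d G y) g X - \<gamma> y (ext_d G x) g X))"

text \<open>\<open>to_alg\<close> is \<open>\<tau> \<mapsto> \<tau>~\<close>, \<open>\<tau>~(g)(v) = \<tau>(g)(gv)\<close>, from 1-forms to functions with values in the dual
  of \<open>T\<^sub>eG\<close>; \<open>of_alg\<close> is its inverse.\<close>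

definition to_alg :: "('g, 'e::euclidean_space) lie \<Rightarrow> 'g form \<Rightarrow> 'g form" where
  "to_alg G \<tau> = (\<lambda>g v. \<tau> g (ltrans G g v))"

definition of_alg :: "('g, 'e::euclidean_space) lie \<Rightarrow> 'g form \<Rightarrow> 'g form" where
  "of_alg G s = (\<lambda>g X. if X \<in> tangent_space G g then s g (ltrans G (inv\<^bsub>G\<^esub> g) X) else 0)"

text \<open>The bracket of a function with a dual-valued function \<open>s\<close> is taken componentwise.\<close>

definition canonical_alg ::
    "('g, 'e::euclidean_space) lie \<Rightarrow> 'g tensor2 \<Rightarrow> ('g \<Rightarrow> real) \<Rightarrow> 'g form \<Rightarrow> 'g form" where
  "canonical_alg G r a s = (\<lambda>g w.
     pl_bracket G r a (\<lambda>h. s h w) g +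
     (\<Sum>(u, v)\<leftarrow>skew_part r. ltrans G g u a * coad G v (s g) w))"

definition canonical_preconnection ::
    "('g, 'e::euclidean_space) lie \<Rightarrow> 'g tensor2 \<Rightarrow> 'g preconn" where
  "canonical_preconnection G r a \<tau> = of_alg G (canonical_alg G r a (to_alg G \<tau>))"

definition curvature :: "'g poisson \<Rightarrow> 'g preconn \<Rightarrow> ('g \<Rightarrow> real) \<Rightarrow> ('g \<Rightarrow> real) \<Rightarrow> 'g form \<Rightarrow> 'g form" where
  "curvature P \<gamma> x y \<tau> = (\<lambda>g X. \<gamma> x (\<gamma> y \<tau>) g X - \<gamma> y (\<gamma> x \<tau>) g X - \<gamma> (P x y) \<tau> g X)"

definition hamiltonian :: "'g poisson \<Rightarrow> ('g \<Rightarrow> real) \<Rightarrow> 'g \<Rightarrow> 'g tangent" where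
  "hamiltonian P x = (\<lambda>g a. P x a g)"

text \<open>The covariant derivative of a vector field \<open>v\<close> is given, as in the theory of preconnections, by
  its pairing with 1-forms: \<open>nabla_pairing P \<gamma> x v \<tau>\<close> is \<open>\<langle>\<nabla>\<^sub>x v, \<tau>\<rangle>\<close>, and \<open>torsion_pairing P \<gamma> x y \<tau>\<close> is
  \<open>\<langle>T(x, y), \<tau>\<rangle>\<close>.\<close>

definition nabla_pairing ::
    "'g poisson \<Rightarrow> 'g preconn \<Rightarrow> ('g \<Rightarrow> real) \<Rightarrow> ('g \<Rightarrow> 'g tangent) \<Rightarrow> 'g form \<Rightarrow> 'g \<Rightarrow> real" where
  "nabla_pairing P \<gamma> x v \<tau> = (\<lambda>g. P x (pairing v \<tau>) g - pairing v (\<gamma> x \<tau>) g)"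

definition torsion_pairing ::
    "'g poisson \<Rightarrow> 'g preconn \<Rightarrow> ('g \<Rightarrow> real) \<Rightarrow> ('g \<Rightarrow> real) \<Rightarrow> 'g form \<Rightarrow> 'g \<Rightarrow> real" where
  "torsion_pairing P \<gamma> x y \<tau> = (\<lambda>g.
     nabla_pairing P \<gamma> x (hamiltonian P y) \<tau> g - nabla_pairing P \<gamma> y (hamiltonian P x) \<tau> g -
     pairing (hamiltonian P (P x y)) \<tau> g)"

end

theory Submission
  imports Defs
begin

text \<open>
  The statement is a formal consequence of the properties of the two infinitesimal actions of the
  Lie algebra. Write \<open>A\<^sub>v\<close> for the right action of \<open>v\<close>, which on functions is minus the left-invariant
  vector field \<open>g \<mapsto> gv\<close>, and \<open>B\<^sub>v\<close> for the left action, on functions minus the right-invariant field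
  \<open>g \<mapsto> vg\<close>, and let \<open>r\<^sub>- = \<Sum>\<^sub>i u\<^sub>i \<otimes> v\<^sub>i\<close>.

  The Poisson bracket is antisymmetric, so the symmetric part of \<open>r\<close> contributes nothing to \<open>gr - rg\<close>
  and \<open>{a, b} = \<Sum>\<^sub>i A\<^bsub>u\<^sub>i\<^esub>a A\<^bsub>v\<^sub>i\<^esub>b - B\<^bsub>u\<^sub>i\<^esub>a B\<^bsub>v\<^sub>i\<^esub>b\<close> (\<open>pl_bracket_eq\<close>). A 1-form \<open>\<tau>\<close> is determined by the
  functions \<open>g \<mapsto> \<tau>(g)(gw)\<close>, its components in the left trivialisation. On them \<open>B\<^sub>v\<close> acts
  componentwise, while \<open>A\<^sub>v\<close> has an additional term that evaluates \<open>\<tau>\<close> on \<open>[v, w]\<close>, the derivative of the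
  adjoint action (\<open>to_alg_inf_lact_form\<close>, \<open>to_alg_inf_ract_form\<close>). This term is the coadjoint term in
  the definition of the canonical preconnection, which gives
  \<open>\<gamma>(a, \<tau>) = \<Sum>\<^sub>i A\<^bsub>u\<^sub>i\<^esub>a A\<^bsub>v\<^sub>i\<^esub>\<tau> - B\<^bsub>u\<^sub>i\<^esub>a B\<^bsub>v\<^sub>i\<^esub>\<tau>\<close> (\<open>canonical_eq\<close>).

  The operators \<open>A\<^sub>v\<close> and \<open>B\<^sub>v\<close> are derivations, commute with the exterior derivative, every \<open>A\<^sub>u\<close> commutes
  with every \<open>B\<^sub>v\<close>, and both families represent the bracket: \<open>A\<^sub>v A\<^sub>u - A\<^sub>u A\<^sub>v = A\<^bsub>[u,v]\<^esub>\<close> and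
  \<open>B\<^sub>u B\<^sub>v - B\<^sub>v B\<^sub>u = B\<^bsub>[u,v]\<^esub>\<close> (\<open>inf_fun_commute\<close>, \<open>inf_form_commute\<close>, \<open>inf_form_ext_d\<close>). Curvature and
  torsion expand into double sums over two copies of \<open>r\<^sub>-\<close>. All terms that mix \<open>A\<close> and \<open>B\<close> cancel. In the
  curvature, the commutators that hit \<open>\<tau>\<close>, \<open>y\<close> and \<open>x\<close> are the three terms of \<open>[[r\<^sub>-, r\<^sub>-]]\<close>, where skewness
  of \<open>r\<^sub>-\<close> is needed for those that hit \<open>x\<close>. In the torsion the Jacobi identity of the Poisson bracket
  removes everything that does not involve \<open>\<gamma>\<close>, and only the commutators that hit \<open>z\<close> are left.

  The analysis behind these rules is elementary. A tangent vector is a functional on smooth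
  functions, so that invariant vector fields are obtained by applying a functional to one argument
  of a smooth function of two variables. Such applications commute (symmetry of second
  derivatives, \<open>tangent_apply_commute\<close>) and satisfy a chain rule on the diagonal
  (\<open>tangent_apply_diagonal\<close>). The Lie algebra is a finite-dimensional space of functionals, hence has
  a frame \<open>E\<^sub>i\<close> and smooth functions \<open>\<phi>\<^sub>i\<close> on the whole group with \<open>v = \<Sum>\<^sub>i v(\<phi>\<^sub>i) E\<^sub>i\<close> (\<open>ex_dual_frame\<close>). This
  shows that \<open>[v, w]\<close>, computed as the derivative of \<open>g \<mapsto> Ad\<^sub>g w\<close>, is a tangent vector again, and that
  1-forms correspond to smooth functions with values in the dual of the Lie algebra.
\<close>

section \<open>Smooth maps between normed spaces\<close>

lemma Ck_on_subset: "Ck_on k S f \<Longrightarrow> T \<subseteq> S \<Longrightarrow> Ck_on k T f"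
  by (induction k arbitrary: f) (auto intro: continuous_on_subset)

lemma Ck_on_cong:
  assumes "open S" "\<And>x. x \<in> S \<Longrightarrow> f x = g x" "Ck_on k S f"
  shows "Ck_on k S g"
  using assms(2,3)
proof (induction k arbitrary: f g)
  case 0
  then show ?case using continuous_on_cong[of S S f g] by simp
next
  case (Suc k)
  have d: "f differentiable (at x)" if "x \<in> S" for x using Suc.prems that by simp
  have "g differentiable (at x)" if "x \<in> S" for x
    using d[OF that] that assms(1) Suc.prems(1)
    by (metis differentiable_def has_derivative_transform_within_open)
  moreover have "Ck_on k S (\<lambda>x. frechet_derivative g (at x) v)" for v
  proof (rule Suc.IH)
    show "Ck_on k S (\<lambda>x. frechet_derivative f (at x) v)" using Suc.prems by simp
    show "frechet_derivative f (at x) v = frechet_derivative g (at x) v" if "x \<in> S" for x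
      using frechet_derivative_transform_within_open[OF d[OF that] assms(1) that] Suc.prems(1) by metis
  qed
  ultimately show ?case by simp
qed

text \<open>
  Differentiability and continuity at a point only see a neighbourhood of it. This is used to pass
  between charts, whose domains cover the group only together.
\<close>
lemma Ck_on_local:
  assumes "\<And>x. x \<in> S \<Longrightarrow> \<exists>T. open T \<and> x \<in> T \<and> Ck_on k T f"
  shows "Ck_on k S f"
  using assms
proof (induction k arbitrary: f)
  case 0
  have "continuous (at x) f" if "x \<in> S" for x
    using 0[OF that] continuous_on_eq_continuous_at by fastforce
  then show ?case by (simp add: continuous_at_imp_continuous_on)
next
  case (Suc k)
  show ?case
  proof (simp, intro conjI ballI allI)
    show "f differentiable (at x)" if "x \<in> S" for x using Suc.prems[OF that] by auto
    show "Ck_on k S (\<lambda>x. frechet_derivative f (at x) v)" for v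
      by (rule Suc.IH) (use Suc.prems in fastforce)
  qed
qed

lemma Ck_on_Suc_D: "Ck_on (Suc k) S f \<Longrightarrow> Ck_on k S f"
proof (induction k arbitrary: f)
  case 0
  then show ?case
    by (auto intro!: continuous_at_imp_continuous_on differentiable_imp_continuous_within)
next
  case (Suc k)
  then show ?case using Ck_on.simps(2) by metis
qed

lemma Ck_on_has_derivative:
  "Ck_on (Suc k) S f \<Longrightarrow> x \<in> S \<Longrightarrow> (f has_derivative frechet_derivative f (at x)) (at x)"
  using frechet_derivative_works by auto

lemma Ck_on_SucI:
  assumes "open S" "\<And>x. x \<in> S \<Longrightarrow> (f has_derivative f' x) (at x)" "\<And>v. Ck_on k S (\<lambda>x. f' x v)"
  shows "Ck_on (Suc k) S f"
proof -
  have "Ck_on k S (\<lambda>x. frechet_derivative f (at x) v)" for v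
    by (rule Ck_on_cong[OF assms(1) _ assms(3)[of v]]) (metis assms(2) frechet_derivative_at)
  moreover have "f differentiable (at x)" if "x \<in> S" for x
    using assms(2)[OF that] by (auto simp: differentiable_def)
  ultimately show ?thesis by simp
qed

lemma Ck_on_const: "Ck_on k S (\<lambda>x. c)"
  by (induction k arbitrary: c) (auto simp: continuous_on_const)

lemma Ck_on_bounded_linear:
  assumes "bounded_linear L" "Ck_on k S f" "open S"
  shows "Ck_on k S (\<lambda>x. L (f x))"
  using assms(2)
proof (induction k arbitrary: f)
  case 0
  then show ?case using bounded_linear.continuous_on[OF assms(1)] by auto
next
  case (Suc k)
  show ?case
  proof (rule Ck_on_SucI[OF assms(3)])
    show "((\<lambda>x. L (f x)) has_derivative (\<lambda>v. L (frechet_derivative f (at x) v))) (at x)" if "x \<in> S" for x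
      using bounded_linear.has_derivative[OF assms(1) Ck_on_has_derivative[OF Suc.prems that]] .
    show "Ck_on k S (\<lambda>x. L (frechet_derivative f (at x) v))" for v
      using Suc by simp
  qed
qed

lemma Ck_on_id: "open S \<Longrightarrow> Ck_on k S (\<lambda>x. x)"
  by (cases k) (auto intro!: Ck_on_SucI Ck_on_const has_derivative_ident continuous_on_id simp del: Ck_on.simps(2))

lemma Ck_on_Pair:
  assumes "Ck_on k S f" "Ck_on k S g" "open S"
  shows "Ck_on k S (\<lambda>x. (f x, g x))"
  using assms(1,2)
proof (induction k arbitrary: f g)
  case 0
  then show ?case by (auto intro: continuous_on_Pair)
next
  case (Suc k)
  show ?case
  proof (rule Ck_on_SucI[OF assms(3)])
    show "((\<lambda>x. (f x, g x)) has_derivative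
        (\<lambda>v. (frechet_derivative f (at x) v, frechet_derivative g (at x) v))) (at x)" if "x \<in> S" for x
      using has_derivative_Pair[OF Ck_on_has_derivative[OF Suc.prems(1) that] Ck_on_has_derivative[OF Suc.prems(2) that]] .
    show "Ck_on k S (\<lambda>x. (frechet_derivative f (at x) v, frechet_derivative g (at x) v))" for v
      using Suc by simp
  qed
qed

lemma Ck_on_add:
  assumes "Ck_on k S f" "Ck_on k S g" "open S"
  shows "Ck_on k S (\<lambda>x. f x + g x)"
  using assms(1,2)
proof (induction k arbitrary: f g)
  case 0
  then show ?case by (auto intro: continuous_on_add)
next
  case (Suc k)
  show ?case
  proof (rule Ck_on_SucI[OF assms(3)])
    show "((\<lambda>x. f x + g x) has_derivative
        (\<lambda>v. frechet_derivative f (at x) v + frechet_derivative g (at x) v)) (at x)" if "x \<in> S" for x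
      using has_derivative_add[OF Ck_on_has_derivative[OF Suc.prems(1) that] Ck_on_has_derivative[OF Suc.prems(2) that]] .
    show "Ck_on k S (\<lambda>x. frechet_derivative f (at x) v + frechet_derivative g (at x) v)" for v
      using Suc by simp
  qed
qed

lemma Ck_on_sum:
  assumes "\<And>i. i \<in> I \<Longrightarrow> Ck_on k S (f i)" "open S"
  shows "Ck_on k S (\<lambda>x. \<Sum>i\<in>I. f i x)"
  using assms(1)
  by (induction I rule: infinite_finite_induct) (auto intro: Ck_on_const Ck_on_add assms(2))

lemma Ck_on_scaleR:
  assumes "Ck_on k S f" "Ck_on k S g" "open S"
  shows "Ck_on k S (\<lambda>x. f x *\<^sub>R g x)"
  using assms(1,2)
proof (induction k arbitrary: f g)
  case 0
  then show ?case by (auto intro: continuous_on_scaleR)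
next
  case (Suc k)
  show ?case
  proof (rule Ck_on_SucI[OF assms(3)])
    show "((\<lambda>x. f x *\<^sub>R g x) has_derivative
        (\<lambda>v. f x *\<^sub>R frechet_derivative g (at x) v + frechet_derivative f (at x) v *\<^sub>R g x)) (at x)" if "x \<in> S" for x
      using has_derivative_scaleR[OF Ck_on_has_derivative[OF Suc.prems(1) that] Ck_on_has_derivative[OF Suc.prems(2) that]] .
    show "Ck_on k S (\<lambda>x. f x *\<^sub>R frechet_derivative g (at x) v + frechet_derivative f (at x) v *\<^sub>R g x)" for v
      using Suc.prems Suc.prems[THEN Ck_on_Suc_D] by (intro Ck_on_add Suc.IH assms(3)) auto
  qed
qed

text \<open>
  Induction on \<open>k\<close>. The recursion of \<open>Ck_on\<close> speaks about derivatives in fixed directions, whereas in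
  the chain rule the direction \<open>Dg(x) v\<close> varies with \<open>x\<close>. A finite basis of the middle space removes this:
  the derivative of the composition is a sum of products of components of \<open>Dg(x) v\<close> with derivatives
  of \<open>f\<close> in basis directions.
\<close>
lemma Ck_on_compose:
  fixes g :: "'a::real_normed_vector \<Rightarrow> 'b::euclidean_space"
  assumes "Ck_on k T f" "Ck_on k S g" "open S" "g ` S \<subseteq> T"
  shows "Ck_on k S (\<lambda>x. f (g x))"
  using assms(1,2)
proof (induction k arbitrary: f)
  case 0
  then show ?case using continuous_on_compose2 assms(4) by auto
next
  case (Suc k)
  show ?case
  proof (rule Ck_on_SucI[OF assms(3)])
    fix x assume x: "x \<in> S"
    show "((\<lambda>x. f (g x)) has_derivative
        (\<lambda>v. \<Sum>b\<in>Basis. (frechet_derivative g (at x) v \<bullet> b) *\<^sub>R frechet_derivative f (at (g x)) b)) (at x)"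
    proof -
      have f: "(f has_derivative frechet_derivative f (at (g x))) (at (g x))"
        using Ck_on_has_derivative[OF Suc.prems(1)] x assms(4) by auto
      interpret F: linear "frechet_derivative f (at (g x))"
        using has_derivative_linear[OF f] .
      have "frechet_derivative f (at (g x)) w = (\<Sum>b\<in>Basis. (w \<bullet> b) *\<^sub>R frechet_derivative f (at (g x)) b)" for w
        by (subst euclidean_representation[symmetric, of w]) (simp only: F.sum F.scale)
      note this[of "frechet_derivative g (at x) v" for v, symmetric]
      then show ?thesis
        by (simp only:) (rule has_derivative_compose[OF Ck_on_has_derivative[OF Suc.prems(2) x] f])
    qed
  next
    fix v
    have "Ck_on k S (\<lambda>x. frechet_derivative f (at (g x)) b)" for b
      by (rule Suc.IH) (use Suc.prems(1) Ck_on_Suc_D[OF Suc.prems(2)] in auto)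
    moreover have "Ck_on k S (\<lambda>x. frechet_derivative g (at x) v \<bullet> b)" for b
      using Suc.prems by (intro Ck_on_bounded_linear[OF bounded_linear_inner_left]) (auto simp: assms(3))
    ultimately show "Ck_on k S (\<lambda>x. \<Sum>b\<in>Basis. (frechet_derivative g (at x) v \<bullet> b) *\<^sub>R frechet_derivative f (at (g x)) b)"
      by (intro Ck_on_sum Ck_on_scaleR assms(3))
  qed
qed

lemma smooth_on_subset: "smooth_on S f \<Longrightarrow> T \<subseteq> S \<Longrightarrow> smooth_on T f"
  unfolding smooth_on_def by (blast intro: Ck_on_subset)

lemma smooth_on_cong:
  "open S \<Longrightarrow> smooth_on S f \<Longrightarrow> (\<And>x. x \<in> S \<Longrightarrow> f x = g x) \<Longrightarrow> smooth_on S g"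
  unfolding smooth_on_def using Ck_on_cong by blast

lemma smooth_on_local:
  "(\<And>x. x \<in> S \<Longrightarrow> \<exists>T. open T \<and> x \<in> T \<and> smooth_on T f) \<Longrightarrow> smooth_on S f"
  unfolding smooth_on_def using Ck_on_local by meson

lemma smooth_on_has_derivative:
  "smooth_on S f \<Longrightarrow> x \<in> S \<Longrightarrow> (f has_derivative frechet_derivative f (at x)) (at x)"
  unfolding smooth_on_def using Ck_on_has_derivative by blast

lemma smooth_on_derivative:
  "smooth_on S f \<Longrightarrow> smooth_on S (\<lambda>x. frechet_derivative f (at x) v)"
  unfolding smooth_on_def using Ck_on.simps(2) by blast

lemma smooth_on_continuous: "smooth_on S f \<Longrightarrow> continuous_on S f"
  unfolding smooth_on_def using Ck_on.simps(1) by blast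

lemma smooth_on_const: "smooth_on S (\<lambda>x. c)"
  and smooth_on_id: "open S \<Longrightarrow> smooth_on S (\<lambda>x. x)"
  and smooth_on_Pair: "smooth_on S f \<Longrightarrow> smooth_on S h \<Longrightarrow> open S \<Longrightarrow> smooth_on S (\<lambda>x. (f x, h x))"
  and smooth_on_bounded_linear: "bounded_linear L \<Longrightarrow> smooth_on S f \<Longrightarrow> open S \<Longrightarrow> smooth_on S (\<lambda>x. L (f x))"
  unfolding smooth_on_def by (simp_all add: Ck_on_const Ck_on_id Ck_on_Pair Ck_on_bounded_linear)

lemma smooth_on_add: "smooth_on S f \<Longrightarrow> smooth_on S g \<Longrightarrow> open S \<Longrightarrow> smooth_on S (\<lambda>x. f x + g x)"
  and smooth_on_scaleR: "smooth_on S h \<Longrightarrow> smooth_on S g \<Longrightarrow> open S \<Longrightarrow> smooth_on S (\<lambda>x. h x *\<^sub>R g x)"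
  unfolding smooth_on_def by (simp_all add: Ck_on_add Ck_on_scaleR)

lemma smooth_on_mult:
  fixes f g :: "'a::real_normed_vector \<Rightarrow> real"
  shows "smooth_on S f \<Longrightarrow> smooth_on S g \<Longrightarrow> open S \<Longrightarrow> smooth_on S (\<lambda>x. f x * g x)"
  using smooth_on_scaleR[of S f g] by simp

lemma smooth_on_sum:
  "(\<And>i. i \<in> I \<Longrightarrow> smooth_on S (f i)) \<Longrightarrow> open S \<Longrightarrow> smooth_on S (\<lambda>x. \<Sum>i\<in>I. f i x)"
  unfolding smooth_on_def by (simp add: Ck_on_sum)

lemma smooth_on_compose:
  fixes g :: "'a::real_normed_vector \<Rightarrow> 'b::euclidean_space"
  assumes "smooth_on T f" "smooth_on S g" "open S" "g ` S \<subseteq> T"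
  shows "smooth_on S (\<lambda>x. f (g x))"
  unfolding smooth_on_def
proof
  fix k show "Ck_on k S (\<lambda>x. f (g x))"
    by (rule Ck_on_compose[of k T f S g]) (use assms in \<open>simp_all add: smooth_on_def\<close>)
qed

section \<open>Symmetry of second derivatives\<close>

text \<open>
  Apply the mean value theorem along \<open>v\<close>, to \<open>s \<mapsto> f (p + s v + h w) - f (p + s v)\<close>, and then along \<open>w\<close>, to the
  derivative of \<open>f\<close> in direction \<open>v\<close>.
\<close>
lemma second_difference_quotient:
  fixes f :: "'a::real_normed_vector \<Rightarrow> real"
  assumes "open S" "Ck_on 2 S f" "p \<in> S"
  shows "\<exists>d>0. \<forall>h. 0 < h \<and> h < d \<longrightarrow> 
     (\<exists>q. norm (q - p) \<le> h * (norm v + norm w) \<and>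
      f (p + h *\<^sub>R v + h *\<^sub>R w) - f (p + h *\<^sub>R v) - f (p + h *\<^sub>R w) + f p
      = h * h * frechet_derivative (\<lambda>x. frechet_derivative f (at x) v) (at q) w)"
proof -
  obtain e where e: "e > 0" "ball p e \<subseteq> S" using assms(1,3) open_contains_ball by blast
  \<comment> \<open>Points \<open>p + s v + t w\<close> with \<open>0 \<le> s, t < ?d\<close> stay in the ball; the summand \<open>1\<close> is for \<open>v = w = 0\<close>.\<close>
  let ?d = "e / (norm v + norm w + 1)"
  let ?f' = "\<lambda>x. frechet_derivative f (at x)"
  let ?f'' = "\<lambda>x. frechet_derivative (\<lambda>x. frechet_derivative f (at x) v) (at x)"
  have der1: "(f has_derivative ?f' x) (at x)" if "x \<in> S" for x
    using assms(2) that Ck_on_has_derivative[of 1 S f] by (simp add: numeral_2_eq_2)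
  have der2: "((\<lambda>x. ?f' x v) has_derivative ?f'' x) (at x)" if "x \<in> S" for x
    using assms(2) that Ck_on_has_derivative[of 0 S "\<lambda>x. ?f' x v"] by (simp add: numeral_2_eq_2)
  have nv: "norm v + norm w + 1 > 0" by (smt (verit) norm_ge_zero)
  show ?thesis
  proof (intro exI[of _ ?d] conjI allI impI)
    show "?d > 0" using e nv by simp
    fix h :: real assume h: "0 < h \<and> h < ?d"
    have inS: "p + s *\<^sub>R v + t *\<^sub>R w \<in> S" and near: "norm (p + s *\<^sub>R v + t *\<^sub>R w - p) \<le> h * (norm v + norm w)"
      if "0 \<le> s" "s \<le> h" "0 \<le> t" "t \<le> h" for s t
    proof -
      have "norm (p + s *\<^sub>R v + t *\<^sub>R w - p) \<le> norm (s *\<^sub>R v) + norm (t *\<^sub>R w)"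
        using norm_triangle_ineq[of "s *\<^sub>R v" "t *\<^sub>R w"] by (simp add: algebra_simps)
      also have "\<dots> \<le> h * norm v + h * norm w"
        using that by (intro add_mono) (simp_all add: mult_right_mono)
      finally show 1: "norm (p + s *\<^sub>R v + t *\<^sub>R w - p) \<le> h * (norm v + norm w)" by (simp add: algebra_simps)
      have "h * (norm v + norm w) \<le> h * (norm v + norm w + 1)" using h by (simp add: algebra_simps)
      also have "\<dots> < e" using h nv by (simp add: pos_less_divide_eq)
      finally show "p + s *\<^sub>R v + t *\<^sub>R w \<in> S"
        using 1 e(2) by (auto simp: dist_norm norm_minus_commute subset_iff)
    qed
    let ?g = "\<lambda>s. f (p + s *\<^sub>R v + h *\<^sub>R w) - f (p + s *\<^sub>R v)"
    have "(?g has_real_derivative (?f' (p + s *\<^sub>R v + h *\<^sub>R w) v - ?f' (p + s *\<^sub>R v) v)) (at s)"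
      if "0 \<le> s" "s \<le> h" for s
    proof -
      have "((\<lambda>s. f (p + s *\<^sub>R v + t *\<^sub>R w)) has_derivative (\<lambda>k. ?f' (p + s *\<^sub>R v + t *\<^sub>R w) (k *\<^sub>R v))) (at s)"
        if "0 \<le> t" "t \<le> h" for t
        using inS[OF \<open>0 \<le> s\<close> \<open>s \<le> h\<close> that]
        by (intro has_derivative_compose[of "\<lambda>s. p + s *\<^sub>R v + t *\<^sub>R w" _ _ _ f] der1)
           (auto intro!: derivative_eq_intros)
      from this[of h] this[of 0] h
      have "(?g has_derivative (\<lambda>k. ?f' (p + s *\<^sub>R v + h *\<^sub>R w) (k *\<^sub>R v) - ?f' (p + s *\<^sub>R v) (k *\<^sub>R v))) (at s)"
        by (intro has_derivative_diff) simp_all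
      moreover have "?f' x (k *\<^sub>R v) = k * ?f' x v" if "x \<in> S" for x k
        using linear_scale[OF has_derivative_linear[OF der1[OF that]]] by simp
      moreover have "p + s *\<^sub>R v + h *\<^sub>R w \<in> S" "p + s *\<^sub>R v \<in> S"
        using inS[of s h] inS[of s 0] that h by auto
      ultimately have "(?g has_derivative (\<lambda>k. (?f' (p + s *\<^sub>R v + h *\<^sub>R w) v - ?f' (p + s *\<^sub>R v) v) * k)) (at s)"
        by (simp add: algebra_simps)
      then show ?thesis
        by (simp add: has_field_derivative_def)
    qed
    from MVT2[of 0 h ?g, OF _ this] h obtain s where s: "0 < s" "s < h"
      "?g h - ?g 0 = h * (?f' (p + s *\<^sub>R v + h *\<^sub>R w) v - ?f' (p + s *\<^sub>R v) v)" by auto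
    let ?k = "\<lambda>t. ?f' (p + s *\<^sub>R v + t *\<^sub>R w) v"
    have "(?k has_real_derivative ?f'' (p + s *\<^sub>R v + t *\<^sub>R w) w) (at t)" if "0 \<le> t" "t \<le> h" for t
    proof -
      have S: "p + s *\<^sub>R v + t *\<^sub>R w \<in> S" using inS s that by simp
      have "(?k has_derivative (\<lambda>k. ?f'' (p + s *\<^sub>R v + t *\<^sub>R w) (k *\<^sub>R w))) (at t)"
        using S by (intro has_derivative_compose[of "\<lambda>t. p + s *\<^sub>R v + t *\<^sub>R w" _ _ _ "\<lambda>x. ?f' x v"] der2)
           (auto intro!: derivative_eq_intros)
      moreover have "?f'' (p + s *\<^sub>R v + t *\<^sub>R w) (k *\<^sub>R w) = k * ?f'' (p + s *\<^sub>R v + t *\<^sub>R w) w" for k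
        using linear_scale[OF has_derivative_linear[OF der2[OF S]]] by simp
      ultimately show ?thesis by (simp add: has_field_derivative_def mult_commute_abs)
    qed
    from MVT2[of 0 h ?k, OF _ this] h obtain t where t: "0 < t" "t < h"
      "?k h - ?k 0 = h * ?f'' (p + s *\<^sub>R v + t *\<^sub>R w) w" by auto
    show "\<exists>q. norm (q - p) \<le> h * (norm v + norm w) \<and>
      f (p + h *\<^sub>R v + h *\<^sub>R w) - f (p + h *\<^sub>R v) - f (p + h *\<^sub>R w) + f p = h * h * ?f'' q w"
      using s t near[of s t] by (intro exI[of _ "p + s *\<^sub>R v + t *\<^sub>R w"]) (auto simp: algebra_simps)
  qed
qed

lemma second_difference_quotient_tendsto:
  fixes f :: "'a::real_normed_vector \<Rightarrow> real"
  assumes "open S" "Ck_on 2 S f" "p \<in> S"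
  shows "((\<lambda>h. (f (p + h *\<^sub>R v + h *\<^sub>R w) - f (p + h *\<^sub>R v) - f (p + h *\<^sub>R w) + f p) / (h * h))
      \<longlongrightarrow> frechet_derivative (\<lambda>x. frechet_derivative f (at x) v) (at p) w) (at_right 0)"
    (is "(?Q \<longlongrightarrow> ?f'' p) _")
proof (rule tendstoI)
  fix e :: real assume "e > 0"
  have "continuous_on S ?f''" using assms(2) by (simp add: numeral_2_eq_2)
  then have "continuous (at p) ?f''" using assms continuous_on_eq_continuous_at by blast
  then obtain c where c: "c > 0" "\<And>q. norm (q - p) < c \<Longrightarrow> dist (?f'' q) (?f'' p) < e"
    using \<open>e > 0\<close> unfolding continuous_at_eps_delta dist_norm by blast
  obtain d where d: "d > 0" "\<And>h. 0 < h \<and> h < d \<Longrightarrow> 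
     (\<exists>q. norm (q - p) \<le> h * (norm v + norm w) \<and>
      f (p + h *\<^sub>R v + h *\<^sub>R w) - f (p + h *\<^sub>R v) - f (p + h *\<^sub>R w) + f p = h * h * ?f'' q)"
    using second_difference_quotient[OF assms, of v w] by blast
  have nv: "norm v + norm w + 1 > 0" by (smt (verit) norm_ge_zero)
  let ?d = "min d (c / (norm v + norm w + 1))"
  have "dist (?Q h) (?f'' p) < e" if h: "0 < h" "h < ?d" for h
  proof -
    obtain q where q: "norm (q - p) \<le> h * (norm v + norm w)"
      "f (p + h *\<^sub>R v + h *\<^sub>R w) - f (p + h *\<^sub>R v) - f (p + h *\<^sub>R w) + f p = h * h * ?f'' q"
      using d(2)[of h] h by auto
    have "h * (norm v + norm w) \<le> h * (norm v + norm w + 1)" using h by (simp add: algebra_simps)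
    also have "\<dots> < c" using h nv by (simp add: pos_less_divide_eq)
    finally have "dist (?f'' q) (?f'' p) < e" using q(1) c(2) by simp
    then show ?thesis using q(2) h by simp
  qed
  moreover have "?d > 0" using d(1) c(1) nv by simp
  ultimately show "\<forall>\<^sub>F h in at_right 0. dist (?Q h) (?f'' p) < e"
    using eventually_at_right_real[of 0 ?d] by (auto elim!: eventually_mono)
qed

text \<open>
  The second difference does not change when \<open>v\<close> and \<open>w\<close> are exchanged, hence neither does its limit.
\<close>
lemma symmetric_second_derivative:
  fixes f :: "'a::real_normed_vector \<Rightarrow> real"
  assumes "open S" "smooth_on S f" "p \<in> S"
  shows "frechet_derivative (\<lambda>x. frechet_derivative f (at x) v) (at p) w
       = frechet_derivative (\<lambda>x. frechet_derivative f (at x) w) (at p) v"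
proof -
  have C2: "Ck_on 2 S f" using assms(2) by (simp add: smooth_on_def)
  have eq: "(\<lambda>h. (f (p + h *\<^sub>R w + h *\<^sub>R v) - f (p + h *\<^sub>R w) - f (p + h *\<^sub>R v) + f p) / (h * h))
    = (\<lambda>h. (f (p + h *\<^sub>R v + h *\<^sub>R w) - f (p + h *\<^sub>R v) - f (p + h *\<^sub>R w) + f p) / (h * h))"
    by (simp add: algebra_simps)
  show ?thesis
    using second_difference_quotient_tendsto[OF assms(1) C2 assms(3), of v w]
      second_difference_quotient_tendsto[OF assms(1) C2 assms(3), of w v]
    unfolding eq by (rule tendsto_unique[OF trivial_limit_at_right_real])
qed

section \<open>Partial derivatives and finite frames\<close>

lemma frechet_derivative_partial:
  fixes \<Phi> :: "'a::euclidean_space \<times> 'b::euclidean_space \<Rightarrow> 'c::real_normed_vector"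
  assumes "smooth_on S \<Phi>" "(p, q) \<in> S"
  shows "frechet_derivative (\<lambda>x. \<Phi> (x, q)) (at p) d = frechet_derivative \<Phi> (at (p, q)) (d, 0)"
    and "frechet_derivative (\<lambda>y. \<Phi> (p, y)) (at q) d' = frechet_derivative \<Phi> (at (p, q)) (0, d')"
proof -
  note \<Phi> = smooth_on_has_derivative[OF assms]
  have "((\<lambda>x. \<Phi> (x, q)) has_derivative (\<lambda>d. frechet_derivative \<Phi> (at (p, q)) (d, 0))) (at p)"
    by (rule has_derivative_compose[of "\<lambda>x. (x, q)" _ _ _ \<Phi>, OF _ \<Phi>]) (auto intro!: derivative_eq_intros)
  then show "frechet_derivative (\<lambda>x. \<Phi> (x, q)) (at p) d = frechet_derivative \<Phi> (at (p, q)) (d, 0)"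
    by (simp add: frechet_derivative_at[symmetric])
  have "((\<lambda>y. \<Phi> (p, y)) has_derivative (\<lambda>d. frechet_derivative \<Phi> (at (p, q)) (0, d))) (at q)"
    by (rule has_derivative_compose[of "\<lambda>y. (p, y)" _ _ _ \<Phi>, OF _ \<Phi>]) (auto intro!: derivative_eq_intros)
  then show "frechet_derivative (\<lambda>y. \<Phi> (p, y)) (at q) d' = frechet_derivative \<Phi> (at (p, q)) (0, d')"
    by (simp add: frechet_derivative_at[symmetric])
qed

text \<open>
  Induction on the dimension of \<open>W\<close>. If \<open>L w\<^sub>0 \<psi> = 1\<close> for some \<open>w\<^sub>0 \<in> W\<close>, take a frame of the subspace where
  \<open>L w \<psi> = 0\<close>, and add \<open>\<psi>\<close> together with \<open>w\<^sub>0\<close> minus its expansion in that frame. Every \<open>\<phi> i\<close> is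
  non-trivial for \<open>L\<close>; when \<open>L w\<close> runs through tangent vectors this forces \<open>\<phi> i\<close> to be smooth.
\<close>
lemma finite_frame:
  fixes L :: "'d::euclidean_space \<Rightarrow> 'x \<Rightarrow> real"
  assumes lin: "\<And>x. linear (\<lambda>d. L d x)" and W: "subspace W"
  shows "\<exists>(n::nat) E \<phi>. (\<forall>i<n. E i \<in> W \<and> (\<exists>w. L w (\<phi> i) \<noteq> 0)) \<and>
           (\<forall>w\<in>W. \<forall>x. L w x = (\<Sum>i<n. L w (\<phi> i) * L (E i) x))"
  using W
proof (induction "dim W" arbitrary: W rule: less_induct)
  case less
  show ?case
  proof (cases "\<forall>w\<in>W. \<forall>x. L w x = 0")
    case True
    then show ?thesis by (intro exI[of _ 0]) auto
  next
    case False
    then obtain w1 \<psi> where w1: "w1 \<in> W" "L w1 \<psi> \<noteq> 0" by auto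
    define w0 where "w0 = (1 / L w1 \<psi>) *\<^sub>R w1"
    have w0: "w0 \<in> W" "L w0 \<psi> = 1"
      using w1 less.prems linear_scale[OF lin] by (auto simp: w0_def subspace_scale)
    let ?W = "{w \<in> W. L w \<psi> = 0}"
    have sub: "subspace ?W"
      using less.prems linear_add[OF lin] linear_scale[OF lin] linear_0[OF lin]
      by (auto simp: subspace_def)
    moreover have "dim ?W < dim W"
    proof (rule dim_psubset)
      have "w0 \<in> W - ?W" using w0 by simp
      then show "span ?W \<subset> span W"
        unfolding span_eq_iff[THEN iffD2, OF sub] span_eq_iff[THEN iffD2, OF less.prems] by auto
    qed
    ultimately obtain n E \<phi> where IH: "\<And>i. i < n \<Longrightarrow> E i \<in> ?W \<and> (\<exists>w. L w (\<phi> i) \<noteq> 0)"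
      "\<And>w x. w \<in> ?W \<Longrightarrow> L w x = (\<Sum>i<(n::nat). L w (\<phi> i) * L (E i) x)"
      using less.hyps[of ?W] by blast
    define e where "e = w0 - (\<Sum>i<n. L w0 (\<phi> i) *\<^sub>R E i)"
    have e: "e \<in> W" unfolding e_def
      using IH(1) less.prems w0(1) by (intro subspace_diff subspace_sum subspace_scale) auto
    have Le: "L e x = L w0 x - (\<Sum>i<n. L w0 (\<phi> i) * L (E i) x)" for x
      by (simp add: e_def linear_diff[OF lin] linear_sum[OF lin] linear_scale[OF lin])
    have "L w x = (\<Sum>i<n. L w (\<phi> i) * L (E i) x) + L w \<psi> * L e x" if w: "w \<in> W" for w x
    proof -
      have L: "L (w - L w \<psi> *\<^sub>R w0) y = L w y - L w \<psi> * L w0 y" for y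
        using linear_diff[OF lin] linear_scale[OF lin] by simp
      have "w - L w \<psi> *\<^sub>R w0 \<in> ?W"
        using w w0 less.prems L[of \<psi>] by (simp add: subspace_diff subspace_scale)
      from IH(2)[OF this, of x] show ?thesis
        unfolding L Le by (simp add: algebra_simps sum_subtractf sum_distrib_left)
    qed
    note expand = this
    define E' \<phi>' where "E' i = (if i < n then E i else e)" and "\<phi>' i = (if i < n then \<phi> i else \<psi>)" for i
    show ?thesis
    proof (intro exI[of _ "Suc n"] exI[of _ E'] exI[of _ \<phi>'] conjI allI impI ballI)
      fix w x assume "w \<in> W"
      then show "L w x = (\<Sum>i<Suc n. L w (\<phi>' i) * L (E' i) x)"
        by (rule trans[OF expand]) (simp add: E'_def \<phi>'_def)
    qed (use IH(1) e w1 in \<open>auto simp: E'_def \<phi>'_def\<close>)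
  qed
qed

section \<open>Charts and plots\<close>

locale lie_group_structure =
  fixes G :: "('g::{t2_space, second_countable_topology}, 'e::euclidean_space) lie" (structure)
  assumes lie_group: "lie_group G"
begin

lemma carrier_UNIV [simp]: "carrier G = UNIV"
  using lie_group by (simp add: lie_group_def)

sublocale group G
  using lie_group by (simp add: lie_group_def)

abbreviation chart_inv :: "('g, 'e) chart \<Rightarrow> 'e \<Rightarrow> 'g" where
  "chart_inv C \<equiv> inv_into (fst C) (snd C)"

abbreviation chart_image :: "('g, 'e) chart \<Rightarrow> 'e set" where
  "chart_image C \<equiv> snd C ` fst C"

lemma atlas: "smooth_atlas (charts G)"
  using lie_group by (simp add: lie_group_def)

lemma chart_at: obtains C where "C \<in> charts G" "g \<in> fst C"
proof -
  have "g \<in> (\<Union>(U, c)\<in>charts G. U)" using atlas by (simp add: smooth_atlas_def)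
  then show ?thesis using that by fastforce
qed

lemma chart_homeomorphism:
  assumes "C \<in> charts G"
  shows "open (fst C)" "open (chart_image C)" "homeomorphism (fst C) (chart_image C) (snd C) (chart_inv C)"
  using atlas assms by (auto simp: smooth_atlas_def)

lemma chart_inv_chart [simp]: "C \<in> charts G \<Longrightarrow> g \<in> fst C \<Longrightarrow> chart_inv C (snd C g) = g"
  and chart_chart_inv [simp]: "C \<in> charts G \<Longrightarrow> p \<in> chart_image C \<Longrightarrow> snd C (chart_inv C p) = p"
  using chart_homeomorphism(3)[of C] by (auto simp: homeomorphism_def)

lemma chart_inv_in [simp]: "p \<in> chart_image C \<Longrightarrow> chart_inv C p \<in> fst C"
  by (rule inv_into_into)

lemma continuous_on_chart_inv: "C \<in> charts G \<Longrightarrow> continuous_on (chart_image C) (chart_inv C)"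
  using chart_homeomorphism(3)[of C] by (auto simp: homeomorphism_def)

text \<open>
  Smooth maps from open subsets of Euclidean spaces into the group. They serve as test maps, as in
  diffeology: a function is smooth if it is smooth along plots, and a map of the group is
  well-behaved if it carries plots to plots. Taking the domain in \<open>'e \<times> 'e\<close> treats functions of two
  group elements without a manifold structure on \<open>G \<times> G\<close>.
\<close>
definition plot :: "'d::euclidean_space set \<Rightarrow> ('d \<Rightarrow> 'g) \<Rightarrow> bool" where
  "plot S \<rho> \<longleftrightarrow> open S \<and> continuous_on S \<rho> \<and>
     (\<forall>C\<in>charts G. smooth_on (S \<inter> \<rho> -` fst C) (\<lambda>p. snd C (\<rho> p)))"

lemma plot_open: "plot S \<rho> \<Longrightarrow> open S"
  by (simp add: plot_def)

lemma plot_open_vimage: "plot S \<rho> \<Longrightarrow> open V \<Longrightarrow> open (S \<inter> \<rho> -` V)"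
  by (simp add: plot_def continuous_open_preimage)

lemma plot_smooth_on_chart:
  "plot S \<rho> \<Longrightarrow> C \<in> charts G \<Longrightarrow> smooth_on (S \<inter> \<rho> -` fst C) (\<lambda>p. snd C (\<rho> p))"
  by (simp add: plot_def)

lemma plot_chart_inv:
  assumes C: "C \<in> charts G" shows "plot (chart_image C) (chart_inv C)"
  unfolding plot_def
proof (intro conjI ballI)
  fix D assume D: "D \<in> charts G"
  have "chart_image C \<inter> chart_inv C -` fst D = snd C ` (fst C \<inter> fst D)"
    using C by (auto simp: image_iff)
  moreover have "\<forall>(U, c)\<in>charts G. \<forall>(V, d)\<in>charts G. smooth_on (c ` (U \<inter> V)) (d \<circ> inv_into U c)"
    using atlas unfolding smooth_atlas_def by blast
  note this[unfolded case_prod_unfold, rule_format, OF C D]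
  ultimately show "smooth_on (chart_image C \<inter> chart_inv C -` fst D) (\<lambda>p. snd D (chart_inv C p))"
    by (simp add: comp_def)
qed (use chart_homeomorphism continuous_on_chart_inv C in auto)

lemma plot_compose:
  fixes f :: "'a::euclidean_space \<Rightarrow> 'b::euclidean_space"
  assumes "plot T \<rho>" "smooth_on S f" "open S" "f ` S \<subseteq> T"
  shows "plot S (\<lambda>p. \<rho> (f p))"
proof -
  have cont: "continuous_on S (\<lambda>p. \<rho> (f p))"
    using assms(1) by (intro continuous_on_compose2[OF _ smooth_on_continuous[OF assms(2)] assms(4)]) (simp add: plot_def)
  show ?thesis
    unfolding plot_def
  proof (intro conjI ballI)
    fix C assume C: "C \<in> charts G"
    let ?R = "S \<inter> (\<lambda>p. \<rho> (f p)) -` fst C"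
    have "open ?R" using cont assms(3) C chart_homeomorphism(1) by (blast intro: continuous_open_preimage)
    then show "smooth_on ?R (\<lambda>p. snd C (\<rho> (f p)))"
      by (rule smooth_on_compose[OF plot_smooth_on_chart[OF assms(1) C] smooth_on_subset[OF assms(2)], rotated])
        (use assms(4) in auto)
  qed (use assms cont in auto)
qed

lemma plot_const: "open S \<Longrightarrow> plot S (\<lambda>p. g)"
  by (simp add: plot_def smooth_on_const continuous_on_const)

text \<open>
  Near a given point the product factors through the expression of the multiplication in charts
  around the two factors and the product.
\<close>
lemma plot_mult:
  assumes \<rho>: "plot S \<rho>" and \<sigma>: "plot S \<sigma>"
  shows "plot S (\<lambda>p. \<rho> p \<otimes> \<sigma> p)"
proof -
  have mult: "\<forall>(U, c)\<in>charts G. \<forall>(V, d)\<in>charts G. \<forall>(W, f)\<in>charts G.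
        smooth_on {(p, q). p \<in> c ` U \<and> q \<in> d ` V \<and> inv_into U c p \<otimes> inv_into V d q \<in> W}
          (\<lambda>(p, q). f (inv_into U c p \<otimes> inv_into V d q))"
    using lie_group unfolding lie_group_def by (elim conjE)
  have "continuous_on UNIV (\<lambda>(g, h). g \<otimes> h)" using lie_group by (simp add: lie_group_def)
  from continuous_on_compose2[OF this, of S "\<lambda>p. (\<rho> p, \<sigma> p)"]
  have cont: "continuous_on S (\<lambda>p. \<rho> p \<otimes> \<sigma> p)"
    using \<rho> \<sigma> by (auto simp: plot_def intro: continuous_on_Pair)
  show ?thesis
    unfolding plot_def
  proof (intro conjI ballI)
    fix W assume W: "W \<in> charts G"
    show "smooth_on (S \<inter> (\<lambda>p. \<rho> p \<otimes> \<sigma> p) -` fst W) (\<lambda>p. snd W (\<rho> p \<otimes> \<sigma> p))"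
    proof (rule smooth_on_local)
      fix p assume p: "p \<in> S \<inter> (\<lambda>p. \<rho> p \<otimes> \<sigma> p) -` fst W"
      obtain C where C: "C \<in> charts G" "\<rho> p \<in> fst C" by (rule chart_at)
      obtain D where D: "D \<in> charts G" "\<sigma> p \<in> fst D" by (rule chart_at)
      let ?M = "{(x, y). x \<in> chart_image C \<and> y \<in> chart_image D \<and> chart_inv C x \<otimes> chart_inv D y \<in> fst W}"
      let ?T = "(S \<inter> \<rho> -` fst C) \<inter> (S \<inter> \<sigma> -` fst D) \<inter> (S \<inter> (\<lambda>p. \<rho> p \<otimes> \<sigma> p) -` fst W)"
      have T: "open ?T"
        using plot_open_vimage[OF \<rho>, of "fst C"] plot_open_vimage[OF \<sigma>, of "fst D"]
          continuous_open_preimage[OF cont plot_open[OF \<rho>], of "fst W"] chart_homeomorphism(1) C D W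
        by - (rule open_Int[OF open_Int], auto)
      have "smooth_on ?M (\<lambda>(x, y). snd W (chart_inv C x \<otimes> chart_inv D y))"
        using mult[unfolded case_prod_unfold, rule_format, OF C(1) D(1) W] unfolding case_prod_unfold .
      moreover have "smooth_on ?T (\<lambda>p. (snd C (\<rho> p), snd D (\<sigma> p)))"
        by (intro smooth_on_Pair T smooth_on_subset[OF plot_smooth_on_chart[OF \<rho> C(1)]]
            smooth_on_subset[OF plot_smooth_on_chart[OF \<sigma> D(1)]]) auto
      ultimately have "smooth_on ?T (\<lambda>p. (\<lambda>(x, y). snd W (chart_inv C x \<otimes> chart_inv D y)) (snd C (\<rho> p), snd D (\<sigma> p)))"
        by (rule smooth_on_compose[OF _ _ T]) (use C D in auto)
      then have "smooth_on ?T (\<lambda>p. snd W (\<rho> p \<otimes> \<sigma> p))"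
        by (rule smooth_on_cong[OF T]) (use C D in auto)
      then show "\<exists>T. open T \<and> p \<in> T \<and> smooth_on T (\<lambda>p. snd W (\<rho> p \<otimes> \<sigma> p))"
        using T p C(2) D(2) by (intro exI[of _ ?T]) auto
    qed
  qed (use \<rho> cont in \<open>auto simp: plot_def\<close>)
qed

lemma plot_inverse:
  assumes \<rho>: "plot S \<rho>"
  shows "plot S (\<lambda>p. inv (\<rho> p))"
proof -
  have inverse: "\<forall>(U, c)\<in>charts G. \<forall>(W, f)\<in>charts G.
        smooth_on {p. p \<in> c ` U \<and> inv (inv_into U c p) \<in> W} (\<lambda>p. f (inv (inv_into U c p)))"
    using lie_group unfolding lie_group_def by (elim conjE)
  have "continuous_on UNIV (\<lambda>g. inv g)" using lie_group by (simp add: lie_group_def)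
  from continuous_on_compose2[OF this, of S \<rho>]
  have cont: "continuous_on S (\<lambda>p. inv (\<rho> p))"
    using \<rho> by (auto simp: plot_def)
  show ?thesis
    unfolding plot_def
  proof (intro conjI ballI)
    fix W assume W: "W \<in> charts G"
    show "smooth_on (S \<inter> (\<lambda>p. inv (\<rho> p)) -` fst W) (\<lambda>p. snd W (inv (\<rho> p)))"
    proof (rule smooth_on_local)
      fix p assume p: "p \<in> S \<inter> (\<lambda>p. inv (\<rho> p)) -` fst W"
      obtain C where C: "C \<in> charts G" "\<rho> p \<in> fst C" by (rule chart_at)
      let ?M = "{x. x \<in> chart_image C \<and> inv (chart_inv C x) \<in> fst W}"
      let ?T = "(S \<inter> \<rho> -` fst C) \<inter> (S \<inter> (\<lambda>p. inv (\<rho> p)) -` fst W)"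
      have T: "open ?T"
        using plot_open_vimage[OF \<rho>, of "fst C"]
          continuous_open_preimage[OF cont plot_open[OF \<rho>], of "fst W"] chart_homeomorphism(1) C W
        by - (rule open_Int, auto)
      have "smooth_on ?M (\<lambda>x. snd W (inv (chart_inv C x)))"
        using inverse[unfolded case_prod_unfold, rule_format, OF C(1) W] .
      moreover have "smooth_on ?T (\<lambda>p. snd C (\<rho> p))"
        by (intro smooth_on_subset[OF plot_smooth_on_chart[OF \<rho> C(1)]]) auto
      ultimately have "smooth_on ?T (\<lambda>p. snd W (inv (chart_inv C (snd C (\<rho> p)))))"
        by (rule smooth_on_compose[OF _ _ T]) (use C in auto)
      then have "smooth_on ?T (\<lambda>p. snd W (inv (\<rho> p)))"
        by (rule smooth_on_cong[OF T]) (use C in auto)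
      then show "\<exists>T. open T \<and> p \<in> T \<and> smooth_on T (\<lambda>p. snd W (inv (\<rho> p)))"
        using T p C(2) by (intro exI[of _ ?T]) auto
    qed
  qed (use \<rho> cont in \<open>auto simp: plot_def\<close>)
qed

lemma smooth_fun_iff: "smooth_fun G a \<longleftrightarrow> (\<forall>C\<in>charts G. smooth_on (chart_image C) (\<lambda>p. a (chart_inv C p)))"
  by (auto simp: smooth_fun_def comp_def split: prod.splits)

lemma smooth_fun_plot:
  assumes \<rho>: "plot S \<rho>" and a: "smooth_fun G a"
  shows "smooth_on S (\<lambda>p. a (\<rho> p))"
proof (rule smooth_on_local)
  fix p assume p: "p \<in> S"
  obtain C where C: "C \<in> charts G" "\<rho> p \<in> fst C" by (rule chart_at)
  let ?T = "S \<inter> \<rho> -` fst C"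
  have T: "open ?T" using plot_open_vimage[OF \<rho>] chart_homeomorphism(1)[OF C(1)] by blast
  have "smooth_on ?T (\<lambda>p. a (chart_inv C (snd C (\<rho> p))))"
    by (rule smooth_on_compose[OF _ plot_smooth_on_chart[OF \<rho> C(1)] T, of "chart_image C" "\<lambda>x. a (chart_inv C x)"])
      (use a C in \<open>auto simp: smooth_fun_iff\<close>)
  then have "smooth_on ?T (\<lambda>p. a (\<rho> p))"
    by (rule smooth_on_cong[OF T]) (use C in auto)
  then show "\<exists>T. open T \<and> p \<in> T \<and> smooth_on T (\<lambda>p. a (\<rho> p))"
    using T p C(2) by (intro exI[of _ ?T]) auto
qed

lemma smooth_fun_compose:
  assumes "smooth_fun G a" "\<And>S \<rho>. plot (S :: 'e set) \<rho> \<Longrightarrow> plot S (\<lambda>p. f (\<rho> p))"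
  shows "smooth_fun G (\<lambda>g. a (f g))"
  unfolding smooth_fun_iff using assms smooth_fun_plot plot_chart_inv by blast

lemma smooth_fun_const: "smooth_fun G (\<lambda>g. c)"
  and smooth_fun_add: "smooth_fun G a \<Longrightarrow> smooth_fun G b \<Longrightarrow> smooth_fun G (\<lambda>g. a g + b g)"
  and smooth_fun_mult: "smooth_fun G a \<Longrightarrow> smooth_fun G b \<Longrightarrow> smooth_fun G (\<lambda>g. a g * b g)"
  unfolding smooth_fun_iff by (simp_all add: smooth_on_const smooth_on_add smooth_on_mult chart_homeomorphism)

lemma smooth_fun_scale: "smooth_fun G a \<Longrightarrow> smooth_fun G (\<lambda>g. c * a g)"
  by (intro smooth_fun_mult smooth_fun_const)

lemma smooth_fun_uminus: "smooth_fun G a \<Longrightarrow> smooth_fun G (\<lambda>g. - a g)"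
  using smooth_fun_scale[of a "-1"] by simp

lemma smooth_fun_diff: "smooth_fun G a \<Longrightarrow> smooth_fun G b \<Longrightarrow> smooth_fun G (\<lambda>g. a g - b g)"
  using smooth_fun_add[of a "\<lambda>g. - b g"] smooth_fun_uminus by simp

lemma smooth_fun_sum:
  "(\<And>i. i \<in> I \<Longrightarrow> smooth_fun G (a i)) \<Longrightarrow> smooth_fun G (\<lambda>g. \<Sum>i\<in>I. a i g)"
  by (induction I rule: infinite_finite_induct) (simp_all add: smooth_fun_const smooth_fun_add)

lemma mult_inv_cancel [simp]: "g \<otimes> (inv g \<otimes> h) = h" "inv g \<otimes> (g \<otimes> h) = h"
    "h \<otimes> g \<otimes> inv g = h" "h \<otimes> inv g \<otimes> g = h"
  by (simp_all add: m_assoc[symmetric]) (simp_all add: m_assoc)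

lemma smooth_fun_left: "smooth_fun G (\<lambda>h. a (k \<otimes> h)) \<longleftrightarrow> smooth_fun G a"
proof -
  have *: "smooth_fun G (\<lambda>h. a (k \<otimes> h))" if "smooth_fun G a" for a k
    using that by (rule smooth_fun_compose) (intro plot_mult plot_const plot_open)
  show ?thesis using *[of "\<lambda>h. a (k \<otimes> h)" "inv k"] * by auto
qed

lemma smooth_fun_right: "smooth_fun G (\<lambda>h. a (h \<otimes> k)) \<longleftrightarrow> smooth_fun G a"
proof -
  have *: "smooth_fun G (\<lambda>h. a (h \<otimes> k))" if "smooth_fun G a" for a k
    using that by (rule smooth_fun_compose) (intro plot_mult plot_const plot_open)
  show ?thesis using *[of "\<lambda>h. a (h \<otimes> k)" "inv k"] * by auto
qed

lemma smooth_fun_inverse: "smooth_fun G a \<Longrightarrow> smooth_fun G (\<lambda>h. a (inv h))"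
  by (erule smooth_fun_compose) (rule plot_inverse)

section \<open>Tangent vectors\<close>

text \<open>
  The velocity of \<open>\<rho>\<close> at \<open>p\<close> in the direction \<open>d\<close>.
\<close>
definition plot_vector :: "('d::euclidean_space \<Rightarrow> 'g) \<Rightarrow> 'd \<Rightarrow> 'd \<Rightarrow> 'g tangent" where
  "plot_vector \<rho> p d = (\<lambda>a. if smooth_fun G a then frechet_derivative (\<lambda>q. a (\<rho> q)) (at p) d else 0)"

lemma coord_vector_eq_plot_vector: "coord_vector G C g e = plot_vector (chart_inv C) (snd C g) e"
  unfolding coord_vector_def plot_vector_def comp_def ..

text \<open>
  The chain rule through the chart \<open>C\<close>. As every tangent vector in question is the velocity of some
  plot, this handles changes of charts, translations of tangent vectors and invariant vector fields
  at once.
\<close>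
lemma plot_vector_eq_coord_vector:
  assumes \<rho>: "plot S \<rho>" and p: "p \<in> S" and C: "C \<in> charts G" "\<rho> p \<in> fst C"
  shows "plot_vector \<rho> p d =
    coord_vector G C (\<rho> p) (frechet_derivative (\<lambda>q. snd C (\<rho> q)) (at p) d)"
proof (rule ext)
  fix a
  show "plot_vector \<rho> p d a =
    coord_vector G C (\<rho> p) (frechet_derivative (\<lambda>q. snd C (\<rho> q)) (at p) d) a"
  proof (cases "smooth_fun G a")
    case True
    let ?T = "S \<inter> \<rho> -` fst C"
    have T: "open ?T" "p \<in> ?T" using plot_open_vimage[OF \<rho>] chart_homeomorphism(1)[OF C(1)] p C(2) by auto
    have "((\<lambda>q. a (chart_inv C (snd C (\<rho> q)))) has_derivative
       (\<lambda>d. frechet_derivative (\<lambda>q. a (chart_inv C q)) (at (snd C (\<rho> p)))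
          (frechet_derivative (\<lambda>q. snd C (\<rho> q)) (at p) d))) (at p)"
      using True C T(2)
      by (intro has_derivative_compose[of "\<lambda>q. snd C (\<rho> q)" _ _ _ "\<lambda>q. a (chart_inv C q)"]
          smooth_on_has_derivative[of "chart_image C"]
          smooth_on_has_derivative[OF plot_smooth_on_chart[OF \<rho> C(1)]]) (auto simp: smooth_fun_iff)
    then have "((\<lambda>q. a (\<rho> q)) has_derivative
       (\<lambda>d. frechet_derivative (\<lambda>q. a (chart_inv C q)) (at (snd C (\<rho> p)))
          (frechet_derivative (\<lambda>q. snd C (\<rho> q)) (at p) d))) (at p)"
      by (rule has_derivative_transform_within_open[OF _ T]) (use C in auto)
    then show ?thesis
      using True by (simp add: plot_vector_def coord_vector_def comp_def frechet_derivative_at[symmetric])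
  qed (simp add: plot_vector_def coord_vector_def)
qed

lemma plot_vector_in_tangent_space:
  assumes "plot S \<rho>" "p \<in> S"
  shows "plot_vector \<rho> p d \<in> tangent_space G (\<rho> p)"
proof -
  obtain C where C: "C \<in> charts G" "\<rho> p \<in> fst C" by (rule chart_at)
  then show ?thesis
    unfolding plot_vector_eq_coord_vector[OF assms C] tangent_space_def by blast
qed

lemma coord_vector_in_tangent_space: "C \<in> charts G \<Longrightarrow> g \<in> fst C \<Longrightarrow> coord_vector G C g d \<in> tangent_space G g"
  unfolding tangent_space_def by blast

lemma tangent_space_eq_range:
  assumes C: "C \<in> charts G" "g \<in> fst C"
  shows "tangent_space G g = range (coord_vector G C g)"
proof
  show "tangent_space G g \<subseteq> range (coord_vector G C g)"
  proof
    fix X assume "X \<in> tangent_space G g"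
    then obtain D d where D: "D \<in> charts G" "g \<in> fst D" "X = coord_vector G D g d"
      unfolding tangent_space_def by auto
    show "X \<in> range (coord_vector G C g)"
      using plot_vector_eq_coord_vector[OF plot_chart_inv[OF D(1)], of "snd D g" C d]
        coord_vector_eq_plot_vector[of D g d] C D by auto
  qed
qed (use coord_vector_in_tangent_space[OF C] in auto)

lemma chart_expression_has_derivative:
  assumes "C \<in> charts G" "g \<in> fst C" "smooth_fun G a"
  shows "((\<lambda>q. a (chart_inv C q)) has_derivative (\<lambda>d. coord_vector G C g d a)) (at (snd C g))"
  using assms smooth_on_has_derivative[of "chart_image C" "\<lambda>q. a (chart_inv C q)" "snd C g"]
  by (auto simp: coord_vector_def smooth_fun_iff comp_def)

lemma coord_vector_add:
  assumes "C \<in> charts G" "g \<in> fst C"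
  shows "coord_vector G C g (d + d') = (\<lambda>a. coord_vector G C g d a + coord_vector G C g d' a)"
proof (rule ext)
  fix a show "coord_vector G C g (d + d') a = coord_vector G C g d a + coord_vector G C g d' a"
  proof (cases "smooth_fun G a")
    case True
    show ?thesis
      using linear_add[OF has_derivative_linear[OF chart_expression_has_derivative[OF assms True]]] .
  qed (simp add: coord_vector_def)
qed

lemma coord_vector_scale:
  assumes "C \<in> charts G" "g \<in> fst C"
  shows "coord_vector G C g (t *\<^sub>R d) = (\<lambda>a. t * coord_vector G C g d a)"
proof (rule ext)
  fix a show "coord_vector G C g (t *\<^sub>R d) a = t * coord_vector G C g d a"
  proof (cases "smooth_fun G a")
    case True
    show ?thesis
      using linear_scale[OF has_derivative_linear[OF chart_expression_has_derivative[OF assms True]]] by simp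
  qed (simp add: coord_vector_def)
qed

lemma tangent_space_add:
  assumes "X \<in> tangent_space G g" "Y \<in> tangent_space G g"
  shows "(\<lambda>a. X a + Y a) \<in> tangent_space G g"
proof -
  obtain C where C: "C \<in> charts G" "g \<in> fst C" by (rule chart_at)
  show ?thesis
    using assms unfolding tangent_space_eq_range[OF C] by (auto simp: coord_vector_add[OF C, symmetric])
qed

lemma tangent_space_scale:
  assumes "X \<in> tangent_space G g"
  shows "(\<lambda>a. t * X a) \<in> tangent_space G g"
proof -
  obtain C where C: "C \<in> charts G" "g \<in> fst C" by (rule chart_at)
  show ?thesis
    using assms unfolding tangent_space_eq_range[OF C] by (auto simp: coord_vector_scale[OF C, symmetric])
qed

lemma tangent_space_zero: "(\<lambda>a. 0) \<in> tangent_space G g"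
proof -
  obtain C where C: "C \<in> charts G" "g \<in> fst C" by (rule chart_at)
  show ?thesis
    using tangent_space_scale[OF coord_vector_in_tangent_space[OF C, of 0], of 0] by simp
qed

lemma tangent_space_sum:
  "(\<And>i. i \<in> I \<Longrightarrow> X i \<in> tangent_space G g) \<Longrightarrow> (\<lambda>a. \<Sum>i\<in>I. X i a) \<in> tangent_space G g"
  by (induction I rule: infinite_finite_induct) (simp_all add: tangent_space_zero tangent_space_add)

lemma tangent_nonsmooth: "X \<in> tangent_space G g \<Longrightarrow> \<not> smooth_fun G a \<Longrightarrow> X a = 0"
  by (auto simp: tangent_space_def coord_vector_def)

lemma tangent_add:
  assumes "X \<in> tangent_space G g" "smooth_fun G a" "smooth_fun G b"
  shows "X (\<lambda>h. a h + b h) = X a + X b"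
proof -
  obtain C where C: "C \<in> charts G" "g \<in> fst C" by (rule chart_at)
  obtain d where X: "X = coord_vector G C g d" using assms(1) unfolding tangent_space_eq_range[OF C] by auto
  have "((\<lambda>q. a (chart_inv C q) + b (chart_inv C q)) has_derivative
     (\<lambda>d. coord_vector G C g d a + coord_vector G C g d b)) (at (snd C g))"
    by (intro has_derivative_add chart_expression_has_derivative C assms)
  from has_derivative_unique[OF chart_expression_has_derivative[OF C smooth_fun_add[OF assms(2,3)]] this]
  show ?thesis
    unfolding X by (rule fun_cong)
qed

lemma tangent_mult:
  assumes "X \<in> tangent_space G g" "smooth_fun G a" "smooth_fun G b"
  shows "X (\<lambda>h. a h * b h) = X a * b g + a g * X b"
proof -
  obtain C where C: "C \<in> charts G" "g \<in> fst C" by (rule chart_at)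
  obtain d where X: "X = coord_vector G C g d" using assms(1) unfolding tangent_space_eq_range[OF C] by auto
  have "((\<lambda>q. a (chart_inv C q) * b (chart_inv C q)) has_derivative
     (\<lambda>d. a (chart_inv C (snd C g)) * coord_vector G C g d b + coord_vector G C g d a * b (chart_inv C (snd C g)))) (at (snd C g))"
    by (intro has_derivative_mult chart_expression_has_derivative C assms)
  then have "(\<lambda>d. coord_vector G C g d (\<lambda>h. a h * b h)) = (\<lambda>d. a g * coord_vector G C g d b + coord_vector G C g d a * b g)"
    using has_derivative_unique[OF _ chart_expression_has_derivative[OF C smooth_fun_mult[OF assms(2,3)]]] C
    by simp
  then show ?thesis
    unfolding X by (subst add.commute) (rule fun_cong)
qed

lemma tangent_const: "X \<in> tangent_space G g \<Longrightarrow> X (\<lambda>h. c) = 0"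
  by (auto simp: tangent_space_def coord_vector_def comp_def)

lemma tangent_scale: "X \<in> tangent_space G g \<Longrightarrow> smooth_fun G a \<Longrightarrow> X (\<lambda>h. c * a h) = c * X a"
  using tangent_mult[of X g "\<lambda>h. c" a] by (simp add: smooth_fun_const tangent_const)

lemma tangent_uminus: "X \<in> tangent_space G g \<Longrightarrow> smooth_fun G a \<Longrightarrow> X (\<lambda>h. - a h) = - X a"
  using tangent_scale[of X g a "-1"] by simp

lemma tangent_diff:
  "X \<in> tangent_space G g \<Longrightarrow> smooth_fun G a \<Longrightarrow> smooth_fun G b \<Longrightarrow> X (\<lambda>h. a h - b h) = X a - X b"
  using tangent_add[of X g a "\<lambda>h. - b h"] by (simp add: smooth_fun_uminus tangent_uminus)

lemma tangent_sum:
  assumes "X \<in> tangent_space G g" "\<And>i. i \<in> I \<Longrightarrow> smooth_fun G (a i)"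
  shows "X (\<lambda>h. \<Sum>i\<in>I. a i h) = (\<Sum>i\<in>I. X (a i))"
  using assms(2)
  by (induction I rule: infinite_finite_induct)
    (simp_all add: tangent_const[OF assms(1)] tangent_add[OF assms(1)] smooth_fun_sum)

text \<open>
  The map \<open>f\<close> carries a plot with velocity \<open>X\<close> to a plot with the pushed-forward velocity. The
  equivalence for smoothness is required in both directions, because the push-forward has to vanish
  on functions that are not smooth.
\<close>
lemma tangent_pushforward:
  assumes X: "X \<in> tangent_space G g"
    and f: "\<And>S \<rho>. plot (S :: 'e set) \<rho> \<Longrightarrow> plot S (\<lambda>p. f (\<rho> p))"
    and sm: "\<And>a. smooth_fun G (\<lambda>h. a (f h)) \<longleftrightarrow> smooth_fun G a"
  shows "(\<lambda>a. X (\<lambda>h. a (f h))) \<in> tangent_space G (f g)"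
proof -
  obtain C d where C: "C \<in> charts G" "g \<in> fst C" "X = coord_vector G C g d"
    using X by (auto simp: tangent_space_def)
  have "(\<lambda>a. X (\<lambda>h. a (f h))) = plot_vector (\<lambda>p. f (chart_inv C p)) (snd C g) d"
    unfolding C(3) by (simp add: coord_vector_eq_plot_vector plot_vector_def sm)
  then show ?thesis
    using plot_vector_in_tangent_space[OF f[OF plot_chart_inv[OF C(1)]], of "snd C g" d] C by simp
qed

lemma ltrans_in_tangent_space:
  "X \<in> tangent_space G h \<Longrightarrow> ltrans G k X \<in> tangent_space G (k \<otimes> h)"
  unfolding ltrans_def
  by (rule tangent_pushforward[where f = "\<lambda>h. k \<otimes> h"])
    (auto intro!: plot_mult plot_const dest: plot_open simp: smooth_fun_left)

lemma rtrans_in_tangent_space: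
  "X \<in> tangent_space G h \<Longrightarrow> rtrans G X k \<in> tangent_space G (h \<otimes> k)"
  unfolding rtrans_def
  by (rule tangent_pushforward[where f = "\<lambda>h. h \<otimes> k"])
    (auto intro!: plot_mult plot_const dest: plot_open simp: smooth_fun_right)

lemma ltrans_ltrans: "ltrans G k (ltrans G l X) = ltrans G (k \<otimes> l) X"
  by (simp add: ltrans_def m_assoc)

lemma rtrans_rtrans: "rtrans G (rtrans G X k) l = rtrans G X (k \<otimes> l)"
  by (simp add: rtrans_def m_assoc)

lemma ltrans_rtrans: "ltrans G k (rtrans G X l) = rtrans G (ltrans G k X) l"
  by (simp add: ltrans_def rtrans_def m_assoc)

lemma trans_one [simp]: "ltrans G \<one> X = X" "rtrans G X \<one> = X"
  by (simp_all add: ltrans_def rtrans_def)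

section \<open>Smooth functions of two group elements\<close>

definition smooth2 :: "('g \<Rightarrow> 'g \<Rightarrow> real) \<Rightarrow> bool" where
  "smooth2 F \<longleftrightarrow> (\<forall>C\<in>charts G. \<forall>D\<in>charts G.
     smooth_on (chart_image C \<times> chart_image D) (\<lambda>(p, q). F (chart_inv C p) (chart_inv D q)))"

lemma smooth2_on_charts:
  "smooth2 F \<Longrightarrow> C \<in> charts G \<Longrightarrow> D \<in> charts G \<Longrightarrow>
     smooth_on (chart_image C \<times> chart_image D) (\<lambda>(p, q). F (chart_inv C p) (chart_inv D q))"
  by (simp add: smooth2_def)

lemma smooth2_plots:
  assumes F: "smooth2 F" and \<rho>: "plot S \<rho>" and \<sigma>: "plot S \<sigma>"
  shows "smooth_on S (\<lambda>p. F (\<rho> p) (\<sigma> p))"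
proof (rule smooth_on_local)
  fix p assume p: "p \<in> S"
  obtain C where C: "C \<in> charts G" "\<rho> p \<in> fst C" by (rule chart_at)
  obtain D where D: "D \<in> charts G" "\<sigma> p \<in> fst D" by (rule chart_at)
  let ?T = "(S \<inter> \<rho> -` fst C) \<inter> (S \<inter> \<sigma> -` fst D)"
  have T: "open ?T"
    by (rule open_Int) (use plot_open_vimage[OF \<rho>] plot_open_vimage[OF \<sigma>] chart_homeomorphism(1) C D in auto)
  have "smooth_on ?T (\<lambda>p. (snd C (\<rho> p), snd D (\<sigma> p)))"
    by (intro smooth_on_Pair T smooth_on_subset[OF plot_smooth_on_chart[OF \<rho> C(1)]]
        smooth_on_subset[OF plot_smooth_on_chart[OF \<sigma> D(1)]]) auto
  from smooth_on_compose[OF smooth2_on_charts[OF F C(1) D(1)] this T]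
  have "smooth_on ?T (\<lambda>p. F (chart_inv C (snd C (\<rho> p))) (chart_inv D (snd D (\<sigma> p))))" by force
  then have "smooth_on ?T (\<lambda>p. F (\<rho> p) (\<sigma> p))"
    by (rule smooth_on_cong[OF T]) (use C D in auto)
  then show "\<exists>T. open T \<and> p \<in> T \<and> smooth_on T (\<lambda>p. F (\<rho> p) (\<sigma> p))"
    using T p C(2) D(2) by (intro exI[of _ ?T]) auto
qed

lemma plot_chart_fst: "C \<in> charts G \<Longrightarrow> D \<in> charts G \<Longrightarrow> plot (chart_image C \<times> chart_image D) (\<lambda>z. chart_inv C (fst z))"
  by (rule plot_compose[OF plot_chart_inv])
    (auto intro!: smooth_on_bounded_linear[OF bounded_linear_fst smooth_on_id] open_Times chart_homeomorphism)

lemma plot_chart_snd: "C \<in> charts G \<Longrightarrow> D \<in> charts G \<Longrightarrow> plot (chart_image C \<times> chart_image D) (\<lambda>z. chart_inv D (snd z))"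
  by (rule plot_compose[OF plot_chart_inv])
    (auto intro!: smooth_on_bounded_linear[OF bounded_linear_snd smooth_on_id] open_Times chart_homeomorphism)

lemma smooth2I:
  assumes "\<And>S \<rho> \<sigma>. plot (S :: ('e \<times> 'e) set) \<rho> \<Longrightarrow> plot S \<sigma> \<Longrightarrow> smooth_on S (\<lambda>p. F (\<rho> p) (\<sigma> p))"
  shows "smooth2 F"
  unfolding smooth2_def case_prod_unfold
  using assms[OF plot_chart_fst plot_chart_snd] by blast

lemma smooth2_compose:
  assumes "smooth_fun G a"
    and "\<And>S \<rho> \<sigma>. plot (S :: ('e \<times> 'e) set) \<rho> \<Longrightarrow> plot S \<sigma> \<Longrightarrow> plot S (\<lambda>p. f (\<rho> p) (\<sigma> p))"
  shows "smooth2 (\<lambda>g h. a (f g h))"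
  by (rule smooth2I) (rule smooth_fun_plot[OF assms(2) assms(1)])

lemma smooth2_swap: "smooth2 F \<Longrightarrow> smooth2 (\<lambda>g h. F h g)"
  by (rule smooth2I) (rule smooth2_plots)

lemma smooth2_diagonal:
  assumes F: "smooth2 F" and f: "\<And>S \<rho>. plot (S :: 'e set) \<rho> \<Longrightarrow> plot S (\<lambda>p. f (\<rho> p))"
    "\<And>S \<rho>. plot (S :: 'e set) \<rho> \<Longrightarrow> plot S (\<lambda>p. f' (\<rho> p))"
  shows "smooth_fun G (\<lambda>g. F (f g) (f' g))"
  unfolding smooth_fun_iff using smooth2_plots[OF F f(1) f(2)] plot_chart_inv by blast

lemma smooth2_section: "smooth2 F \<Longrightarrow> smooth_fun G (F g)" "smooth2 F \<Longrightarrow> smooth_fun G (\<lambda>h. F h g)"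
  using smooth2_diagonal[of F "\<lambda>h. g" "\<lambda>h. h"] smooth2_diagonal[of F "\<lambda>h. h" "\<lambda>h. g"]
  by (auto intro: plot_const plot_open)

lemma coord_vector_smooth2:
  assumes F: "smooth2 F" and C: "C \<in> charts G" "p \<in> chart_image C" and D: "D \<in> charts G" "q \<in> chart_image D"
  shows "coord_vector G D (chart_inv D q) d (F (chart_inv C p)) =
      frechet_derivative (\<lambda>(p, q). F (chart_inv C p) (chart_inv D q)) (at (p, q)) (0, d)"
    and "coord_vector G C (chart_inv C p) d (\<lambda>g. F g (chart_inv D q)) =
      frechet_derivative (\<lambda>(p, q). F (chart_inv C p) (chart_inv D q)) (at (p, q)) (d, 0)"
  using frechet_derivative_partial[OF smooth2_on_charts[OF F C(1) D(1)], of p q] C D smooth2_section[OF F]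
  by (auto simp: coord_vector_def comp_def)

lemma smooth_fun_tangent_apply:
  assumes F: "smooth2 F" and v: "v \<in> tangent_space G k"
  shows "smooth_fun G (\<lambda>g. v (F g))"
  unfolding smooth_fun_iff
proof
  fix C assume C: "C \<in> charts G"
  obtain D where D: "D \<in> charts G" "k \<in> fst D" by (rule chart_at)
  then obtain d where d: "v = coord_vector G D k d" using v tangent_space_eq_range by auto
  let ?\<Phi> = "\<lambda>(p, q). F (chart_inv C p) (chart_inv D q)"
  have o: "open (chart_image C)" using C by (rule chart_homeomorphism)
  have "smooth_on (chart_image C) (\<lambda>p. frechet_derivative ?\<Phi> (at (p, snd D k)) (0, d))"
    by (rule smooth_on_compose[OF smooth_on_derivative[OF smooth2_on_charts[OF F C D(1)]]
          smooth_on_Pair[OF smooth_on_id smooth_on_const] o])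
      (use o D in auto)
  then show "smooth_on (chart_image C) (\<lambda>p. v (F (chart_inv C p)))"
    by (rule smooth_on_cong[OF o])
      (use coord_vector_smooth2(1)[OF F C _ D(1), of _ "snd D k" d] D in \<open>auto simp: d\<close>)
qed

lemma coord_vector_eq_frechet_derivative:
  assumes C: "C \<in> charts G" "k \<in> fst C" and a: "smooth_fun G a"
    and eq: "\<And>p. p \<in> chart_image C \<Longrightarrow> a (chart_inv C p) = b p"
  shows "coord_vector G C k d a = frechet_derivative b (at (snd C k)) d"
proof -
  have "(b has_derivative (\<lambda>d. coord_vector G C k d a)) (at (snd C k))"
    by (rule has_derivative_transform_within_open[OF chart_expression_has_derivative[OF C a]
          chart_homeomorphism(2)[OF C(1)]]) (use C eq in auto)
  then show ?thesis by (simp add: frechet_derivative_at[symmetric])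
qed

text \<open>
  In charts, both sides are mixed second derivatives of \<open>F\<close>.
\<close>
lemma tangent_apply_commute:
  assumes F: "smooth2 F" and v: "v \<in> tangent_space G k" and w: "w \<in> tangent_space G l"
  shows "v (\<lambda>g. w (F g)) = w (\<lambda>h. v (\<lambda>g. F g h))"
proof -
  obtain C where C: "C \<in> charts G" "k \<in> fst C" by (rule chart_at)
  then obtain c where c: "v = coord_vector G C k c" using v tangent_space_eq_range by auto
  obtain D where D: "D \<in> charts G" "l \<in> fst D" by (rule chart_at)
  then obtain d where d: "w = coord_vector G D l d" using w tangent_space_eq_range by auto
  let ?\<Phi> = "\<lambda>(p, q). F (chart_inv C p) (chart_inv D q)"
  let ?S = "chart_image C \<times> chart_image D"
  have o: "open (chart_image C)" "open (chart_image D)" using C D by (auto intro: chart_homeomorphism)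
  have in_S: "(snd C k, snd D l) \<in> ?S" using C D by auto
  note \<Phi> = smooth2_on_charts[OF F C(1) D(1)]
  have 1: "w (F (chart_inv C p)) = frechet_derivative ?\<Phi> (at (p, snd D l)) (0, d)" if "p \<in> chart_image C" for p
    using coord_vector_smooth2(1)[OF F C(1) that D(1), of "snd D l" d] D by (auto simp: d)
  have 2: "v (\<lambda>g. F g (chart_inv D q)) = frechet_derivative ?\<Phi> (at (snd C k, q)) (c, 0)" if "q \<in> chart_image D" for q
    using coord_vector_smooth2(2)[OF F C(1) _ D(1) that, of "snd C k" c] C by (auto simp: c)
  have sw: "smooth_fun G (\<lambda>g. w (F g))"
    by (rule smooth_fun_tangent_apply[OF F w])
  have sv: "smooth_fun G (\<lambda>h. v (\<lambda>g. F g h))"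
    using smooth_fun_tangent_apply[OF smooth2_swap[OF F] v] .
  have "v (\<lambda>g. w (F g)) = frechet_derivative (\<lambda>p. frechet_derivative ?\<Phi> (at (p, snd D l)) (0, d)) (at (snd C k)) c"
    unfolding c by (rule coord_vector_eq_frechet_derivative[OF C sw 1])
  also have "\<dots> = frechet_derivative (\<lambda>z. frechet_derivative ?\<Phi> (at z) (0, d)) (at (snd C k, snd D l)) (c, 0)"
    using frechet_derivative_partial(1)[OF smooth_on_derivative[OF \<Phi>] in_S] .
  also have "\<dots> = frechet_derivative (\<lambda>z. frechet_derivative ?\<Phi> (at z) (c, 0)) (at (snd C k, snd D l)) (0, d)"
    by (rule symmetric_second_derivative[OF open_Times[OF o] \<Phi> in_S])
  also have "\<dots> = frechet_derivative (\<lambda>q. frechet_derivative ?\<Phi> (at (snd C k, q)) (c, 0)) (at (snd D l)) d"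
    using frechet_derivative_partial(2)[OF smooth_on_derivative[OF \<Phi>] in_S] by (rule sym)
  also have "\<dots> = w (\<lambda>h. v (\<lambda>g. F g h))"
    unfolding d by (rule coord_vector_eq_frechet_derivative[OF D sv 2, symmetric])
  finally show ?thesis .
qed

text \<open>
  If \<open>v\<close> has the coordinates \<open>c\<close> in a chart, then the diagonal is differentiated in the direction
  \<open>(c, c) = (c, 0) + (0, c)\<close>.
\<close>
lemma tangent_apply_diagonal:
  assumes F: "smooth2 F" and v: "v \<in> tangent_space G k"
  shows "v (\<lambda>g. F g g) = v (\<lambda>g. F g k) + v (F k)"
proof -
  obtain C where C: "C \<in> charts G" "k \<in> fst C" by (rule chart_at)
  then obtain c where c: "v = coord_vector G C k c" using v tangent_space_eq_range by auto
  let ?\<Phi> = "\<lambda>(p, q). F (chart_inv C p) (chart_inv C q)" and ?p = "snd C k"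
  have p: "?p \<in> chart_image C" "chart_inv C ?p = k" using C by auto
  have d: "(?\<Phi> has_derivative frechet_derivative ?\<Phi> (at (?p, ?p))) (at (?p, ?p))"
    using smooth_on_has_derivative[OF smooth2_on_charts[OF F C(1) C(1)]] p by blast
  have "((\<lambda>q. ?\<Phi> (q, q)) has_derivative (\<lambda>c. frechet_derivative ?\<Phi> (at (?p, ?p)) (c, c))) (at ?p)"
    by (rule has_derivative_compose[of "\<lambda>q. (q, q)" _ _ _ ?\<Phi>, OF _ d]) (auto intro!: derivative_eq_intros)
  moreover have "smooth_fun G (\<lambda>g. F g g)" using smooth2_diagonal[OF F, of "\<lambda>g. g" "\<lambda>g. g"] by simp
  ultimately have "v (\<lambda>g. F g g) = frechet_derivative ?\<Phi> (at (?p, ?p)) (c, c)"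
    by (simp add: c coord_vector_def comp_def frechet_derivative_at[symmetric])
  also have "\<dots> = frechet_derivative ?\<Phi> (at (?p, ?p)) (c, 0) + frechet_derivative ?\<Phi> (at (?p, ?p)) (0, c)"
    using linear_add[OF has_derivative_linear[OF d], of "(c, 0)" "(0, c)"] by simp
  finally show ?thesis
    using coord_vector_smooth2[OF F C(1) p(1) C(1) p(1), of c] p(2) by (simp add: c)
qed

section \<open>The Lie algebra and the adjoint action\<close>

lemma lie_algebra_eq: "lie_algebra G = tangent_space G \<one>"
  by (simp add: lie_algebra_def)

lemmas lie_algebra_D = lie_algebra_eq[THEN equalityD1, THEN subsetD]

text \<open>
  The numbers \<open>v (\<phi> i)\<close> are linear coordinates of \<open>v\<close>. Since the \<open>\<phi> i\<close> are functions on the whole group,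
  they can be composed with translations and conjugations, unlike the components of a chart. The
  \<open>E i\<close> span the Lie algebra, but may be linearly dependent.
\<close>
definition dual_frame :: "nat \<Rightarrow> (nat \<Rightarrow> 'g tangent) \<Rightarrow> (nat \<Rightarrow> 'g \<Rightarrow> real) \<Rightarrow> bool" where
  "dual_frame n E \<phi> \<longleftrightarrow> (\<forall>i<n. E i \<in> lie_algebra G) \<and> (\<forall>i<n. smooth_fun G (\<phi> i)) \<and>
     (\<forall>v\<in>lie_algebra G. v = (\<lambda>a. \<Sum>i<n. v (\<phi> i) * E i a))"

lemma dual_frame_D:
  assumes "dual_frame n E \<phi>"
  shows "i < n \<Longrightarrow> E i \<in> lie_algebra G" "i < n \<Longrightarrow> smooth_fun G (\<phi> i)"
    "v \<in> lie_algebra G \<Longrightarrow> v = (\<lambda>a. \<Sum>i<n. v (\<phi> i) * E i a)"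
  using assms unfolding dual_frame_def by blast+

lemma ex_dual_frame: obtains n E \<phi> where "dual_frame n E \<phi>"
proof -
  obtain C where C: "C \<in> charts G" "\<one> \<in> fst C" by (rule chart_at)
  let ?L = "coord_vector G C \<one>"
  have "linear (\<lambda>d. ?L d a)" for a
    by (rule linearI) (simp_all add: coord_vector_add[OF C] coord_vector_scale[OF C])
  from finite_frame[where L = ?L, OF this subspace_UNIV]
  obtain n E \<phi> where f: "\<And>i. i < n \<Longrightarrow> \<exists>w. ?L w (\<phi> i) \<noteq> 0"
      "\<And>w x. ?L w x = (\<Sum>i<(n::nat). ?L w (\<phi> i) * ?L (E i) x)" by blast
  have "smooth_fun G (\<phi> i)" if "i < n" for i
    using f(1)[OF that] by (auto simp: coord_vector_def split: if_splits)
  moreover have "v = (\<lambda>a. \<Sum>i<n. v (\<phi> i) * ?L (E i) a)" if "v \<in> lie_algebra G" for v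
  proof -
    obtain d where "v = ?L d" using \<open>v \<in> lie_algebra G\<close> by (auto simp: lie_algebra_eq tangent_space_eq_range[OF C])
    then show ?thesis by (simp only:) (rule ext, rule f(2))
  qed
  ultimately show ?thesis
    using that[of n "\<lambda>i. ?L (E i)" \<phi>] coord_vector_in_tangent_space[OF C] by (simp add: lie_algebra_eq dual_frame_def)
qed

lemma linear_form_on_zero: "linear_form_on (tangent_space G g) \<psi> \<Longrightarrow> \<psi> (\<lambda>a. 0) = 0"
  using tangent_space_zero[of g] by (force simp: linear_form_on_def dest: bspec[of _ _ "\<lambda>a. 0"] spec[of _ 0])

lemma linear_form_on_sum:
  assumes "linear_form_on (tangent_space G g) \<psi>" "\<And>i. i \<in> I \<Longrightarrow> X i \<in> tangent_space G g"
  shows "\<psi> (\<lambda>a. \<Sum>i\<in>I. c i * X i a) = (\<Sum>i\<in>I. c i * \<psi> (X i))"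
  using assms(2)
proof (induction I rule: infinite_finite_induct)
  case (insert i I)
  then show ?case
    using assms(1) tangent_space_scale[of "X i" g "c i"]
      tangent_space_sum[of I "\<lambda>i a. c i * X i a" g] tangent_space_scale
    by (simp add: linear_form_on_def)
qed (simp_all add: linear_form_on_zero[OF assms(1)])

text \<open>
  Differentiate the constant function \<open>g \<mapsto> a (g\<^sup>-\<^sup>1 g)\<close> by the chain rule on the diagonal.
\<close>
lemma tangent_apply_inverse:
  assumes v: "v \<in> lie_algebra G" and a: "smooth_fun G a"
  shows "v (\<lambda>g. a (inv g)) = - v a"
proof -
  have v: "v \<in> tangent_space G \<one>" using v by (simp add: lie_algebra_eq)
  have "smooth2 (\<lambda>g h. a (inv g \<otimes> h))"
    by (rule smooth2_compose[OF a]) (intro plot_mult plot_inverse)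
  from tangent_apply_diagonal[OF this v] show ?thesis
    by (simp add: tangent_const[OF v])
qed

lemma smooth_fun_ltrans:
  assumes "v \<in> lie_algebra G" "smooth_fun G a" shows "smooth_fun G (\<lambda>g. ltrans G g v a)"
  unfolding ltrans_def
  by (rule smooth_fun_tangent_apply[OF _ lie_algebra_D[OF assms(1)]])
    (rule smooth2_compose[OF assms(2)], rule plot_mult)

lemma smooth_fun_rtrans:
  assumes "v \<in> lie_algebra G" "smooth_fun G a" shows "smooth_fun G (\<lambda>g. rtrans G v g a)"
  unfolding rtrans_def
  by (rule smooth_fun_tangent_apply[OF _ lie_algebra_D[OF assms(1)]])
    (rule smooth2_compose[OF assms(2)], rule plot_mult)

text \<open>
  The left-invariant field of \<open>v\<close> and the right-invariant field of \<open>w\<close> differentiate \<open>(h, l) \<mapsto> a (l g h)\<close>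
  in different variables.
\<close>
lemma ltrans_rtrans_commute:
  assumes "v \<in> lie_algebra G" "w \<in> lie_algebra G" "smooth_fun G a"
  shows "ltrans G g v (\<lambda>h. rtrans G w h a) = rtrans G w g (\<lambda>h. ltrans G h v a)"
proof -
  have "smooth2 (\<lambda>h l. a (l \<otimes> g \<otimes> h))"
    by (rule smooth2_compose[OF assms(3)]) (auto intro!: plot_mult plot_const dest: plot_open)
  from tangent_apply_commute[OF this lie_algebra_D[OF assms(1)] lie_algebra_D[OF assms(2)]]
  show ?thesis by (simp add: ltrans_def rtrans_def m_assoc)
qed

definition Ad :: "'g \<Rightarrow> 'g tangent \<Rightarrow> 'g tangent" where
  "Ad g w = rtrans G (ltrans G g w) (inv g)"

lemma Ad_in_lie_algebra: "w \<in> lie_algebra G \<Longrightarrow> Ad g w \<in> lie_algebra G"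
  using rtrans_in_tangent_space[OF ltrans_in_tangent_space, of w \<one> g "inv g"] by (simp add: Ad_def lie_algebra_eq)

lemma rtrans_Ad: "rtrans G (Ad g w) g = ltrans G g w"
  by (simp add: Ad_def rtrans_rtrans)

lemma Ad_one [simp]: "Ad \<one> w = w"
  by (simp add: Ad_def)

lemma smooth_fun_Ad:
  assumes "w \<in> lie_algebra G" "smooth_fun G a"
  shows "smooth_fun G (\<lambda>g. Ad g w a)"
proof -
  have "smooth2 (\<lambda>g l. a (g \<otimes> l \<otimes> inv g))"
    by (rule smooth2_compose[OF assms(2)]) (intro plot_mult plot_inverse)
  from smooth_fun_tangent_apply[OF this lie_algebra_D[OF assms(1)]] show ?thesis
    by (simp add: Ad_def ltrans_def rtrans_def)
qed

text \<open>
  The right-hand side is the derivative of \<open>g \<mapsto> Ad g w\<close> along \<open>v\<close>. Write \<open>gw = (Ad g w) g\<close> and expand \<open>Ad g w\<close>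
  in the frame, so that the left-invariant field of \<open>w\<close> is a combination of the right-invariant fields
  of the \<open>E i\<close> with the coefficients \<open>(Ad g w)(\<phi> i)\<close>. The Leibniz rule for \<open>v\<close> yields two sums: the
  right-hand side, and one with second derivatives of \<open>a\<close>, which is the term subtracted in the
  definition of the bracket. As a commutator of derivations the bracket is not visibly a tangent
  vector; in this form it is.
\<close>
lemma bracket_eq_derivative_Ad:
  assumes v: "v \<in> lie_algebra G" and w: "w \<in> lie_algebra G"
    and f: "dual_frame n E \<phi>"
  shows "bracket G v w = (\<lambda>a. \<Sum>i<n. v (\<lambda>g. Ad g w (\<phi> i)) * E i a)"
proof (rule ext)
  fix a
  note v' = lie_algebra_D[OF v] and w' = lie_algebra_D[OF w]
  note E = dual_frame_D(1)[OF f] and \<phi> = dual_frame_D(2)[OF f] and frame = dual_frame_D(3)[OF f]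
  show "bracket G v w a = (\<Sum>i<n. v (\<lambda>g. Ad g w (\<phi> i)) * E i a)"
  proof (cases "smooth_fun G a")
    case False
    \<comment> \<open>both sides vanish, because tangent vectors are zero on functions that are not smooth\<close>
    then have "ltrans G g u a = 0" if "u \<in> lie_algebra G" for u g
      using tangent_nonsmooth[OF ltrans_in_tangent_space[OF lie_algebra_D[OF that]]] by simp
    then show ?thesis
      using False v w E tangent_nonsmooth[OF lie_algebra_D, of _ a] tangent_const[OF v'] tangent_const[OF w']
      by (auto simp: bracket_def intro!: sum.neutral)
  next
    case True
    let ?c = "\<lambda>i g. Ad g w (\<phi> i)"
    have "ltrans G g w a = (\<Sum>i<n. ?c i g * rtrans G (E i) g a)" for g
    proof -
      have "ltrans G g w a = Ad g w (\<lambda>h. a (h \<otimes> g))"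
        by (subst rtrans_Ad[symmetric]) (simp add: rtrans_def)
      also have "\<dots> = (\<Sum>i<n. ?c i g * E i (\<lambda>h. a (h \<otimes> g)))"
        by (rule fun_cong[OF frame[OF Ad_in_lie_algebra[OF w]]])
      finally show ?thesis by (simp add: rtrans_def)
    qed
    then have "v (\<lambda>g. ltrans G g w a) = v (\<lambda>g. \<Sum>i<n. ?c i g * rtrans G (E i) g a)" by simp
    also have "\<dots> = (\<Sum>i<n. v (\<lambda>g. ?c i g * rtrans G (E i) g a))"
      by (intro tangent_sum[OF v'] smooth_fun_mult smooth_fun_Ad smooth_fun_rtrans w E \<phi> True) auto
    also have "\<dots> = (\<Sum>i<n. v (?c i) * E i a + w (\<phi> i) * v (\<lambda>g. rtrans G (E i) g a))"
      by (intro sum.cong refl, subst tangent_mult[OF v'])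
        (auto intro!: smooth_fun_Ad smooth_fun_rtrans w E \<phi> True)
    \<comment> \<open>left- and right-invariant vector fields commute\<close>
    also have "\<dots> = (\<Sum>i<n. v (?c i) * E i a) + (\<Sum>i<n. w (\<phi> i) * E i (\<lambda>h. ltrans G h v a))"
    proof -
      have "v (\<lambda>g. rtrans G (E i) g a) = E i (\<lambda>h. ltrans G h v a)" if "i < n" for i
        using ltrans_rtrans_commute[OF v E[OF that] True, of \<one>] by simp
      then show ?thesis by (simp add: sum.distrib)
    qed
    also have "(\<Sum>i<n. w (\<phi> i) * E i (\<lambda>h. ltrans G h v a)) = w (\<lambda>h. ltrans G h v a)"
      by (rule fun_cong[OF frame[OF w], symmetric])
    finally show ?thesis by (simp add: bracket_def)
  qed
qed

lemma bracket_in_lie_algebra: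
  assumes "v \<in> lie_algebra G" "w \<in> lie_algebra G"
  shows "bracket G v w \<in> lie_algebra G"
proof -
  obtain n E \<phi> where frame: "dual_frame n E \<phi>" by (rule ex_dual_frame)
  note f = dual_frame_D[OF frame]
  show ?thesis
    unfolding bracket_eq_derivative_Ad[OF assms frame] lie_algebra_eq
    using f(1) by (intro tangent_space_sum tangent_space_scale lie_algebra_D) auto
qed

text \<open>
  Expanding \<open>Ad g w\<close> in a dual frame writes \<open>\<psi> (Ad g w)\<close> as a finite combination of smooth functions of
  \<open>g\<close>, so that \<open>v\<close> can be taken inside \<open>\<psi>\<close>.
\<close>
lemma linear_form_Ad_derivative:
  assumes v: "v \<in> lie_algebra G" and w: "w \<in> lie_algebra G" and \<psi>: "linear_form_on (lie_algebra G) \<psi>"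
  shows "v (\<lambda>g. \<psi> (Ad g w)) = \<psi> (bracket G v w)"
proof -
  obtain n E \<phi> where frame: "dual_frame n E \<phi>" by (rule ex_dual_frame)
  note f = dual_frame_D[OF frame]
  have sum: "\<psi> (\<lambda>a. \<Sum>i<n. c i * E i a) = (\<Sum>i<n. \<psi> (E i) * c i)" for c
    using linear_form_on_sum[of \<one> \<psi> "{..<n}" E c] \<psi> f(1) by (simp add: lie_algebra_eq mult.commute)
  have *: "\<psi> (Ad g w) = (\<Sum>i<n. \<psi> (E i) * Ad g w (\<phi> i))" for g
    by (subst f(3)[OF Ad_in_lie_algebra[OF w]]) (rule sum)
  show "v (\<lambda>g. \<psi> (Ad g w)) = \<psi> (bracket G v w)"
    unfolding * bracket_eq_derivative_Ad[OF v w frame] sum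
    by (subst tangent_sum[OF lie_algebra_D[OF v]])
      (auto intro!: smooth_fun_scale smooth_fun_Ad w f tangent_scale[OF lie_algebra_D[OF v]] sum.cong)
qed

lemma ltrans_bracket:
  "ltrans G g (bracket G v w) a = ltrans G g v (\<lambda>h. ltrans G h w a) - ltrans G g w (\<lambda>h. ltrans G h v a)"
  by (simp add: ltrans_def bracket_def m_assoc)

text \<open>
  The sign is opposite to that in \<open>ltrans_bracket\<close>: nesting right-invariant fields multiplies the
  group elements in the reversed order.
\<close>
lemma rtrans_bracket:
  assumes "v \<in> lie_algebra G" "w \<in> lie_algebra G" "smooth_fun G a"
  shows "rtrans G (bracket G v w) g a = rtrans G w g (\<lambda>h. rtrans G v h a) - rtrans G v g (\<lambda>h. rtrans G w h a)"
proof -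
  have F: "smooth2 (\<lambda>h l. a (h \<otimes> l \<otimes> g))"
    by (rule smooth2_compose[OF assms(3)]) (auto intro!: plot_mult plot_const dest: plot_open)
  show ?thesis
    using tangent_apply_commute[OF F lie_algebra_D[OF assms(1)] lie_algebra_D[OF assms(2)]]
      tangent_apply_commute[OF F lie_algebra_D[OF assms(2)] lie_algebra_D[OF assms(1)]]
    by (simp add: ltrans_def rtrans_def bracket_def m_assoc)
qed

lemma bracket_skew: "bracket G v w = (\<lambda>a. - bracket G w v a)"
  by (simp add: bracket_def)

text \<open>
  Expanded into iterated derivatives along left-invariant vector fields, both sides have the same terms.
\<close>
lemma bracket_jacobi:
  assumes "u \<in> lie_algebra G" "v \<in> lie_algebra G" "w \<in> lie_algebra G"
  shows "bracket G (bracket G u v) w = (\<lambda>a. bracket G u (bracket G v w) a - bracket G v (bracket G u w) a)"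
proof
  fix a
  have b1: "bracket G v w a = v (\<lambda>g. ltrans G g w a) - w (\<lambda>g. ltrans G g v a)" for v w a
    by (simp add: bracket_def)
  show "bracket G (bracket G u v) w a = bracket G u (bracket G v w) a - bracket G v (bracket G u w) a"
  proof (cases "smooth_fun G a")
    case True
    have s: "smooth_fun G (\<lambda>g. ltrans G g x (\<lambda>h. ltrans G h y a))" if "x \<in> lie_algebra G" "y \<in> lie_algebra G" for x y
      using that True by (intro smooth_fun_ltrans)
    note d = assms[THEN lie_algebra_D, THEN tangent_diff]
    show ?thesis
      unfolding b1 ltrans_bracket by (simp add: d s assms)
  next
    case False
    then show ?thesis
      using assms tangent_nonsmooth[OF lie_algebra_D[OF bracket_in_lie_algebra], of _ _ a]
      by (simp add: bracket_in_lie_algebra)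
  qed
qed

section \<open>1-forms in the left trivialisation\<close>

lemma one_forms_linear: "\<tau> \<in> one_forms G \<Longrightarrow> linear_form_on (tangent_space G g) (\<tau> g)"
  and one_forms_outside: "\<tau> \<in> one_forms G \<Longrightarrow> X \<notin> tangent_space G g \<Longrightarrow> \<tau> g X = 0"
  by (auto simp: one_forms_def)

lemma one_forms_smooth:
  "\<tau> \<in> one_forms G \<Longrightarrow> C \<in> charts G \<Longrightarrow>
    smooth_on (chart_image C) (\<lambda>p. \<tau> (chart_inv C p) (coord_vector G C (chart_inv C p) e))"
  by (auto simp: one_forms_def Let_def)

lemma ltrans_lie_algebra: "w \<in> lie_algebra G \<Longrightarrow> ltrans G g w \<in> tangent_space G g"
  using ltrans_in_tangent_space[of w \<one> g] by (simp add: lie_algebra_eq)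

lemma rtrans_lie_algebra: "w \<in> lie_algebra G \<Longrightarrow> rtrans G w g \<in> tangent_space G g"
  using rtrans_in_tangent_space[of w \<one> g] by (simp add: lie_algebra_eq)

lemmas trans_uminus = tangent_uminus[OF ltrans_lie_algebra] tangent_uminus[OF rtrans_lie_algebra]

lemmas trans_diff = tangent_diff[OF ltrans_lie_algebra] tangent_diff[OF rtrans_lie_algebra]

lemma ltrans_inv_in_lie_algebra: "X \<in> tangent_space G g \<Longrightarrow> ltrans G (inv g) X \<in> lie_algebra G"
  using ltrans_in_tangent_space[of X g "inv g"] by (simp add: lie_algebra_eq)

lemma ltrans_ltrans_inv [simp]: "ltrans G g (ltrans G (inv g) X) = X" "ltrans G (inv g) (ltrans G g X) = X"
  by (simp_all add: ltrans_ltrans)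

lemma tangent_spaceE:
  assumes "X \<in> tangent_space G g" obtains w where "w \<in> lie_algebra G" "X = ltrans G g w"
  using assms ltrans_inv_in_lie_algebra[of X g] ltrans_ltrans_inv(1)[of g X] by metis

lemma linear_to_alg:
  "linear_form_on (tangent_space G g) (\<tau> g) \<Longrightarrow> linear_form_on (lie_algebra G) (to_alg G \<tau> g)"
  using ltrans_lie_algebra[of _ g] unfolding linear_form_on_def to_alg_def by (simp add: ltrans_def)

lemma one_form_to_alg_linear: "\<tau> \<in> one_forms G \<Longrightarrow> linear_form_on (lie_algebra G) (to_alg G \<tau> g)"
  using linear_to_alg[of g \<tau>] one_forms_linear by blast

lemma one_form_eq_to_alg: "\<tau> g X = to_alg G \<tau> g (ltrans G (inv g) X)"
  by (simp add: to_alg_def)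

lemma form_eqI:
  assumes "\<And>g X. X \<notin> tangent_space G g \<Longrightarrow> \<alpha> g X = 0" "\<And>g X. X \<notin> tangent_space G g \<Longrightarrow> \<beta> g X = 0"
    and "\<And>g w. w \<in> lie_algebra G \<Longrightarrow> to_alg G \<alpha> g w = to_alg G \<beta> g w"
  shows "\<alpha> = \<beta>"
proof (intro ext)
  fix g X show "\<alpha> g X = \<beta> g X"
    using assms ltrans_inv_in_lie_algebra[of X g] one_form_eq_to_alg[of \<alpha> g X] one_form_eq_to_alg[of \<beta> g X]
    by (cases "X \<in> tangent_space G g") auto
qed

text \<open>
  In a chart, \<open>gw\<close> is the coordinate vector of the derivative of the multiplication at \<open>(g, e)\<close> in the
  direction \<open>(0, w)\<close>, which depends smoothly on \<open>g\<close>. In a basis, \<open>\<tau>(g)(gw)\<close> thus becomes a combination of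
  the coefficients of \<open>\<tau>\<close> in the chart.
\<close>
lemma smooth_fun_to_alg:
  assumes \<tau>: "\<tau> \<in> one_forms G" and w: "w \<in> lie_algebra G"
  shows "smooth_fun G (\<lambda>g. to_alg G \<tau> g w)"
  unfolding smooth_fun_iff
proof
  fix C assume C: "C \<in> charts G"
  obtain D where D: "D \<in> charts G" "\<one> \<in> fst D" by (rule chart_at)
  then obtain d where d: "w = coord_vector G D \<one> d" using w tangent_space_eq_range by (auto simp: lie_algebra_eq)
  let ?q = "snd D \<one>" and ?\<Phi> = "\<lambda>z. chart_inv C (fst z) \<otimes> chart_inv D (snd z)"
  let ?h = "\<lambda>z. snd C (?\<Phi> z)" and ?S = "(chart_image C \<times> chart_image D) \<inter> ?\<Phi> -` fst C"
  \<comment> \<open>the coordinates of the tangent vector \<open>gw\<close>\<close>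
  let ?M = "\<lambda>p. frechet_derivative ?h (at (p, ?q)) (0, d)"
  have o: "open (chart_image C)" using C by (rule chart_homeomorphism)
  have q: "?q \<in> chart_image D" using D by simp
  have h: "smooth_on ?S ?h"
    by (rule plot_smooth_on_chart[OF plot_mult[OF plot_chart_fst plot_chart_snd]]) (use C D in auto)
  have M: "smooth_on (chart_image C) ?M"
    by (rule smooth_on_compose[OF smooth_on_derivative[OF h] smooth_on_Pair[OF smooth_on_id smooth_on_const] o])
      (use o D in auto)
  have "to_alg G \<tau> (chart_inv C p) w =
      (\<Sum>b\<in>Basis. (?M p \<bullet> b) * \<tau> (chart_inv C p) (coord_vector G C (chart_inv C p) b))" if p: "p \<in> chart_image C" for p
  proof -
    let ?g = "chart_inv C p"
    have g: "?g \<in> fst C" using p by simp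
    have "ltrans G ?g w = plot_vector (\<lambda>q. ?g \<otimes> chart_inv D q) ?q d"
      unfolding d by (simp add: ltrans_def coord_vector_eq_plot_vector plot_vector_def smooth_fun_left)
    also have "\<dots> = coord_vector G C ?g (frechet_derivative (\<lambda>q. snd C (?g \<otimes> chart_inv D q)) (at ?q) d)"
      using plot_vector_eq_coord_vector[OF plot_mult[OF plot_const plot_chart_inv[OF D(1)]] q C, of ?g d]
        D g chart_homeomorphism(2)[OF D(1)] by simp
    also have "frechet_derivative (\<lambda>q. snd C (?g \<otimes> chart_inv D q)) (at ?q) d = ?M p"
      using frechet_derivative_partial(2)[OF h, of p ?q d] p q D g by simp
    also have "coord_vector G C ?g (?M p) = (\<lambda>a. \<Sum>b\<in>Basis. (?M p \<bullet> b) * coord_vector G C ?g b a)"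
    proof
      fix a
      have "linear (\<lambda>d. coord_vector G C ?g d a)"
        by (rule linearI) (simp_all add: coord_vector_add[OF C g] coord_vector_scale[OF C g])
      note L = linear_sum[OF this] linear_scale[OF this]
      show "coord_vector G C ?g (?M p) a = (\<Sum>b\<in>Basis. (?M p \<bullet> b) * coord_vector G C ?g b a)"
        by (subst euclidean_representation[symmetric, of "?M p"]) (simp only: L real_scaleR_def)
    qed
    finally show ?thesis
      unfolding to_alg_def
      using linear_form_on_sum[OF one_forms_linear[OF \<tau>], of Basis "coord_vector G C ?g" ?g]
        coord_vector_in_tangent_space[OF C g] by simp
  qed
  moreover have "smooth_on (chart_image C)
      (\<lambda>p. \<Sum>b\<in>Basis. (?M p \<bullet> b) * \<tau> (chart_inv C p) (coord_vector G C (chart_inv C p) b))"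
    by (intro smooth_on_sum smooth_on_mult smooth_on_bounded_linear[OF bounded_linear_inner_left] M o
        one_forms_smooth \<tau> C)
  ultimately show "smooth_on (chart_image C) (\<lambda>p. to_alg G \<tau> (chart_inv C p) w)"
    by (metis (no_types, lifting) smooth_on_cong[OF o])
qed

text \<open>
  Let \<open>X\<close> be the coordinate vector of \<open>e\<close> at \<open>h\<close>. In a dual frame the coefficient of the form on \<open>X\<close> is
  the sum of \<open>s(h)(E i)\<close> weighted by \<open>(h\<^sup>-\<^sup>1 X)(\<phi> i)\<close>, the derivative of \<open>l \<mapsto> \<phi> i (h\<^sup>-\<^sup>1 l)\<close> at \<open>l = h\<close> along \<open>X\<close>.
  This is a partial derivative of a smooth function of two variables, taken on the diagonal.
\<close>
lemma of_alg_in_one_forms: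
  assumes lin: "\<And>g. linear_form_on (lie_algebra G) (s g)"
    and smooth: "\<And>w. w \<in> lie_algebra G \<Longrightarrow> smooth_fun G (\<lambda>g. s g w)"
  shows "of_alg G s \<in> one_forms G"
  unfolding one_forms_def
proof (intro CollectI conjI allI ballI impI)
  fix g
  show "linear_form_on (tangent_space G g) (of_alg G s g)"
    using lin[of g] ltrans_inv_in_lie_algebra[of _ g] tangent_space_add[of _ g] tangent_space_scale[of _ g]
    unfolding linear_form_on_def of_alg_def by (simp add: ltrans_def)
next
  fix C e assume C: "C \<in> charts G"
  obtain n E \<phi> where frame: "dual_frame n E \<phi>" by (rule ex_dual_frame)
  have o: "open (chart_image C)" using C by (rule chart_homeomorphism)
  let ?D = "\<lambda>i p. frechet_derivative (\<lambda>(p, q). \<phi> i (inv (chart_inv C p) \<otimes> chart_inv C q)) (at (p, p)) (0, e)"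
  have F: "smooth2 (\<lambda>g h. \<phi> i (inv g \<otimes> h))" if "i < n" for i
    by (rule smooth2_compose[OF dual_frame_D(2)[OF frame that]]) (intro plot_mult plot_inverse)
  have eq: "(\<Sum>i<n. ?D i p * s (chart_inv C p) (E i)) =
      of_alg G s (chart_inv C p) (coord_vector G C (chart_inv C p) e)"
    if p: "p \<in> chart_image C" for p
  proof -
    let ?h = "chart_inv C p" and ?X = "coord_vector G C (chart_inv C p) e"
    have X: "?X \<in> tangent_space G ?h" using C p by (intro coord_vector_in_tangent_space) auto
    have "ltrans G (inv ?h) ?X = (\<lambda>a. \<Sum>i<n. ltrans G (inv ?h) ?X (\<phi> i) * E i a)"
      by (rule dual_frame_D(3)[OF frame ltrans_inv_in_lie_algebra[OF X]])
    then have "s ?h (ltrans G (inv ?h) ?X) = s ?h (\<lambda>a. \<Sum>i<n. ltrans G (inv ?h) ?X (\<phi> i) * E i a)"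
      by (rule arg_cong)
    also have "\<dots> = (\<Sum>i<n. ltrans G (inv ?h) ?X (\<phi> i) * s ?h (E i))"
      using dual_frame_D(1)[OF frame] lin[of ?h] by (intro linear_form_on_sum) (auto simp: lie_algebra_eq)
    also have "\<dots> = (\<Sum>i<n. ?D i p * s ?h (E i))"
      using coord_vector_smooth2(1)[OF F C p C p] by (simp add: ltrans_def)
    finally show ?thesis using X by (simp add: of_alg_def)
  qed
  have "smooth_on (chart_image C) (\<lambda>p. \<Sum>i<n. ?D i p * s (chart_inv C p) (E i))"
  proof (intro smooth_on_sum smooth_on_mult o)
    fix i assume i: "i \<in> {..<n}"
    show "smooth_on (chart_image C) (?D i)"
      by (rule smooth_on_compose[OF smooth_on_derivative[OF smooth2_on_charts[OF F C C]]
            smooth_on_Pair[OF smooth_on_id smooth_on_id] o]) (use i o in auto)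
    show "smooth_on (chart_image C) (\<lambda>p. s (chart_inv C p) (E i))"
      using smooth[OF dual_frame_D(1)[OF frame, of i]] i C by (simp add: smooth_fun_iff)
  qed
  from smooth_on_cong[OF o this eq]
  show "smooth_on (snd C ` fst C) (\<lambda>p. let h = chart_inv C p in of_alg G s h (coord_vector G C h e))"
    by (simp add: Let_def)
qed (simp add: of_alg_def)

lemma to_alg_of_alg: "w \<in> lie_algebra G \<Longrightarrow> to_alg G (of_alg G s) g w = s g w"
  by (simp add: to_alg_def of_alg_def ltrans_lie_algebra)

lemma of_alg_to_alg:
  "(\<And>g X. X \<notin> tangent_space G g \<Longrightarrow> \<tau> g X = 0) \<Longrightarrow> of_alg G (to_alg G \<tau>) = \<tau>"
  by (intro ext) (simp add: of_alg_def one_form_eq_to_alg[symmetric])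

lemma one_formsI:
  assumes "\<And>g X. X \<notin> tangent_space G g \<Longrightarrow> \<tau> g X = 0"
    and "\<And>g. linear_form_on (lie_algebra G) (to_alg G \<tau> g)"
    and "\<And>w. w \<in> lie_algebra G \<Longrightarrow> smooth_fun G (\<lambda>g. to_alg G \<tau> g w)"
  shows "\<tau> \<in> one_forms G"
  using of_alg_in_one_forms[OF assms(2,3)] of_alg_to_alg[OF assms(1)] by simp

lemma ext_d_in_one_forms:
  assumes "smooth_fun G a" shows "ext_d G a \<in> one_forms G"
  using assms smooth_fun_ltrans
  by (intro one_formsI linear_to_alg)
    (auto simp: ext_d_def to_alg_def linear_form_on_def tangent_space_add tangent_space_scale
        ltrans_lie_algebra)

lemma to_alg_ext_d: "w \<in> lie_algebra G \<Longrightarrow> to_alg G (ext_d G a) g w = ltrans G g w a"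
  by (simp add: to_alg_def ext_d_def ltrans_lie_algebra)

lemma one_forms_lincomb:
  assumes "\<And>i. i \<in> I \<Longrightarrow> smooth_fun G (f i)" "\<And>i. i \<in> I \<Longrightarrow> \<tau> i \<in> one_forms G"
  shows "(\<lambda>g X. \<Sum>i\<in>I. f i g * \<tau> i g X) \<in> one_forms G"
proof (rule one_formsI)
  fix g
  show "linear_form_on (lie_algebra G) (to_alg G (\<lambda>g X. \<Sum>i\<in>I. f i g * \<tau> i g X) g)"
    using one_forms_linear[OF assms(2)]
    by (intro linear_to_alg) (simp add: linear_form_on_def sum.distrib[symmetric] sum_distrib_left algebra_simps)
next
  fix w assume "w \<in> lie_algebra G"
  then show "smooth_fun G (\<lambda>g. to_alg G (\<lambda>g X. \<Sum>i\<in>I. f i g * \<tau> i g X) g w)"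
    using smooth_fun_to_alg[OF assms(2)] unfolding to_alg_def
    by (intro smooth_fun_sum smooth_fun_mult assms(1))
qed (simp add: one_forms_outside[OF assms(2)])

lemma one_forms_diff:
  assumes "\<alpha> \<in> one_forms G" "\<beta> \<in> one_forms G"
  shows "(\<lambda>g X. \<alpha> g X - \<beta> g X) \<in> one_forms G"
  \<comment> \<open>a linear combination indexed by the two truth values\<close>
  using one_forms_lincomb[of UNIV "\<lambda>i g. if i then 1 else -1" "\<lambda>i. if i then \<alpha> else \<beta>"] assms
  by (simp add: UNIV_bool smooth_fun_const)

section \<open>Infinitesimal actions\<close>

lemma inf_lact_fun_eq:
  assumes "v \<in> lie_algebra G" "smooth_fun G a" shows "inf_lact_fun G v a g = - rtrans G v g a"
  using tangent_apply_inverse[OF assms(1), of "\<lambda>h. a (h \<otimes> g)"] assms(2)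
  by (simp add: inf_lact_fun_def lact_fun_def rtrans_def smooth_fun_right)

lemma inf_ract_fun_eq:
  assumes "v \<in> lie_algebra G" "smooth_fun G a" shows "inf_ract_fun G a v g = - ltrans G g v a"
  using tangent_apply_inverse[OF assms(1), of "\<lambda>h. a (g \<otimes> h)"] assms(2)
  by (simp add: inf_ract_fun_def ract_fun_def ltrans_def smooth_fun_left)

lemma smooth_fun_inf:
  assumes "v \<in> lie_algebra G" "smooth_fun G a"
  shows "smooth_fun G (inf_lact_fun G v a)" "smooth_fun G (inf_ract_fun G a v)"
  using smooth_fun_uminus[OF smooth_fun_rtrans[OF assms]] smooth_fun_uminus[OF smooth_fun_ltrans[OF assms]]
    inf_lact_fun_eq[OF assms] inf_ract_fun_eq[OF assms] by presburger+

lemma lact_form_outside: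
  assumes "\<tau> \<in> one_forms G" "X \<notin> tangent_space G g" shows "lact_form G k \<tau> g X = 0"
proof -
  have "ltrans G (inv k) X \<notin> tangent_space G (inv k \<otimes> g)"
    using ltrans_in_tangent_space[of "ltrans G (inv k) X" "inv k \<otimes> g" k] assms(2) by auto
  then show ?thesis using one_forms_outside[OF assms(1)] by (simp add: lact_form_def)
qed

lemma ract_form_outside:
  assumes "\<tau> \<in> one_forms G" "X \<notin> tangent_space G g" shows "ract_form G \<tau> k g X = 0"
proof -
  have "rtrans G X (inv k) \<notin> tangent_space G (g \<otimes> inv k)"
    using rtrans_in_tangent_space[of "rtrans G X (inv k)" "g \<otimes> inv k" k] assms(2)
    by (auto simp: rtrans_rtrans)
  then show ?thesis using one_forms_outside[OF assms(1)] by (simp add: ract_form_def)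
qed

lemma inf_form_outside:
  assumes "v \<in> lie_algebra G" "\<tau> \<in> one_forms G" "X \<notin> tangent_space G g"
  shows "inf_lact_form G v \<tau> g X = 0" "inf_ract_form G \<tau> v g X = 0"
  by (simp_all add: inf_lact_form_def inf_ract_form_def lact_form_outside[OF assms(2,3)]
      ract_form_outside[OF assms(2,3)] tangent_const[OF lie_algebra_D[OF assms(1)]])

lemma lact_form_ltrans: "lact_form G k \<tau> g (ltrans G g w) = to_alg G \<tau> (inv k \<otimes> g) w"
  by (simp add: lact_form_def to_alg_def ltrans_ltrans)

lemma ract_form_ltrans: "ract_form G \<tau> k g (ltrans G g w) = to_alg G \<tau> (g \<otimes> inv k) (Ad k w)"
  by (simp add: ract_form_def to_alg_def Ad_def ltrans_ltrans ltrans_rtrans)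

lemma smooth_fun_lact_form:
  assumes \<tau>: "\<tau> \<in> one_forms G" and X: "X \<in> tangent_space G g"
  shows "smooth_fun G (\<lambda>k. lact_form G k \<tau> g X)"
proof -
  obtain w where w: "w \<in> lie_algebra G" "X = ltrans G g w" using X by (rule tangent_spaceE)
  show ?thesis
    unfolding w(2) lact_form_ltrans
    using smooth_fun_to_alg[OF \<tau> w(1)]
    by (intro smooth_fun_inverse[of "\<lambda>k. to_alg G \<tau> (k \<otimes> g) w"])
      (simp add: smooth_fun_right[of "\<lambda>k. to_alg G \<tau> k w"])
qed

text \<open>
  In the right action of \<open>k\<close> on forms, \<open>k\<close> moves both the base point and the vector. Here the two
  occurrences are separate variables, so that the chain rule on the diagonal applies.
\<close>
lemma smooth2_to_alg_Ad:
  assumes \<tau>: "\<tau> \<in> one_forms G" and w: "w \<in> lie_algebra G"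
  shows "smooth2 (\<lambda>k l. to_alg G \<tau> (g \<otimes> inv k) (Ad l w))"
proof -
  obtain n E \<phi> where frame: "dual_frame n E \<phi>" by (rule ex_dual_frame)
  have "to_alg G \<tau> h (Ad l w) = (\<Sum>i<n. Ad l w (\<phi> i) * to_alg G \<tau> h (E i))" for h l
  proof -
    have "to_alg G \<tau> h (Ad l w) = to_alg G \<tau> h (\<lambda>a. \<Sum>i<n. Ad l w (\<phi> i) * E i a)"
      by (rule arg_cong[of _ _ "to_alg G \<tau> h"], rule dual_frame_D(3)[OF frame Ad_in_lie_algebra[OF w]])
    also have "\<dots> = (\<Sum>i<n. Ad l w (\<phi> i) * to_alg G \<tau> h (E i))"
      using one_form_to_alg_linear[OF \<tau>] dual_frame_D(1)[OF frame]
      by (intro linear_form_on_sum) (auto simp: lie_algebra_eq)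
    finally show ?thesis .
  qed
  moreover have "smooth2 (\<lambda>k l. \<Sum>i<n. Ad l w (\<phi> i) * to_alg G \<tau> (g \<otimes> inv k) (E i))"
  proof (intro smooth2I smooth_on_sum smooth_on_mult)
    fix S :: "('e \<times> 'e) set" and \<rho> \<sigma> i assume \<rho>: "plot S \<rho>" and \<sigma>: "plot S \<sigma>" and i: "i \<in> {..<n}"
    show "smooth_on S (\<lambda>p. Ad (\<sigma> p) w (\<phi> i))"
      using i by (intro smooth_fun_plot[OF \<sigma>] smooth_fun_Ad w dual_frame_D(2)[OF frame]) simp
    show "smooth_on S (\<lambda>p. to_alg G \<tau> (g \<otimes> inv (\<rho> p)) (E i))"
      using i by (intro smooth_fun_plot[where \<rho> = "\<lambda>p. g \<otimes> inv (\<rho> p)"] smooth_fun_to_alg \<tau> dual_frame_D(1)[OF frame]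
          plot_mult plot_const plot_inverse \<rho> plot_open[OF \<rho>]) simp
  qed (auto dest: plot_open)
  ultimately show ?thesis by simp
qed

lemma smooth_fun_ract_form:
  assumes \<tau>: "\<tau> \<in> one_forms G" and X: "X \<in> tangent_space G g"
  shows "smooth_fun G (\<lambda>k. ract_form G \<tau> k g X)"
proof -
  obtain w where w: "w \<in> lie_algebra G" "X = ltrans G g w" using X by (rule tangent_spaceE)
  show ?thesis
    unfolding w(2) ract_form_ltrans
    using smooth2_diagonal[OF smooth2_to_alg_Ad[OF \<tau> w(1)], of "\<lambda>k. k" "\<lambda>k. k"] by simp
qed

text \<open>
  Left translations preserve the left trivialisation: \<open>k\<^sup>-\<^sup>1 (gw) = (k\<^sup>-\<^sup>1 g) w\<close>.
\<close>
lemma to_alg_inf_lact_form: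
  assumes v: "v \<in> lie_algebra G" and \<tau>: "\<tau> \<in> one_forms G" and w: "w \<in> lie_algebra G"
  shows "to_alg G (inf_lact_form G v \<tau>) g w = - rtrans G v g (\<lambda>h. to_alg G \<tau> h w)"
proof -
  have "to_alg G (inf_lact_form G v \<tau>) g w = v (\<lambda>k. to_alg G \<tau> (inv k \<otimes> g) w)"
    unfolding to_alg_def[of G "inf_lact_form G v \<tau>"] by (simp add: inf_lact_form_def lact_form_ltrans)
  also have "\<dots> = - v (\<lambda>k. to_alg G \<tau> (k \<otimes> g) w)"
    using tangent_apply_inverse[OF v, of "\<lambda>k. to_alg G \<tau> (k \<otimes> g) w"] smooth_fun_to_alg[OF \<tau> w]
    by (simp add: smooth_fun_right[of "\<lambda>k. to_alg G \<tau> k w"])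
  finally show ?thesis by (simp add: rtrans_def)
qed

text \<open>
  A right translation twists the left trivialisation: \<open>(gw) k\<^sup>-\<^sup>1 = (g k\<^sup>-\<^sup>1) (Ad k w)\<close>. The factor \<open>Ad k\<close>
  contributes the bracket.
\<close>
lemma to_alg_inf_ract_form:
  assumes v: "v \<in> lie_algebra G" and \<tau>: "\<tau> \<in> one_forms G" and w: "w \<in> lie_algebra G"
  shows "to_alg G (inf_ract_form G \<tau> v) g w =
    to_alg G \<tau> g (bracket G v w) - ltrans G g v (\<lambda>h. to_alg G \<tau> h w)"
proof -
  have "to_alg G (inf_ract_form G \<tau> v) g w = v (\<lambda>k. to_alg G \<tau> (g \<otimes> inv k) (Ad k w))"
    unfolding to_alg_def[of G "inf_ract_form G \<tau> v"] by (simp add: inf_ract_form_def ract_form_ltrans)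
  also have "\<dots> = v (\<lambda>k. to_alg G \<tau> (g \<otimes> inv k) w) + v (\<lambda>k. to_alg G \<tau> g (Ad k w))"
    using tangent_apply_diagonal[OF smooth2_to_alg_Ad[OF \<tau> w] lie_algebra_D[OF v]] by simp
  also have "v (\<lambda>k. to_alg G \<tau> (g \<otimes> inv k) w) = - v (\<lambda>k. to_alg G \<tau> (g \<otimes> k) w)"
    using tangent_apply_inverse[OF v, of "\<lambda>k. to_alg G \<tau> (g \<otimes> k) w"] smooth_fun_to_alg[OF \<tau> w]
    by (simp add: smooth_fun_left[of "\<lambda>k. to_alg G \<tau> k w"])
  also have "v (\<lambda>k. to_alg G \<tau> g (Ad k w)) = to_alg G \<tau> g (bracket G v w)"
    by (rule linear_form_Ad_derivative[OF v w one_form_to_alg_linear[OF \<tau>]])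
  finally show ?thesis by (simp add: ltrans_def)
qed

lemma inf_form_linear:
  assumes v: "v \<in> lie_algebra G" and \<tau>: "\<tau> \<in> one_forms G"
  shows "linear_form_on (tangent_space G g) (inf_lact_form G v \<tau> g)"
    "linear_form_on (tangent_space G g) (inf_ract_form G \<tau> v g)"
proof -
  note lin = one_forms_linear[OF \<tau>, unfolded linear_form_on_def]
  note t = lie_algebra_D[OF v]
  have l: "lact_form G k \<tau> g (\<lambda>a. X a + Y a) = lact_form G k \<tau> g X + lact_form G k \<tau> g Y"
    "lact_form G k \<tau> g (\<lambda>a. t * X a) = t * lact_form G k \<tau> g X"
    "ract_form G \<tau> k g (\<lambda>a. X a + Y a) = ract_form G \<tau> k g X + ract_form G \<tau> k g Y"
    "ract_form G \<tau> k g (\<lambda>a. t * X a) = t * ract_form G \<tau> k g X"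
    if "X \<in> tangent_space G g" "Y \<in> tangent_space G g" for X Y k t
    using lin[of "inv k \<otimes> g"] lin[of "g \<otimes> inv k"] that[THEN ltrans_in_tangent_space, of "inv k"]
      that[THEN rtrans_in_tangent_space, of "inv k"]
    by (simp_all add: lact_form_def ract_form_def ltrans_def rtrans_def)
  show "linear_form_on (tangent_space G g) (inf_lact_form G v \<tau> g)"
    "linear_form_on (tangent_space G g) (inf_ract_form G \<tau> v g)"
    unfolding linear_form_on_def inf_lact_form_def inf_ract_form_def
    using smooth_fun_lact_form[OF \<tau>] smooth_fun_ract_form[OF \<tau>]
    by (simp_all add: l tangent_add[OF t] tangent_scale[OF t])
qed

lemma inf_lact_form_in_one_forms:
  assumes v: "v \<in> lie_algebra G" and \<tau>: "\<tau> \<in> one_forms G"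
  shows "inf_lact_form G v \<tau> \<in> one_forms G"
  by (rule one_formsI)
    (use inf_form_outside[OF assms] inf_form_linear[OF assms] in
      \<open>auto intro!: linear_to_alg smooth_fun_uminus smooth_fun_rtrans smooth_fun_to_alg assms
         simp: to_alg_inf_lact_form[OF assms]\<close>)

lemma inf_ract_form_in_one_forms:
  assumes v: "v \<in> lie_algebra G" and \<tau>: "\<tau> \<in> one_forms G"
  shows "inf_ract_form G \<tau> v \<in> one_forms G"
  by (rule one_formsI)
    (use inf_form_outside[OF assms] inf_form_linear[OF assms] in
      \<open>auto intro!: linear_to_alg smooth_fun_diff smooth_fun_ltrans smooth_fun_to_alg assms bracket_in_lie_algebra
         simp: to_alg_inf_ract_form[OF assms]\<close>)

text \<open>
  Translating \<open>f \<tau>\<close> translates both factors, so this is the Leibniz rule of the functional \<open>v\<close>, applied to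
  the orbits of \<open>f\<close> and \<open>\<tau>\<close> as functions on the group.
\<close>
lemma inf_form_lincomb:
  assumes v: "v \<in> lie_algebra G" and f: "\<And>i. i \<in> I \<Longrightarrow> smooth_fun G (f i)"
    and \<tau>: "\<And>i. i \<in> I \<Longrightarrow> \<tau> i \<in> one_forms G"
  shows "inf_lact_form G v (\<lambda>g X. \<Sum>i\<in>I. f i g * \<tau> i g X) g X =
      (\<Sum>i\<in>I. inf_lact_fun G v (f i) g * \<tau> i g X + f i g * inf_lact_form G v (\<tau> i) g X)" (is ?l)
    and "inf_ract_form G (\<lambda>g X. \<Sum>i\<in>I. f i g * \<tau> i g X) v g X =
      (\<Sum>i\<in>I. inf_ract_fun G (f i) v g * \<tau> i g X + f i g * inf_ract_form G (\<tau> i) v g X)" (is ?r)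
proof -
  note t = lie_algebra_D[OF v]
  show ?l
  proof (cases "X \<in> tangent_space G g")
    case True
    have "inf_lact_form G v (\<lambda>g X. \<Sum>i\<in>I. f i g * \<tau> i g X) g X =
        v (\<lambda>k. \<Sum>i\<in>I. lact_fun G k (f i) g * lact_form G k (\<tau> i) g X)"
      by (simp add: inf_lact_form_def lact_form_def lact_fun_def)
    also have "\<dots> = (\<Sum>i\<in>I. v (\<lambda>k. lact_fun G k (f i) g * lact_form G k (\<tau> i) g X))"
      using f \<tau> True by (intro tangent_sum[OF t] smooth_fun_mult smooth_fun_lact_form)
        (auto simp: lact_fun_def smooth_fun_right intro!: smooth_fun_inverse[of "\<lambda>k. f _ (k \<otimes> g)"])
    also have "\<dots> = (\<Sum>i\<in>I. inf_lact_fun G v (f i) g * \<tau> i g X + f i g * inf_lact_form G v (\<tau> i) g X)"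
    proof (intro sum.cong refl)
      fix i assume i: "i \<in> I"
      have "smooth_fun G (\<lambda>k. lact_fun G k (f i) g)"
        using f[OF i] by (auto simp: lact_fun_def smooth_fun_right intro!: smooth_fun_inverse[of "\<lambda>k. f _ (k \<otimes> g)"])
      from tangent_mult[OF t this smooth_fun_lact_form[OF \<tau>[OF i] True]]
      show "v (\<lambda>k. lact_fun G k (f i) g * lact_form G k (\<tau> i) g X) =
          inf_lact_fun G v (f i) g * \<tau> i g X + f i g * inf_lact_form G v (\<tau> i) g X"
        by (simp add: inf_lact_fun_def inf_lact_form_def) (simp add: lact_fun_def lact_form_def)
    qed
    finally show ?thesis .
  qed (simp add: inf_form_outside[OF v] one_forms_lincomb f \<tau> one_forms_outside[OF \<tau>])
  show ?r
  proof (cases "X \<in> tangent_space G g")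
    case True
    have "inf_ract_form G (\<lambda>g X. \<Sum>i\<in>I. f i g * \<tau> i g X) v g X =
        v (\<lambda>k. \<Sum>i\<in>I. ract_fun G (f i) k g * ract_form G (\<tau> i) k g X)"
      by (simp add: inf_ract_form_def ract_form_def ract_fun_def)
    also have "\<dots> = (\<Sum>i\<in>I. v (\<lambda>k. ract_fun G (f i) k g * ract_form G (\<tau> i) k g X))"
      using f \<tau> True by (intro tangent_sum[OF t] smooth_fun_mult smooth_fun_ract_form)
        (auto simp: ract_fun_def smooth_fun_left intro!: smooth_fun_inverse[of "\<lambda>k. f _ (g \<otimes> k)"])
    also have "\<dots> = (\<Sum>i\<in>I. inf_ract_fun G (f i) v g * \<tau> i g X + f i g * inf_ract_form G (\<tau> i) v g X)"
    proof (intro sum.cong refl)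
      fix i assume i: "i \<in> I"
      have "smooth_fun G (\<lambda>k. ract_fun G (f i) k g)"
        using f[OF i] by (auto simp: ract_fun_def smooth_fun_left intro!: smooth_fun_inverse[of "\<lambda>k. f _ (g \<otimes> k)"])
      from tangent_mult[OF t this smooth_fun_ract_form[OF \<tau>[OF i] True]]
      show "v (\<lambda>k. ract_fun G (f i) k g * ract_form G (\<tau> i) k g X) =
          inf_ract_fun G (f i) v g * \<tau> i g X + f i g * inf_ract_form G (\<tau> i) v g X"
        by (simp add: inf_ract_fun_def inf_ract_form_def) (simp add: ract_fun_def ract_form_def)
    qed
    finally show ?thesis .
  qed (simp add: inf_form_outside[OF v] one_forms_lincomb f \<tau> one_forms_outside[OF \<tau>])
qed

lemma inf_form_diff:
  assumes v: "v \<in> lie_algebra G" and "\<alpha> \<in> one_forms G" "\<beta> \<in> one_forms G"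
  shows "inf_lact_form G v (\<lambda>g X. \<alpha> g X - \<beta> g X) g X = inf_lact_form G v \<alpha> g X - inf_lact_form G v \<beta> g X"
    and "inf_ract_form G (\<lambda>g X. \<alpha> g X - \<beta> g X) v g X = inf_ract_form G \<alpha> v g X - inf_ract_form G \<beta> v g X"
  using inf_form_lincomb[OF v, of UNIV "\<lambda>i g. if i then 1 else -1" "\<lambda>i. if i then \<alpha> else \<beta>" g X] assms
  by (auto simp: UNIV_bool smooth_fun_const inf_lact_fun_eq inf_ract_fun_eq ltrans_def rtrans_def
      tangent_const[OF lie_algebra_D[OF v]])

lemma inf_fun_commute:
  assumes "u \<in> lie_algebra G" "v \<in> lie_algebra G" "smooth_fun G a"
  shows "inf_lact_fun G u (inf_ract_fun G a v) g = inf_ract_fun G (inf_lact_fun G u a) v g"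
    "inf_lact_fun G u (inf_lact_fun G v a) g - inf_lact_fun G v (inf_lact_fun G u a) g =
      inf_lact_fun G (bracket G u v) a g"
    "inf_ract_fun G (inf_ract_fun G a u) v g - inf_ract_fun G (inf_ract_fun G a v) u g =
      inf_ract_fun G a (bracket G u v) g"
proof -
  have L: "inf_lact_fun G x a = (\<lambda>g. - rtrans G x g a)" and R: "inf_ract_fun G a x = (\<lambda>g. - ltrans G g x a)"
    if "x \<in> lie_algebra G" "smooth_fun G a" for x a
    using inf_lact_fun_eq[OF that] inf_ract_fun_eq[OF that] by auto
  note s = smooth_fun_inf smooth_fun_ltrans smooth_fun_rtrans smooth_fun_uminus bracket_in_lie_algebra
  show "inf_lact_fun G u (inf_ract_fun G a v) g = inf_ract_fun G (inf_lact_fun G u a) v g"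
    using ltrans_rtrans_commute[OF assms(2,1,3)] by (simp add: L R trans_uminus s assms)
  show "inf_lact_fun G u (inf_lact_fun G v a) g - inf_lact_fun G v (inf_lact_fun G u a) g =
      inf_lact_fun G (bracket G u v) a g"
    using rtrans_bracket[OF assms] by (simp add: L trans_uminus s assms)
  show "inf_ract_fun G (inf_ract_fun G a u) v g - inf_ract_fun G (inf_ract_fun G a v) u g =
      inf_ract_fun G a (bracket G u v) g"
    using ltrans_bracket[of g u v a] by (simp add: R trans_uminus s assms)
qed

text \<open>
  Compared on components in the left trivialisation. For two right actions, the terms with iterated
  brackets combine by the Jacobi identity.
\<close>
lemma inf_form_commute:
  assumes "u \<in> lie_algebra G" "v \<in> lie_algebra G" "\<tau> \<in> one_forms G"
  shows "inf_lact_form G u (inf_ract_form G \<tau> v) g X = inf_ract_form G (inf_lact_form G u \<tau>) v g X" (is ?c)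
    "inf_lact_form G u (inf_lact_form G v \<tau>) g X - inf_lact_form G v (inf_lact_form G u \<tau>) g X =
      inf_lact_form G (bracket G u v) \<tau> g X" (is ?l)
    "inf_ract_form G (inf_ract_form G \<tau> u) v g X - inf_ract_form G (inf_ract_form G \<tau> v) u g X =
      inf_ract_form G \<tau> (bracket G u v) g X" (is ?r)
proof -
  note in_forms = inf_lact_form_in_one_forms inf_ract_form_in_one_forms bracket_in_lie_algebra
  have outside: ?c ?l ?r if "X \<notin> tangent_space G g"
    using that assms by (simp_all add: inf_form_outside in_forms)
  have inside: ?c ?l ?r if X: "X \<in> tangent_space G g"
  proof -
    obtain w where w: "w \<in> lie_algebra G" "X = ltrans G g w" using X by (rule tangent_spaceE)
    have app: "\<alpha> g X = to_alg G \<alpha> g w" for \<alpha> by (simp add: to_alg_def w(2))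
    note s = smooth_fun_to_alg smooth_fun_ltrans smooth_fun_rtrans smooth_fun_uminus bracket_in_lie_algebra
    show ?c
      using ltrans_rtrans_commute[OF assms(2,1) smooth_fun_to_alg[OF assms(3) w(1)], of g]
      unfolding app by (simp add: to_alg_inf_lact_form to_alg_inf_ract_form in_forms s trans_uminus trans_diff assms w(1))
    show ?l
      using rtrans_bracket[OF assms(1,2) smooth_fun_to_alg[OF assms(3) w(1)], of g]
      unfolding app by (simp add: to_alg_inf_lact_form in_forms s trans_uminus trans_diff assms w(1))
    have "to_alg G \<tau> g (\<lambda>a. x a - y a) = to_alg G \<tau> g x - to_alg G \<tau> g y"
      if "x \<in> lie_algebra G" "y \<in> lie_algebra G" for x y
      using linear_form_on_sum[of \<one> "to_alg G \<tau> g" UNIV "\<lambda>i. if i then x else y" "\<lambda>i. if i then 1 else - 1"] that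
        one_form_to_alg_linear[OF assms(3), of g]
      by (simp add: lie_algebra_eq UNIV_bool)
    then have jac: "to_alg G \<tau> g (bracket G (bracket G u v) w) =
        to_alg G \<tau> g (bracket G u (bracket G v w)) - to_alg G \<tau> g (bracket G v (bracket G u w))"
      using bracket_jacobi[OF assms(1,2) w(1)] by (simp add: s assms w(1))
    show ?r
      using ltrans_bracket[of g u v "\<lambda>h. to_alg G \<tau> h w"]
      unfolding app by (simp add: to_alg_inf_ract_form in_forms s trans_uminus trans_diff assms w(1) jac)
  qed
  show ?c ?l ?r using inside outside by blast+
qed

text \<open>
  Components of \<open>ext_d G a\<close> are derivatives of \<open>a\<close> along left-invariant fields. Those commute with the
  right-invariant fields of the left action, and for the right action the bracket term accounts
  for their commutators.
\<close>
lemma inf_form_ext_d: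
  assumes v: "v \<in> lie_algebra G" and a: "smooth_fun G a"
  shows "inf_lact_form G v (ext_d G a) = ext_d G (inf_lact_fun G v a)"
    "inf_ract_form G (ext_d G a) v = ext_d G (inf_ract_fun G a v)"
proof -
  have L: "inf_lact_fun G v a = (\<lambda>g. - rtrans G v g a)" and R: "inf_ract_fun G a v = (\<lambda>g. - ltrans G g v a)"
    using inf_lact_fun_eq[OF assms] inf_ract_fun_eq[OF assms] by auto
  note s = smooth_fun_ltrans smooth_fun_rtrans bracket_in_lie_algebra
  show "inf_lact_form G v (ext_d G a) = ext_d G (inf_lact_fun G v a)"
    by (rule form_eqI)
      (use assms ltrans_rtrans_commute[OF _ v a] in
        \<open>simp_all add: inf_form_outside ext_d_in_one_forms to_alg_inf_lact_form to_alg_ext_d L trans_uminus s,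
         simp_all add: ext_d_def\<close>)
  show "inf_ract_form G (ext_d G a) v = ext_d G (inf_ract_fun G a v)"
    by (rule form_eqI)
      (use assms ltrans_bracket[of _ v _ a] in
        \<open>simp_all add: inf_form_outside ext_d_in_one_forms to_alg_inf_ract_form to_alg_ext_d R trans_uminus s,
         simp_all add: ext_d_def\<close>)
qed

lemma inf_fun_lincomb:
  assumes v: "v \<in> lie_algebra G" and f: "\<And>i. i \<in> I \<Longrightarrow> smooth_fun G (f i)"
    and h: "\<And>i. i \<in> I \<Longrightarrow> smooth_fun G (h i)"
  shows "inf_lact_fun G v (\<lambda>g. \<Sum>i\<in>I. f i g * h i g) g =
      (\<Sum>i\<in>I. inf_lact_fun G v (f i) g * h i g + f i g * inf_lact_fun G v (h i) g)" (is ?left)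
    and "inf_ract_fun G (\<lambda>g. \<Sum>i\<in>I. f i g * h i g) v g =
      (\<Sum>i\<in>I. inf_ract_fun G (f i) v g * h i g + f i g * inf_ract_fun G (h i) v g)" (is ?right)
proof -
  have s: "smooth_fun G (\<lambda>g. \<Sum>i\<in>I. f i g * h i g)"
    by (intro smooth_fun_sum smooth_fun_mult f h)
  show ?left
    using f h by (simp add: inf_lact_fun_eq[OF v] s smooth_fun_mult tangent_sum[OF rtrans_lie_algebra[OF v]]
        tangent_mult[OF rtrans_lie_algebra[OF v]] sum_negf[symmetric] cong: sum.cong)
  show ?right
    using f h by (simp add: inf_ract_fun_eq[OF v] s smooth_fun_mult tangent_sum[OF ltrans_lie_algebra[OF v]]
        tangent_mult[OF ltrans_lie_algebra[OF v]] sum_negf[symmetric] cong: sum.cong)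
qed

lemma inf_fun_diff:
  assumes v: "v \<in> lie_algebra G" and "smooth_fun G f" "smooth_fun G h"
  shows "inf_lact_fun G v (\<lambda>g. f g - h g) g = inf_lact_fun G v f g - inf_lact_fun G v h g"
    and "inf_ract_fun G (\<lambda>g. f g - h g) v g = inf_ract_fun G f v g - inf_ract_fun G h v g"
  using assms by (simp_all add: inf_lact_fun_eq inf_ract_fun_eq smooth_fun_diff trans_diff)

end

section \<open>Sums over tensors\<close>

lemma sum_list_pairs: "(\<Sum>(u, v)\<leftarrow>t. f u v) = (\<Sum>i<length t. f (fst (t ! i)) (snd (t ! i)))"
  by (simp add: sum_list_sum_nth case_prod_unfold atLeast0LessThan)

lemma sum_list_br:
  fixes f :: "'g tangent \<Rightarrow> 'g tangent \<Rightarrow> 'g tangent \<Rightarrow> real"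
  shows "(\<Sum>(u, v, w)\<leftarrow>br1213 G t. f u v w) = (\<Sum>i<length t. \<Sum>j<length t.
      f (bracket G (fst (t ! i)) (fst (t ! j))) (snd (t ! i)) (snd (t ! j)))" (is ?br1213)
    and "(\<Sum>(u, v, w)\<leftarrow>br1223 G t. f u v w) = (\<Sum>i<length t. \<Sum>j<length t.
      f (fst (t ! i)) (bracket G (snd (t ! i)) (fst (t ! j))) (snd (t ! j)))" (is ?br1223)
    and "(\<Sum>(u, v, w)\<leftarrow>br1323 G t. f u v w) = (\<Sum>i<length t. \<Sum>j<length t.
      f (fst (t ! i)) (fst (t ! j)) (bracket G (snd (t ! i)) (snd (t ! j))))" (is ?br1323)
proof -
  have *: "(\<Sum>z\<leftarrow>concat (map (\<lambda>p. map (h p) t) t). F z) = (\<Sum>i<length t. \<Sum>j<length t. F (h (t ! i) (t ! j)))"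
    for F :: "_ \<Rightarrow> real" and h :: "_ \<Rightarrow> _ \<Rightarrow> 'g tangent \<times> 'g tangent \<times> 'g tangent"
  proof -
    have "(\<Sum>z\<leftarrow>concat xss. F z) = (\<Sum>xs\<leftarrow>xss. \<Sum>z\<leftarrow>xs. F z)" for xss by (induction xss) simp_all
    then show ?thesis by (simp add: comp_def sum_list_sum_nth atLeast0LessThan)
  qed
  show ?br1213 ?br1223 ?br1323
    unfolding br1213_def br1223_def br1323_def by (simp_all add: case_prod_unfold *)
qed

definition bilinear_form_on :: "'g tangent set \<Rightarrow> ('g tangent \<Rightarrow> 'g tangent \<Rightarrow> real) \<Rightarrow> bool" where
  "bilinear_form_on V \<beta> \<longleftrightarrow> (\<forall>v\<in>V. linear_form_on V (\<beta> v)) \<and> (\<forall>v\<in>V. linear_form_on V (\<lambda>u. \<beta> u v))"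

lemma sum_skew_part:
  assumes t: "set t \<subseteq> V \<times> V" and \<beta>: "bilinear_form_on V \<beta>"
    and V: "\<And>v c. v \<in> V \<Longrightarrow> (\<lambda>a. c * v a) \<in> V"
  shows "(\<Sum>(u, v)\<leftarrow>skew_part t. \<beta> u v) = ((\<Sum>(u, v)\<leftarrow>t. \<beta> u v) - (\<Sum>(u, v)\<leftarrow>t. \<beta> v u)) / 2"
proof -
  have "\<beta> (\<lambda>a. u a / 2) v = \<beta> u v / 2" "\<beta> (\<lambda>a. - (u a / 2)) v = - (\<beta> u v / 2)" if "u \<in> V" "v \<in> V" for u v
  proof -
    have "\<beta> (\<lambda>a. c * u a) v = c * \<beta> u v" for c
      using \<beta> that by (simp add: bilinear_form_on_def linear_form_on_def)
    from this[of "1/2"] this[of "-1/2"] show "\<beta> (\<lambda>a. u a / 2) v = \<beta> u v / 2" "\<beta> (\<lambda>a. - (u a / 2)) v = - (\<beta> u v / 2)"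
      by simp_all
  qed
  with t have "(\<Sum>(u, v)\<leftarrow>skew_part t. \<beta> u v) = (\<Sum>(u, v)\<leftarrow>t. \<beta> u v / 2) + (\<Sum>(u, v)\<leftarrow>t. - (\<beta> v u / 2))"
    unfolding skew_part_def map_append map_map sum_list_append
    by (intro arg_cong2[where f = "(+)"] arg_cong[where f = sum_list] map_cong) auto
  then show ?thesis
    by (simp add: sum_list_pairs sum_divide_distrib[symmetric] sum_negf diff_divide_distrib)
qed

text \<open>
  The list \<open>skew_part t\<close> itself is not antisymmetric; its antisymmetry is seen by bilinear forms.
\<close>
lemma skew_part_swap:
  assumes t: "set t \<subseteq> V \<times> V" and \<beta>: "bilinear_form_on V \<beta>"
    and V: "\<And>v c. v \<in> V \<Longrightarrow> (\<lambda>a. c * v a) \<in> V"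
  shows "(\<Sum>(u, v)\<leftarrow>skew_part t. \<beta> u v) = - (\<Sum>(u, v)\<leftarrow>skew_part t. \<beta> v u)"
proof -
  have "bilinear_form_on V (\<lambda>u v. \<beta> v u)" using \<beta> by (auto simp: bilinear_form_on_def)
  from sum_skew_part[OF t this V] sum_skew_part[OF t \<beta> V] show ?thesis by simp
qed

section \<open>The canonical preconnection\<close>

locale quasitriangular_structure = lie_group_structure G
  for G :: "('g::{t2_space, second_countable_topology}, 'e::euclidean_space) lie" (structure) +
  fixes r :: "'g tensor2"
  assumes quasitriangular: "quasitriangular_poisson_lie_group G r"
begin

abbreviation "P \<equiv> pl_bracket G r"
abbreviation "\<gamma> \<equiv> canonical_preconnection G r"

lemma r_in: "set r \<subseteq> lie_algebra G \<times> lie_algebra G"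
  and poisson: "poisson_structure G P"
  using quasitriangular by (auto simp: quasitriangular_poisson_lie_group_def poisson_lie_group_def)

lemmas poisson_conjuncts = poisson[unfolded poisson_structure_def]

lemmas smooth_fun_P = poisson_conjuncts[THEN conjunct1, rule_format]
  and P_linear = poisson_conjuncts[THEN conjunct2, THEN conjunct1, rule_format]
  and P_skew = poisson_conjuncts[THEN conjunct2, THEN conjunct2, THEN conjunct1, rule_format]
  and P_jacobi = poisson_conjuncts[THEN conjunct2, THEN conjunct2, THEN conjunct2, THEN conjunct2, rule_format]

lemma lie_algebra_scale: "v \<in> lie_algebra G \<Longrightarrow> (\<lambda>a. c * v a) \<in> lie_algebra G"
  by (simp add: lie_algebra_eq tangent_space_scale)

text \<open>
  The summands of \<open>r\<^sub>-\<close>, so that \<open>r\<^sub>- = \<Sum>\<^sub>i r1 i \<otimes> r2 i\<close>.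
\<close>
definition "idx = {..<length (skew_part r)}"
definition "r1 i = fst (skew_part r ! i)"
definition "r2 i = snd (skew_part r ! i)"

lemma skew_part_in: "set (skew_part r) \<subseteq> lie_algebra G \<times> lie_algebra G"
proof -
  have "(\<lambda>a. v a / 2) \<in> lie_algebra G" "(\<lambda>a. - (v a / 2)) \<in> lie_algebra G" if "v \<in> lie_algebra G" for v
    using lie_algebra_scale[OF that, of "1/2"] lie_algebra_scale[OF that, of "-1/2"] by simp_all
  then show ?thesis using r_in by (auto simp: skew_part_def)
qed

lemma nth_in_Times: "set t \<subseteq> V \<times> V \<Longrightarrow> i < length t \<Longrightarrow> fst (t ! i) \<in> V \<and> snd (t ! i) \<in> V"
  by (drule subsetD, erule nth_mem) (simp add: mem_Times_iff)

lemma r_in_lie_algebra [simp]: "i \<in> idx \<Longrightarrow> r1 i \<in> lie_algebra G" "i \<in> idx \<Longrightarrow> r2 i \<in> lie_algebra G"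
  using nth_in_Times[OF skew_part_in] by (auto simp: idx_def r1_def r2_def)

lemma sum_r: "(\<Sum>(u, v)\<leftarrow>skew_part r. f u v) = (\<Sum>i\<in>idx. f (r1 i) (r2 i))"
  by (simp add: sum_list_pairs idx_def r1_def r2_def)

lemma sum_r_swap:
  "bilinear_form_on (lie_algebra G) \<beta> \<Longrightarrow> (\<Sum>i\<in>idx. \<beta> (r1 i) (r2 i)) = - (\<Sum>i\<in>idx. \<beta> (r2 i) (r1 i))"
  using skew_part_swap[OF r_in, of \<beta>] lie_algebra_scale by (simp add: sum_r)

lemma pl_bracket_raw:
  "P a b g = (\<Sum>(u, v)\<leftarrow>r. ltrans G g u a * ltrans G g v b) - (\<Sum>(u, v)\<leftarrow>r. rtrans G u g a * rtrans G v g b)"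
  unfolding pl_bracket_def bivector_def
  by (induction r) (auto simp: algebra_simps)

text \<open>
  The Poisson bracket is antisymmetric, so the symmetric part of \<open>r\<close> drops out of it at every point of
  the group, also away from the identity component.
\<close>
lemma pl_bracket_eq:
  assumes "smooth_fun G a" "smooth_fun G b"
  shows "P a b g = (\<Sum>i\<in>idx. inf_ract_fun G a (r1 i) g * inf_ract_fun G b (r2 i) g)
    - (\<Sum>i\<in>idx. inf_lact_fun G (r1 i) a g * inf_lact_fun G (r2 i) b g)"
proof -
  have bil: "bilinear_form_on (lie_algebra G) (\<lambda>u v. ltrans G g u a * ltrans G g v b)"
    "bilinear_form_on (lie_algebra G) (\<lambda>u v. rtrans G u g a * rtrans G v g b)"
    by (auto simp: bilinear_form_on_def linear_form_on_def ltrans_def rtrans_def algebra_simps)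
  have flip: "P b a g = (\<Sum>(u, v)\<leftarrow>r. ltrans G g v a * ltrans G g u b) - (\<Sum>(u, v)\<leftarrow>r. rtrans G v g a * rtrans G u g b)"
    unfolding pl_bracket_raw by (simp add: sum_list_pairs mult.commute)
  have "P a b g = (P a b g - P b a g) / 2"
    using fun_cong[OF P_skew[OF assms], of g] by simp
  also have "\<dots> = (\<Sum>(u, v)\<leftarrow>skew_part r. ltrans G g u a * ltrans G g v b)
      - (\<Sum>(u, v)\<leftarrow>skew_part r. rtrans G u g a * rtrans G v g b)"
    using sum_skew_part[OF r_in bil(1) lie_algebra_scale] sum_skew_part[OF r_in bil(2) lie_algebra_scale]
    unfolding flip by (simp add: pl_bracket_raw diff_divide_distrib)
  also have "\<dots> = (\<Sum>i\<in>idx. inf_ract_fun G a (r1 i) g * inf_ract_fun G b (r2 i) g)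
    - (\<Sum>i\<in>idx. inf_lact_fun G (r1 i) a g * inf_lact_fun G (r2 i) b g)"
    unfolding sum_r using assms by (simp add: inf_ract_fun_eq inf_lact_fun_eq)
  finally show ?thesis .
qed

lemma pl_bracket_eq_fun:
  assumes "smooth_fun G a" "smooth_fun G b"
  shows "P a b = (\<lambda>g. (\<Sum>i\<in>idx. inf_ract_fun G a (r1 i) g * inf_ract_fun G b (r2 i) g)
    - (\<Sum>i\<in>idx. inf_lact_fun G (r1 i) a g * inf_lact_fun G (r2 i) b g))"
  using pl_bracket_eq[OF assms] by blast

lemma canonical_outside: "X \<notin> tangent_space G g \<Longrightarrow> \<gamma> a \<tau> g X = 0"
  by (simp add: canonical_preconnection_def of_alg_def)

text \<open>
  The bracket term of the right action on forms is the coadjoint term in the definition of the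
  canonical preconnection; the remaining terms are the Poisson bracket with a component of \<open>\<tau>\<close>.
\<close>
lemma canonical_eq:
  assumes a: "smooth_fun G a" and \<tau>: "\<tau> \<in> one_forms G"
  shows "\<gamma> a \<tau> g X = (\<Sum>i\<in>idx. inf_ract_fun G a (r1 i) g * inf_ract_form G \<tau> (r2 i) g X)
    - (\<Sum>i\<in>idx. inf_lact_fun G (r1 i) a g * inf_lact_form G (r2 i) \<tau> g X)"
proof (cases "X \<in> tangent_space G g")
  case False
  then show ?thesis by (simp add: canonical_outside inf_form_outside \<tau>)
next
  case True
  obtain w where w: "w \<in> lie_algebra G" "X = ltrans G g w" using True by (rule tangent_spaceE)
  have app: "\<alpha> g X = to_alg G \<alpha> g w" for \<alpha> by (simp add: to_alg_def w(2))
  let ?s = "\<lambda>h. to_alg G \<tau> h w"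
  note s = smooth_fun_to_alg[OF \<tau> w(1)]
  have skew: "to_alg G \<tau> g (bracket G w v) = - to_alg G \<tau> g (bracket G v w)" if "v \<in> lie_algebra G" for v
  proof -
    have "to_alg G \<tau> g (\<lambda>a. -1 * bracket G v w a) = -1 * to_alg G \<tau> g (bracket G v w)"
      using one_form_to_alg_linear[OF \<tau>, of g] bracket_in_lie_algebra[OF that w(1)]
      unfolding linear_form_on_def by blast
    then show ?thesis unfolding bracket_skew[of w v] by simp
  qed
  have "\<gamma> a \<tau> g X = canonical_alg G r a (to_alg G \<tau>) g w"
    unfolding app canonical_preconnection_def to_alg_of_alg[OF w(1)] ..
  also have "\<dots> = P a ?s g + (\<Sum>i\<in>idx. ltrans G g (r1 i) a * to_alg G \<tau> g (bracket G w (r2 i)))"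
    by (simp add: canonical_alg_def coad_def sum_r)
  also have "\<dots> = (\<Sum>i\<in>idx. inf_ract_fun G a (r1 i) g * to_alg G (inf_ract_form G \<tau> (r2 i)) g w)
    - (\<Sum>i\<in>idx. inf_lact_fun G (r1 i) a g * to_alg G (inf_lact_form G (r2 i) \<tau>) g w)"
    unfolding pl_bracket_eq[OF a s]
    by (simp add: inf_ract_fun_eq inf_lact_fun_eq a s to_alg_inf_ract_form to_alg_inf_lact_form \<tau> w(1) skew
        sum.distrib[symmetric] algebra_simps sum_subtractf)
  finally show ?thesis unfolding app .
qed

lemma canonical_eq_fun:
  assumes "smooth_fun G a" "\<tau> \<in> one_forms G"
  shows "\<gamma> a \<tau> = (\<lambda>g X. (\<Sum>i\<in>idx. inf_ract_fun G a (r1 i) g * inf_ract_form G \<tau> (r2 i) g X)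
    - (\<Sum>i\<in>idx. inf_lact_fun G (r1 i) a g * inf_lact_form G (r2 i) \<tau> g X))"
  using canonical_eq[OF assms] by blast

lemma canonical_summands:
  assumes "smooth_fun G a" "\<tau> \<in> one_forms G"
  shows "(\<lambda>g X. \<Sum>i\<in>idx. inf_ract_fun G a (r1 i) g * inf_ract_form G \<tau> (r2 i) g X) \<in> one_forms G"
    "(\<lambda>g X. \<Sum>i\<in>idx. inf_lact_fun G (r1 i) a g * inf_lact_form G (r2 i) \<tau> g X) \<in> one_forms G"
  by (intro one_forms_lincomb smooth_fun_inf inf_ract_form_in_one_forms inf_lact_form_in_one_forms assms; simp)+

lemma canonical_in_one_forms:
  assumes "smooth_fun G a" "\<tau> \<in> one_forms G"
  shows "\<gamma> a \<tau> \<in> one_forms G"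
  unfolding canonical_eq_fun[OF assms] by (rule one_forms_diff[OF canonical_summands[OF assms]])

lemma canonical_preconnection: "preconnection G P \<gamma>"
  unfolding preconnection_def
proof (intro conjI allI impI ext)
  fix x y \<tau> g X assume x: "smooth_fun G x" and y: "smooth_fun G y" and \<tau>: "\<tau> \<in> one_forms G"
  note [simp] = x y \<tau>
  have fun_mult: "inf_ract_fun G (\<lambda>g. x g * y g) v g = inf_ract_fun G x v g * y g + x g * inf_ract_fun G y v g"
    "inf_lact_fun G v (\<lambda>g. x g * y g) g = inf_lact_fun G v x g * y g + x g * inf_lact_fun G v y g"
    if "v \<in> lie_algebra G" for v
    using inf_fun_lincomb[OF that, of "{()}" "\<lambda>_. x" "\<lambda>_. y" g] by simp_all
  have form_mult: "inf_ract_form G (\<lambda>g X. \<tau> g X * y g) v g X = inf_ract_fun G y v g * \<tau> g X + y g * inf_ract_form G \<tau> v g X"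
    "inf_lact_form G v (\<lambda>g X. \<tau> g X * y g) g X = inf_lact_fun G v y g * \<tau> g X + y g * inf_lact_form G v \<tau> g X"
    if "v \<in> lie_algebra G" for v
    using inf_form_lincomb[OF that, of "{()}" "\<lambda>_. y" "\<lambda>_. \<tau>" g X] by (simp_all add: mult.commute)
  have \<tau>y: "(\<lambda>g X. \<tau> g X * y g) \<in> one_forms G"
    using one_forms_lincomb[of "{()}" "\<lambda>_. y" "\<lambda>_. \<tau>"] by (simp add: mult.commute)
  show "\<gamma> (\<lambda>g. x g * y g) \<tau> g X = x g * \<gamma> y \<tau> g X + \<gamma> x \<tau> g X * y g"
    by (simp add: canonical_eq smooth_fun_mult fun_mult algebra_simps sum.distrib sum_distrib_left)
  show "\<gamma> x (\<lambda>g X. \<tau> g X * y g) g X = \<gamma> x \<tau> g X * y g + \<tau> g X * P x y g"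
    unfolding canonical_eq[OF x \<tau>y]
    by (simp add: form_mult cong: sum.cong)
      (simp add: canonical_eq pl_bracket_eq distrib_left distrib_right left_diff_distrib right_diff_distrib sum.distrib sum_distrib_left sum_distrib_right mult_ac)
qed (rule canonical_in_one_forms)

lemma bilinear_inf:
  "bilinear_form_on (lie_algebra G) (\<lambda>u v. inf_ract_fun G x u g * inf_ract_fun G f v h)"
  "bilinear_form_on (lie_algebra G) (\<lambda>u v. inf_lact_fun G u x g * inf_lact_fun G v f h)"
  "bilinear_form_on (lie_algebra G) (\<lambda>u v. inf_ract_fun G x u g * inf_ract_form G \<tau> v h X)"
  "bilinear_form_on (lie_algebra G) (\<lambda>u v. inf_lact_fun G u x g * inf_lact_form G v \<tau> h X)"
  by (auto simp: bilinear_form_on_def linear_form_on_def inf_ract_fun_def inf_lact_fun_def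
      inf_ract_form_def inf_lact_form_def algebra_simps)

text \<open>
  Apply the exterior derivative to the products in the formula for the bracket. Since it commutes
  with the actions, one half of the terms is \<open>\<gamma> x (ext_d G y)\<close>, and by skewness of \<open>r\<^sub>-\<close> the other half
  is \<open>- \<gamma> y (ext_d G x)\<close>.
\<close>
lemma canonical_compatible: "compatible G P \<gamma>"
  unfolding compatible_def
proof (intro allI impI ext)
  fix x y g X assume x: "smooth_fun G x" and y: "smooth_fun G y"
  show "ext_d G (P x y) g X = \<gamma> x (ext_d G y) g X - \<gamma> y (ext_d G x) g X"
  proof (cases "X \<in> tangent_space G g")
    case True
    have d: "inf_ract_form G (ext_d G f) v g X = X (inf_ract_fun G f v)"
      "inf_lact_form G v (ext_d G f) g X = X (inf_lact_fun G v f)"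
      if "v \<in> lie_algebra G" "smooth_fun G f" for v f
      unfolding inf_form_ext_d[OF that] using True by (simp_all add: ext_d_def)
    note s = smooth_fun_inf smooth_fun_mult smooth_fun_sum x y
    have "ext_d G (P x y) g X = X (\<lambda>g. (\<Sum>i\<in>idx. inf_ract_fun G x (r1 i) g * inf_ract_fun G y (r2 i) g)
      - (\<Sum>i\<in>idx. inf_lact_fun G (r1 i) x g * inf_lact_fun G (r2 i) y g))"
      using True by (simp add: ext_d_def pl_bracket_eq_fun[OF x y])
    also have "\<dots> = (\<Sum>i\<in>idx. X (\<lambda>g. inf_ract_fun G x (r1 i) g * inf_ract_fun G y (r2 i) g))
      - (\<Sum>i\<in>idx. X (\<lambda>g. inf_lact_fun G (r1 i) x g * inf_lact_fun G (r2 i) y g))"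
      by (simp add: tangent_diff[OF True] tangent_sum[OF True] s)
    also have "\<dots> = (\<Sum>i\<in>idx. X (inf_ract_fun G x (r1 i)) * inf_ract_fun G y (r2 i) g
        + inf_ract_fun G x (r1 i) g * X (inf_ract_fun G y (r2 i)))
      - (\<Sum>i\<in>idx. X (inf_lact_fun G (r1 i) x) * inf_lact_fun G (r2 i) y g
        + inf_lact_fun G (r1 i) x g * X (inf_lact_fun G (r2 i) y))"
      by (simp add: tangent_mult[OF True] s)
    also have "\<dots> = \<gamma> x (ext_d G y) g X + (\<Sum>i\<in>idx. inf_ract_fun G y (r2 i) g * inf_ract_form G (ext_d G x) (r1 i) g X)
      - (\<Sum>i\<in>idx. inf_lact_fun G (r2 i) y g * inf_lact_form G (r1 i) (ext_d G x) g X)"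
      by (simp add: canonical_eq x y ext_d_in_one_forms d sum.distrib algebra_simps)
    also have "\<dots> = \<gamma> x (ext_d G y) g X - \<gamma> y (ext_d G x) g X"
      unfolding canonical_eq[OF y ext_d_in_one_forms[OF x]]
        sum_r_swap[OF bilinear_inf(3)] sum_r_swap[OF bilinear_inf(4)] by simp
    finally show ?thesis .
  qed (simp add: canonical_outside ext_d_def)
qed

section \<open>Curvature and torsion\<close>

abbreviation dsum :: "(nat \<Rightarrow> nat \<Rightarrow> real) \<Rightarrow> real" where
  "dsum f \<equiv> \<Sum>i\<in>idx. \<Sum>j\<in>idx. f i j"

lemma dsum_cong: "(\<And>i j. i \<in> idx \<Longrightarrow> j \<in> idx \<Longrightarrow> f i j = h i j) \<Longrightarrow> dsum f = dsum h"
  by (intro sum.cong refl) auto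

lemma dsum_flip: "dsum f = dsum (\<lambda>i j. f j i)"
  by (rule sum.swap)

text \<open>
  Skewness of one copy of \<open>r\<^sub>-\<close>, the summand \<open>j\<close> of the other copy being fixed.
\<close>
lemma dsum_r_swap:
  assumes "\<And>j. j \<in> idx \<Longrightarrow> bilinear_form_on (lie_algebra G) (\<beta> j)"
  shows "dsum (\<lambda>i j. \<beta> j (r1 i) (r2 i) * c j) = dsum (\<lambda>i j. - (\<beta> j (r2 i) (r1 i) * c j))"
proof -
  have "dsum (\<lambda>i j. \<beta> j (r1 i) (r2 i) * c j) = (\<Sum>j\<in>idx. (\<Sum>i\<in>idx. \<beta> j (r1 i) (r2 i)) * c j)"
    unfolding sum_distrib_right by (rule sum.swap)
  also have "\<dots> = (\<Sum>j\<in>idx. - (\<Sum>i\<in>idx. \<beta> j (r2 i) (r1 i)) * c j)"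
    by (intro sum.cong refl) (simp add: sum_r_swap assms)
  also have "\<dots> = dsum (\<lambda>i j. - (\<beta> j (r2 i) (r1 i) * c j))"
    by (subst sum.swap) (simp add: sum_distrib_right sum_negf)
  finally show ?thesis .
qed

lemma inf_form_canonical:
  assumes v: "v \<in> lie_algebra G" and y: "smooth_fun G y" and \<tau>: "\<tau> \<in> one_forms G"
  shows "inf_ract_form G (\<gamma> y \<tau>) v g X =
    (\<Sum>j\<in>idx. inf_ract_fun G (inf_ract_fun G y (r1 j)) v g * inf_ract_form G \<tau> (r2 j) g X
      + inf_ract_fun G y (r1 j) g * inf_ract_form G (inf_ract_form G \<tau> (r2 j)) v g X)
    - (\<Sum>j\<in>idx. inf_ract_fun G (inf_lact_fun G (r1 j) y) v g * inf_lact_form G (r2 j) \<tau> g X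
      + inf_lact_fun G (r1 j) y g * inf_ract_form G (inf_lact_form G (r2 j) \<tau>) v g X)"
    "inf_lact_form G v (\<gamma> y \<tau>) g X =
    (\<Sum>j\<in>idx. inf_lact_fun G v (inf_ract_fun G y (r1 j)) g * inf_ract_form G \<tau> (r2 j) g X
      + inf_ract_fun G y (r1 j) g * inf_lact_form G v (inf_ract_form G \<tau> (r2 j)) g X)
    - (\<Sum>j\<in>idx. inf_lact_fun G v (inf_lact_fun G (r1 j) y) g * inf_lact_form G (r2 j) \<tau> g X
      + inf_lact_fun G (r1 j) y g * inf_lact_form G v (inf_lact_form G (r2 j) \<tau>) g X)"
  unfolding canonical_eq_fun[OF y \<tau>] inf_form_diff[OF v canonical_summands[OF y \<tau>]]
  using y \<tau>
  by (simp_all add: inf_form_lincomb[OF v] smooth_fun_inf inf_ract_form_in_one_forms inf_lact_form_in_one_forms)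

lemma inf_fun_pl_bracket:
  assumes v: "v \<in> lie_algebra G" and x: "smooth_fun G x" and y: "smooth_fun G y"
  shows "inf_ract_fun G (P x y) v g =
    (\<Sum>j\<in>idx. inf_ract_fun G (inf_ract_fun G x (r1 j)) v g * inf_ract_fun G y (r2 j) g
      + inf_ract_fun G x (r1 j) g * inf_ract_fun G (inf_ract_fun G y (r2 j)) v g)
    - (\<Sum>j\<in>idx. inf_ract_fun G (inf_lact_fun G (r1 j) x) v g * inf_lact_fun G (r2 j) y g
      + inf_lact_fun G (r1 j) x g * inf_ract_fun G (inf_lact_fun G (r2 j) y) v g)" (is ?right)
    "inf_lact_fun G v (P x y) g =
    (\<Sum>j\<in>idx. inf_lact_fun G v (inf_ract_fun G x (r1 j)) g * inf_ract_fun G y (r2 j) g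
      + inf_ract_fun G x (r1 j) g * inf_lact_fun G v (inf_ract_fun G y (r2 j)) g)
    - (\<Sum>j\<in>idx. inf_lact_fun G v (inf_lact_fun G (r1 j) x) g * inf_lact_fun G (r2 j) y g
      + inf_lact_fun G (r1 j) x g * inf_lact_fun G v (inf_lact_fun G (r2 j) y) g)" (is ?left)
proof -
  have s: "smooth_fun G (\<lambda>g. \<Sum>i\<in>idx. inf_ract_fun G x (r1 i) g * inf_ract_fun G y (r2 i) g)"
    "smooth_fun G (\<lambda>g. \<Sum>i\<in>idx. inf_lact_fun G (r1 i) x g * inf_lact_fun G (r2 i) y g)"
    by (intro smooth_fun_sum smooth_fun_mult smooth_fun_inf x y; simp)+
  show ?right ?left
    unfolding pl_bracket_eq_fun[OF x y] inf_fun_diff[OF v s]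
    using x y by (simp_all add: inf_fun_lincomb[OF v] smooth_fun_inf)
qed

text \<open>
  All three terms of the curvature expand into double sums over two copies of \<open>r\<^sub>-\<close>, and the summands
  are compared after suitable exchanges. The second derivatives of \<open>\<tau>\<close> form commutators of second
  legs, giving \<open>[r\<^sub>1\<^sub>3, r\<^sub>2\<^sub>3]\<close>. The second derivatives of \<open>y\<close> in \<open>\<gamma> x (\<gamma> y \<tau>)\<close> and in \<open>\<gamma> {x, y} \<tau>\<close> form
  commutators of a second with a first leg, giving \<open>[r\<^sub>1\<^sub>2, r\<^sub>2\<^sub>3]\<close>, and those of \<open>x\<close> in \<open>\<gamma> y (\<gamma> x \<tau>)\<close> and
  \<open>\<gamma> {x, y} \<tau>\<close> form commutators of first legs, giving \<open>[r\<^sub>1\<^sub>2, r\<^sub>1\<^sub>3]\<close>. Terms with both actions cancel,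
  because the actions commute.

  In the proof, \<open>a\<close>, \<open>A\<close> and \<open>b\<close>, \<open>B\<close> abbreviate the right and the left action at \<open>(g, X)\<close> on functions and on
  \<open>\<tau>\<close>, and double letters are iterated actions, where the first vector acts first.
\<close>
lemma canonical_curvature:
  assumes x: "smooth_fun G x" and y: "smooth_fun G y" and \<tau>: "\<tau> \<in> one_forms G"
  shows "curvature P \<gamma> x y \<tau> g X =
     (\<Sum>(u, v, w)\<leftarrow>schouten G (skew_part r).
       inf_lact_fun G u x g * inf_lact_fun G v y g * inf_lact_form G w \<tau> g X) -
     (\<Sum>(u, v, w)\<leftarrow>schouten G (skew_part r).
       inf_ract_fun G x u g * inf_ract_fun G y v g * inf_ract_form G \<tau> w g X)"
proof -
  define a b where "a f u = inf_ract_fun G f u g" and "b f u = inf_lact_fun G u f g" for f u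
  define aa ab bb where "aa f u v = a (inf_ract_fun G f u) v"
    and "ab f u v = a (inf_lact_fun G u f) v"
    and "bb f u v = b (inf_lact_fun G u f) v" for f u v
  define A B where "A u = inf_ract_form G \<tau> u g X" and "B u = inf_lact_form G u \<tau> g X" for u
  define AA AB BB where "AA u v = inf_ract_form G (inf_ract_form G \<tau> u) v g X"
    and "AB u v = inf_ract_form G (inf_lact_form G u \<tau>) v g X"
    and "BB u v = inf_lact_form G v (inf_lact_form G u \<tau>) g X" for u v
  note folds = a_def[symmetric] b_def[symmetric] aa_def[symmetric] ab_def[symmetric] bb_def[symmetric]
    A_def[symmetric] B_def[symmetric] AA_def[symmetric] AB_def[symmetric] BB_def[symmetric]
  have ba: "b (inf_ract_fun G f v) u = ab f u v"
    if "u \<in> lie_algebra G" "v \<in> lie_algebra G" "smooth_fun G f" for u v f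
    using inf_fun_commute(1)[OF that] by (simp add: ab_def a_def b_def)
  have BA: "inf_lact_form G u (inf_ract_form G \<tau> v) g X = AB u v"
    if "u \<in> lie_algebra G" "v \<in> lie_algebra G" for u v
    using inf_form_commute(1)[OF that \<tau>] by (simp add: AB_def)
  have brackets: "a f (bracket G u v) = aa f u v - aa f v u" "b f (bracket G u v) = bb f v u - bb f u v"
    if "u \<in> lie_algebra G" "v \<in> lie_algebra G" "smooth_fun G f" for u v f
    using inf_fun_commute(2,3)[OF that] by (simp_all add: a_def b_def aa_def bb_def)
  have form_brackets: "A (bracket G u v) = AA u v - AA v u" "B (bracket G u v) = BB v u - BB u v"
    if "u \<in> lie_algebra G" "v \<in> lie_algebra G" for u v
    using inf_form_commute(2,3)[OF that \<tau>] by (simp_all add: A_def B_def AA_def BB_def)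
  \<comment> \<open>The first four sums hold the second derivatives of \<open>y'\<close>, the last one those of \<open>\<tau>\<close>; they need
    different exchanges below.\<close>
  have double: "\<gamma> x' (\<gamma> y' \<tau>) g X =
      dsum (\<lambda>i j. a x' (r1 i) * aa y' (r1 j) (r2 i) * A (r2 j)) - dsum (\<lambda>i j. a x' (r1 i) * ab y' (r1 j) (r2 i) * B (r2 j))
      - dsum (\<lambda>i j. b x' (r1 i) * ab y' (r2 i) (r1 j) * A (r2 j)) + dsum (\<lambda>i j. b x' (r1 i) * bb y' (r1 j) (r2 i) * B (r2 j))
      + dsum (\<lambda>i j. a x' (r1 i) * a y' (r1 j) * AA (r2 j) (r2 i) - a x' (r1 i) * b y' (r1 j) * AB (r2 j) (r2 i)
         - b x' (r1 i) * a y' (r1 j) * AB (r2 i) (r2 j) + b x' (r1 i) * b y' (r1 j) * BB (r2 j) (r2 i))"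
    if "smooth_fun G x'" "smooth_fun G y'" for x' y'
    using that \<tau>
    by (simp add: canonical_eq canonical_in_one_forms inf_form_canonical folds ba BA
        sum.distrib sum_subtractf sum_distrib_left algebra_simps)
  \<comment> \<open>Exchanging the legs of the outer copy in \<open>\<gamma> y (\<gamma> x \<tau>)\<close> makes its second derivatives of \<open>x\<close> involve
    only first legs, as do those in \<open>\<gamma> {x, y} \<tau>\<close>.\<close>
  have skew: "dsum (\<lambda>i j. a y (r1 i) * aa x (r1 j) (r2 i) * A (r2 j)) = dsum (\<lambda>i j. - (a y (r2 i) * aa x (r1 j) (r1 i) * A (r2 j)))"
    "dsum (\<lambda>i j. a y (r1 i) * ab x (r1 j) (r2 i) * B (r2 j)) = dsum (\<lambda>i j. - (a y (r2 i) * ab x (r1 j) (r1 i) * B (r2 j)))"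
    "dsum (\<lambda>i j. b y (r1 i) * bb x (r1 j) (r2 i) * B (r2 j)) = dsum (\<lambda>i j. - (b y (r2 i) * bb x (r1 j) (r1 i) * B (r2 j)))"
    unfolding aa_def ab_def bb_def a_def b_def
    by (intro dsum_r_swap bilinear_inf)+
  have skew': "dsum (\<lambda>i j. b y (r1 i) * ab x (r2 i) (r1 j) * A (r2 j)) = dsum (\<lambda>i j. - (b y (r2 i) * ab x (r1 i) (r1 j) * A (r2 j)))"
  proof -
    have "dsum (\<lambda>i j. b y (r1 i) * b (inf_ract_fun G x (r1 j)) (r2 i) * A (r2 j)) =
        dsum (\<lambda>i j. - (b y (r2 i) * b (inf_ract_fun G x (r1 j)) (r1 i) * A (r2 j)))"
      unfolding b_def by (intro dsum_r_swap bilinear_inf)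
    then show ?thesis using x by (simp add: ba)
  qed
  have "\<gamma> (P x y) \<tau> g X =
      dsum (\<lambda>i j. (aa x (r1 j) (r1 i) * a y (r2 j) + a x (r1 j) * aa y (r2 j) (r1 i)
        - ab x (r1 j) (r1 i) * b y (r2 j) - b x (r1 j) * ab y (r2 j) (r1 i)) * A (r2 i)
       - (ab x (r1 i) (r1 j) * a y (r2 j) + a x (r1 j) * ab y (r1 i) (r2 j)
        - bb x (r1 j) (r1 i) * b y (r2 j) - b x (r1 j) * bb y (r2 j) (r1 i)) * B (r2 i))"
    using x y \<tau>
    by (simp add: canonical_eq smooth_fun_P inf_fun_pl_bracket[where g = g, folded a_def b_def] folds ba
        sum.distrib sum_subtractf sum_distrib_left sum_distrib_right algebra_simps)
  \<comment> \<open>After exchanging the two copies, \<open>\<tau>\<close> carries the leg of the copy \<open>j\<close>, as in \<open>double\<close>.\<close>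
  note single = trans[OF this dsum_flip]
  have second: "dsum (\<lambda>i j. a y (r1 i) * a x (r1 j) * AA (r2 j) (r2 i) - a y (r1 i) * b x (r1 j) * AB (r2 j) (r2 i)
         - b y (r1 i) * a x (r1 j) * AB (r2 i) (r2 j) + b y (r1 i) * b x (r1 j) * BB (r2 j) (r2 i)) =
      dsum (\<lambda>i j. a y (r1 j) * a x (r1 i) * AA (r2 i) (r2 j) - a y (r1 j) * b x (r1 i) * AB (r2 i) (r2 j)
         - b y (r1 j) * a x (r1 i) * AB (r2 j) (r2 i) + b y (r1 j) * b x (r1 i) * BB (r2 i) (r2 j))"
    by (rule dsum_flip)
  have target: "(\<Sum>(u, v, w)\<leftarrow>schouten G (skew_part r). f u v w) =
      dsum (\<lambda>i j. f (bracket G (r1 i) (r1 j)) (r2 i) (r2 j) + f (r1 i) (bracket G (r2 i) (r1 j)) (r2 j)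
        + f (r1 i) (r1 j) (bracket G (r2 i) (r2 j)))" for f :: "'g tangent \<Rightarrow> 'g tangent \<Rightarrow> 'g tangent \<Rightarrow> real"
    unfolding schouten_def map_append sum_list_append sum_list_br
    by (simp add: idx_def r1_def r2_def sum.distrib)
  show ?thesis
    unfolding curvature_def double[OF x y] double[OF y x] skew skew' second single target folds
    unfolding sum.distrib[symmetric] sum_subtractf[symmetric]
    by (rule dsum_cong) (simp add: brackets form_brackets x y algebra_simps)
qed

lemma hamiltonian_in_tangent_space: "hamiltonian P x g \<in> tangent_space G g"
proof -
  have "hamiltonian P x g = (\<lambda>a. (\<Sum>i<length r. ltrans G g (fst (r ! i)) x * ltrans G g (snd (r ! i)) a)
     + (\<Sum>i<length r. - rtrans G (fst (r ! i)) g x * rtrans G (snd (r ! i)) g a))"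
    by (simp add: hamiltonian_def pl_bracket_raw sum_list_pairs sum_negf)
  also have "\<dots> \<in> tangent_space G g"
    using nth_in_Times[OF r_in]
    by (intro tangent_space_add tangent_space_sum tangent_space_scale ltrans_lie_algebra rtrans_lie_algebra) auto
  finally show ?thesis .
qed

lemma pairing_hamiltonian_ext_d: "pairing (hamiltonian P x) (ext_d G z) = P x z"
  using hamiltonian_in_tangent_space[of x] by (intro ext) (simp add: pairing_def ext_d_def, simp add: hamiltonian_def)

lemma pairing_hamiltonian_canonical:
  assumes x: "smooth_fun G x" and z: "smooth_fun G z"
  shows "pairing (hamiltonian P y) (\<gamma> x (ext_d G z)) g =
    (\<Sum>i\<in>idx. inf_ract_fun G x (r1 i) g * P y (inf_ract_fun G z (r2 i)) g)
    - (\<Sum>i\<in>idx. inf_lact_fun G (r1 i) x g * P y (inf_lact_fun G (r2 i) z) g)"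
  using pairing_hamiltonian_ext_d[of y, THEN fun_cong, of _ g]
  by (simp add: pairing_def canonical_eq x ext_d_in_one_forms z inf_form_ext_d)

text \<open>
  The Jacobi identity cancels the terms of the torsion without \<open>\<gamma>\<close>. What remains is
  \<open>\<gamma> y (ext_d G z)\<close> on the Hamiltonian field of \<open>x\<close> minus \<open>\<gamma> x (ext_d G z)\<close> on that of \<open>y\<close>. Its second
  derivatives fall on \<open>z\<close> only, and the antisymmetry in \<open>x\<close> and \<open>y\<close> turns them into commutators of
  second legs.
\<close>
lemma canonical_torsion:
  assumes x: "smooth_fun G x" and y: "smooth_fun G y" and z: "smooth_fun G z"
  shows "torsion_pairing P \<gamma> x y (ext_d G z) g =
     (\<Sum>(u, v, w)\<leftarrow>br1323 G (skew_part r).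
        inf_lact_fun G u x g * inf_lact_fun G v y g * inf_lact_fun G w z g) -
     (\<Sum>(u, v, w)\<leftarrow>br1323 G (skew_part r).
        inf_ract_fun G x u g * inf_ract_fun G y v g * inf_ract_fun G z w g)"
proof -
  have jacobi: "P x (P y z) g - P y (P x z) g - P (P x y) z g = 0"
  proof -
    have "P y (P z x) g = - P y (P x z) g"
      using P_linear[OF y smooth_fun_P[OF x z] smooth_fun_const[of 0], of "-1" 0, THEN fun_cong, of g]
      unfolding P_skew[OF z x] by simp
    moreover have "P z (P x y) g = - P (P x y) z g"
      using P_skew[OF z smooth_fun_P[OF x y]] by (rule fun_cong)
    ultimately show ?thesis using P_jacobi[OF x y z, of g] by simp
  qed
  define a b where "a f u = inf_ract_fun G f u g" and "b f u = inf_lact_fun G u f g" for f u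
  define aa ab bb where "aa u v = a (inf_ract_fun G z u) v"
    and "ab u v = a (inf_lact_fun G u z) v"
    and "bb u v = b (inf_lact_fun G u z) v" for u v
  note folds = a_def[symmetric] b_def[symmetric] aa_def[symmetric] ab_def[symmetric] bb_def[symmetric]
  have ba: "b (inf_ract_fun G z v) u = ab u v"
    if "u \<in> lie_algebra G" "v \<in> lie_algebra G" for u v
    using inf_fun_commute(1)[OF that z] by (simp add: ab_def a_def b_def)
  have brackets: "a z (bracket G u v) = aa u v - aa v u" "b z (bracket G u v) = bb v u - bb u v"
    if "u \<in> lie_algebra G" "v \<in> lie_algebra G" for u v
    using inf_fun_commute(2,3)[OF that z] by (simp_all add: a_def b_def aa_def bb_def)
  have pair: "pairing (hamiltonian P y') (\<gamma> x' (ext_d G z)) g =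
      dsum (\<lambda>i j. a x' (r1 i) * (a y' (r1 j) * aa (r2 i) (r2 j) - b y' (r1 j) * ab (r2 j) (r2 i))
        - b x' (r1 i) * (a y' (r1 j) * ab (r2 i) (r2 j) - b y' (r1 j) * bb (r2 i) (r2 j)))"
    if "smooth_fun G x'" "smooth_fun G y'" for x' y'
    using that z
    by (simp add: pairing_hamiltonian_canonical pl_bracket_eq smooth_fun_inf folds ba
        sum.distrib sum_subtractf sum_distrib_left algebra_simps)
  have "torsion_pairing P \<gamma> x y (ext_d G z) g =
      pairing (hamiltonian P x) (\<gamma> y (ext_d G z)) g - pairing (hamiltonian P y) (\<gamma> x (ext_d G z)) g"
    using jacobi by (simp add: torsion_pairing_def nabla_pairing_def pairing_hamiltonian_ext_d)
  also have "\<dots> = dsum (\<lambda>i j. b x (r1 i) * b y (r1 j) * b z (bracket G (r2 i) (r2 j)))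
      - dsum (\<lambda>i j. a x (r1 i) * a y (r1 j) * a z (bracket G (r2 i) (r2 j)))"
    unfolding pair[OF x y] trans[OF pair[OF y x] dsum_flip] sum_subtractf[symmetric]
    by (rule dsum_cong) (simp add: brackets algebra_simps)
  finally show ?thesis
    unfolding sum_list_br folds by (simp add: idx_def r1_def r2_def)
qed

end

theorem proposition4p19:
  fixes G :: "('g::{t2_space, second_countable_topology}, 'e::euclidean_space) lie"
    and r :: "'g tensor2"
  assumes "quasitriangular_poisson_lie_group G r"
  shows
    "preconnection G (pl_bracket G r) (canonical_preconnection G r) \<and>
     compatible G (pl_bracket G r) (canonical_preconnection G r) \<and>
     (\<forall>a \<tau>. smooth_fun G a \<longrightarrow> \<tau> \<in> one_forms G \<longrightarrow>
        canonical_preconnection G r a \<tau> = (\<lambda>g X.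
          (\<Sum>(u, v)\<leftarrow>skew_part r. inf_ract_fun G a u g * inf_ract_form G \<tau> v g X) -
          (\<Sum>(u, v)\<leftarrow>skew_part r. inf_lact_fun G u a g * inf_lact_form G v \<tau> g X))) \<and>
     (\<forall>x y \<tau>. smooth_fun G x \<longrightarrow> smooth_fun G y \<longrightarrow> \<tau> \<in> one_forms G \<longrightarrow>
        curvature (pl_bracket G r) (canonical_preconnection G r) x y \<tau> = (\<lambda>g X.
          (\<Sum>(u, v, w)\<leftarrow>schouten G (skew_part r).
             inf_lact_fun G u x g * inf_lact_fun G v y g * inf_lact_form G w \<tau> g X) -
          (\<Sum>(u, v, w)\<leftarrow>schouten G (skew_part r).
             inf_ract_fun G x u g * inf_ract_fun G y v g * inf_ract_form G \<tau> w g X))) \<and>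
     (\<forall>x y z. smooth_fun G x \<longrightarrow> smooth_fun G y \<longrightarrow> smooth_fun G z \<longrightarrow>
        torsion_pairing (pl_bracket G r) (canonical_preconnection G r) x y (ext_d G z) = (\<lambda>g.
          (\<Sum>(u, v, w)\<leftarrow>br1323 G (skew_part r).
             inf_lact_fun G u x g * inf_lact_fun G v y g * inf_lact_fun G w z g) -
          (\<Sum>(u, v, w)\<leftarrow>br1323 G (skew_part r).
             inf_ract_fun G x u g * inf_ract_fun G y v g * inf_ract_fun G z w g)))"
proof -
  interpret quasitriangular_structure G r
    using assms by unfold_locales (simp_all add: quasitriangular_poisson_lie_group_def poisson_lie_group_def)
  show ?thesis
    by (intro conjI allI impI ext canonical_preconnection canonical_compatible)
      (simp_all add: canonical_curvature canonical_torsion canonical_eq sum_r)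
qed

end
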